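(* Let $R=\mathbb{R}[x_1,\dots,x_d]$ and $\mathfrak{m}=(x_1,\dots,x_d)$, let $I\subset R$ be an ideal of codimension $d$ minimally generated by $\nu(\mathfrak{m}^2)-1$ quadrics, and let $r+1$ be the Cohen–Macaulay type of $I$. Then, up to a change of variables, $$I=(x_1,\dots,x_r)\mathfrak{m}+I_{d-r}R,$$ where $I_{d-r}$ is a Gorenstein ideal of $\mathbb{R}[x_{r+1},\dots,x_d]$. With additional changes of variables $I$ can be written as $$(\ast)\qquad I=K_{r,d}+K_{d-r}+(x_1^2,\dots,x_r^2)+(x_{r+1}^2\pm x_{r+2}^2,\ \dots,\ x_{r+1}^2\pm x_d^2)$$ for some choice of signs, where $K_{r,d}=(x_ix_j \mid 1\le i\le r,\ i<j\le d)$, so that $K_{r,d}+(x_1^2,\dots,x_r^2)=(x_1,\dots,x_r)(x_1,\dots,x_d)$, and $K_{d-r}=(x_ix_j\mid r+1\le i<j\le d)$ is the edge ideal of the complete graph on the vertex set $\{x_{r+1},\dots,x_d\}$. In particular, $I$ is generated by monomials together with $d-r-1$ binomials. Conversely, over any field $K$, any ideal of $K[x_1,\dots,x_d]$ of codimension $d$ minimally generated by $\nu(\mathfrak{m}^2)-1$ quadrics and of the form $(\ast)$ has Cohen–Macaulay type $r+1$.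
   Context: A quadric is a homogeneous polynomial of degree $2$. $\nu(\cdot)$ denotes the minimal number of generators, so $\nu(\mathfrak{m}^2)=\binom{d+1}{2}$. An ideal $I$ of a polynomial ring is called Gorenstein if the quotient ring by it is Gorenstein. The Cohen–Macaulay type of an ideal $I$ with $R/I$ Artinian (local or graded) is the vector space dimension of the socle of $R/I$. A change of variables means an invertible linear change of the variables over the base field. *)

theory Defs
  imports
    Complex_Main
    "HOL-Library.Poly_Mapping"
    "HOL-Library.Extended_Nat"
    "HOL-Algebra.Module"
    "HOL-Algebra.QuotRing"
    "HOL-Algebra.Ideal_Product"
    "HOL-Algebra.Embedded_Algebras"
    "HOL-Algebra.Ring_Divisibility"
begin

section \<open>Polynomial rings\<close>

text \<open>All polynomials over a field live in one type, with a variable for every natural number.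
  The ring \<open>K[x\<^sub>i | i \<in> V]\<close> is the record \<open>mpoly_ring V\<close>, so that
  \<open>K[x\<^sub>r\<^sub>+\<^sub>1,\<dots>,x\<^sub>d]\<close> is literally a subring of \<open>K[x\<^sub>1,\<dots>,x\<^sub>d]\<close>.\<close>

type_synonym 'k mpoly = "(nat \<Rightarrow>\<^sub>0 nat) \<Rightarrow>\<^sub>0 'k"

definition Const :: "'k::field \<Rightarrow> 'k mpoly" where
  "Const c = Poly_Mapping.single 0 c"

definition Var :: "nat \<Rightarrow> 'k::field mpoly" where
  "Var i = Poly_Mapping.single (Poly_Mapping.single i 1) 1"

definition mpoly_ring :: "nat set \<Rightarrow> 'k::field mpoly ring" where
  "mpoly_ring V =
    \<lparr>carrier = {p. \<forall>t\<in>Poly_Mapping.keys p. Poly_Mapping.keys t \<subseteq> V},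
     monoid.mult = (*), one = 1, ring.zero = 0, add = (+)\<rparr>"

abbreviation poly_ring :: "nat \<Rightarrow> 'k::field mpoly ring" where
  "poly_ring d \<equiv> mpoly_ring {1..d}"

definition max_ideal :: "nat \<Rightarrow> 'k::field mpoly set" where
  "max_ideal d = genideal (poly_ring d) (Var ` {1..d})"

definition homogeneous :: "nat \<Rightarrow> 'k::field mpoly \<Rightarrow> bool" where
  "homogeneous n p \<longleftrightarrow>
    (\<forall>t\<in>Poly_Mapping.keys p. (\<Sum>i\<in>Poly_Mapping.keys t. Poly_Mapping.lookup t i) = n)"

abbreviation quadric :: "'k::field mpoly \<Rightarrow> bool" where
  "quadric \<equiv> homogeneous 2"

definition monomial :: "'k::field mpoly \<Rightarrow> bool" where
  "monomial p \<longleftrightarrow> (\<exists>t. p = Poly_Mapping.single t 1)"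

definition binomial_poly :: "'k::field mpoly \<Rightarrow> bool" where
  "binomial_poly p \<longleftrightarrow> card (Poly_Mapping.keys p) = 2"


section \<open>Linear changes of variables\<close>

text \<open>The substitution \<open>x\<^sub>i \<mapsto> \<Sum>\<^sub>j A\<^sub>i\<^sub>j x\<^sub>j\<close>; only the entries with
  \<open>1 \<le> i, j \<le> d\<close> are used on \<open>poly_ring d\<close>.\<close>

definition linear_subst ::
    "nat \<Rightarrow> (nat \<Rightarrow> nat \<Rightarrow> 'k::field) \<Rightarrow> 'k mpoly \<Rightarrow> 'k mpoly" where
  "linear_subst d A p =
    (\<Sum>t\<in>Poly_Mapping.keys p. Const (Poly_Mapping.lookup p t) *
      (\<Prod>i\<in>Poly_Mapping.keys t. (\<Sum>j=1..d. Const (A i j) * Var j) ^ Poly_Mapping.lookup t i))"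

definition invertible_matrix :: "nat \<Rightarrow> (nat \<Rightarrow> nat \<Rightarrow> 'k::field) \<Rightarrow> bool" where
  "invertible_matrix d A \<longleftrightarrow>
    (\<exists>B. \<forall>i\<in>{1..d}. \<forall>k\<in>{1..d}.
      (\<Sum>j=1..d. A i j * B j k) = (if i = k then 1 else 0) \<and>
      (\<Sum>j=1..d. B i j * A j k) = (if i = k then 1 else 0))"

definition change_of_variables :: "nat \<Rightarrow> ('k::field mpoly \<Rightarrow> 'k mpoly) \<Rightarrow> bool" where
  "change_of_variables d \<sigma> \<longleftrightarrow> (\<exists>A. invertible_matrix d A \<and> \<sigma> = linear_subst d A)"


section \<open>Codimension and numbers of generators\<close>

text \<open>The codimension of an ideal is its height. The index \<open>n\<close> is the length of the chain
  \<open>C 0 \<subset> \<dots> \<subset> C n = P\<close>.\<close>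

definition prime_height :: "('a, 'r) ring_scheme \<Rightarrow> 'a set \<Rightarrow> enat" where
  "prime_height R P =
    (SUP n\<in>{n. \<exists>C. (\<forall>i\<le>n. primeideal (C i) R) \<and> (\<forall>i<n. C i \<subset> C (Suc i)) \<and> C n = P}. enat n)"

definition codim :: "('a, 'r) ring_scheme \<Rightarrow> 'a set \<Rightarrow> enat" where
  "codim R I = (INF P\<in>{P. primeideal P R \<and> I \<subseteq> P}. prime_height R P)"

definition nu :: "('a, 'r) ring_scheme \<Rightarrow> 'a set \<Rightarrow> nat" where
  "nu R I = (LEAST n. \<exists>S \<subseteq> carrier R. finite S \<and> card S = n \<and> genideal R S = I)"

definition minimally_generates :: "('a, 'r) ring_scheme \<Rightarrow> 'a set \<Rightarrow> 'a set \<Rightarrow> bool" where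
  "minimally_generates R S I \<longleftrightarrow>
    S \<subseteq> carrier R \<and> genideal R S = I \<and> (\<forall>T. T \<subset> S \<longrightarrow> genideal R T \<noteq> I)"

text \<open>The number \<open>n\<close> of generators is \<open>\<nu>(\<mm>\<^sup>2) - 1\<close>; it is written additively because subtraction
  of natural numbers truncates.\<close>

definition almost_square_quadric_ideal :: "nat \<Rightarrow> 'k::field mpoly set \<Rightarrow> bool" where
  "almost_square_quadric_ideal d I \<longleftrightarrow>
    codim (poly_ring d) I = enat d \<and>
    (\<exists>S n. minimally_generates (poly_ring d) S I \<and> finite S \<and> card S = n \<and>
      (\<forall>q\<in>S. quadric q) \<and>
      n + 1 = nu (poly_ring d) (max_ideal d \<cdot>\<^bsub>poly_ring d\<^esub> (max_ideal d :: 'k mpoly set)))"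


section \<open>Cohen--Macaulay type\<close>

text \<open>For an ideal \<open>I\<close> generated by forms with \<open>R/I\<close> Artinian, the socle of \<open>R/I\<close> is
  \<open>0 : \<mm>\<close>, a vector space over the image of \<open>K\<close> in \<open>R/I\<close>.\<close>

definition socle :: "nat \<Rightarrow> 'k::field mpoly set \<Rightarrow> 'k mpoly set set" where
  "socle d I =
    {a \<in> carrier (poly_ring d Quot I).
      \<forall>y\<in>max_ideal d. (I +>\<^bsub>poly_ring d\<^esub> y) \<otimes>\<^bsub>poly_ring d Quot I\<^esub> a = \<zero>\<^bsub>poly_ring d Quot I\<^esub>}"

definition has_cm_type :: "nat \<Rightarrow> 'k::field mpoly set \<Rightarrow> nat \<Rightarrow> bool" where
  "has_cm_type d I n \<longleftrightarrow>
    ring.dimension (poly_ring d Quot I) n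
      ((\<lambda>c. I +>\<^bsub>poly_ring d\<^esub> Const c) ` UNIV) (socle d I)"


section \<open>Gorenstein rings\<close>

text \<open>\<open>frac A M a s\<close> is the fraction \<open>a/s\<close> in the localization of \<open>A\<close> at the prime ideal \<open>M\<close>,
  as an equivalence class of pairs.\<close>

definition frac :: "('a, 'r) ring_scheme \<Rightarrow> 'a set \<Rightarrow> 'a \<Rightarrow> 'a \<Rightarrow> ('a \<times> 'a) set" where
  "frac A M a s =
    {(b, t). b \<in> carrier A \<and> t \<in> carrier A - M \<and>
      (\<exists>u\<in>carrier A - M. u \<otimes>\<^bsub>A\<^esub> (t \<otimes>\<^bsub>A\<^esub> a) = u \<otimes>\<^bsub>A\<^esub> (s \<otimes>\<^bsub>A\<^esub> b))}"

text \<open>The unions below run over all representatives and are unions of equal classes.\<close>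

definition localization :: "('a, 'r) ring_scheme \<Rightarrow> 'a set \<Rightarrow> ('a \<times> 'a) set ring" where
  "localization A M =
    \<lparr>carrier = {frac A M a s | a s. a \<in> carrier A \<and> s \<in> carrier A - M},
     monoid.mult = (\<lambda>x y. \<Union>(a, s)\<in>x. \<Union>(b, t)\<in>y. frac A M (a \<otimes>\<^bsub>A\<^esub> b) (s \<otimes>\<^bsub>A\<^esub> t)),
     one = frac A M \<one>\<^bsub>A\<^esub> \<one>\<^bsub>A\<^esub>,
     ring.zero = frac A M \<zero>\<^bsub>A\<^esub> \<one>\<^bsub>A\<^esub>,
     add = (\<lambda>x y. \<Union>(a, s)\<in>x. \<Union>(b, t)\<in>y.
       frac A M ((t \<otimes>\<^bsub>A\<^esub> a) \<oplus>\<^bsub>A\<^esub> (s \<otimes>\<^bsub>A\<^esub> b)) (s \<otimes>\<^bsub>A\<^esub> t))\<rparr>"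

definition module_homs ::
    "('a, 'r) ring_scheme \<Rightarrow> ('a, 'b, 'm) module_scheme \<Rightarrow> ('a, 'c, 'n) module_scheme
      \<Rightarrow> ('b \<Rightarrow> 'c) set" where
  "module_homs A M N =
    {f \<in> carrier M \<rightarrow> carrier N.
      (\<forall>x\<in>carrier M. \<forall>y\<in>carrier M. f (x \<oplus>\<^bsub>M\<^esub> y) = f x \<oplus>\<^bsub>N\<^esub> f y) \<and>
      (\<forall>a\<in>carrier A. \<forall>x\<in>carrier M. f (a \<odot>\<^bsub>M\<^esub> x) = a \<odot>\<^bsub>N\<^esub> f x)}"

definition self_module :: "('a, 'r) ring_scheme \<Rightarrow> ('a, 'a) module" where
  "self_module A =
    \<lparr>carrier = carrier A, monoid.mult = monoid.mult A, one = \<one>\<^bsub>A\<^esub>,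
     ring.zero = \<zero>\<^bsub>A\<^esub>, add = add A, smult = monoid.mult A\<rparr>"

text \<open>A definition by extension along all injections of modules would quantify over types, so
  injectivity is expressed by extension from ideals (Baer).\<close>

definition injective_module ::
    "('a, 'r) ring_scheme \<Rightarrow> ('a, 'b, 'm) module_scheme \<Rightarrow> bool" where
  "injective_module A E \<longleftrightarrow>
    module A E \<and>
    (\<forall>J. ideal J A \<longrightarrow>
      (\<forall>f\<in>module_homs A ((self_module A)\<lparr>carrier := J\<rparr>) E.
        \<exists>g\<in>module_homs A (self_module A) E. \<forall>x\<in>J. g x = f x))"

text \<open>A finite injective resolution \<open>0 \<rightarrow> A \<rightarrow> E 0 \<rightarrow> E 1 \<rightarrow> \<dots> \<rightarrow> E n \<rightarrow> 0\<close> of \<open>A\<close> over itself.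
  The modules live on \<open>'a list\<close>: over a Noetherian ring \<open>A\<close> the terms of the minimal injective
  resolution of \<open>A\<close> have cardinality at most \<open>max |A| \<aleph>\<^sub>0\<close>, so this type is large enough
  and the choice does not affect the notion.\<close>

definition finite_self_injective_dimension :: "('a, 'r) ring_scheme \<Rightarrow> bool" where
  "finite_self_injective_dimension A \<longleftrightarrow>
    (\<exists>(n::nat) (E :: nat \<Rightarrow> ('a, 'a list) module) \<eta> \<delta>.
      (\<forall>i. injective_module A (E i)) \<and>
      (\<forall>i>n. carrier (E i) = {\<zero>\<^bsub>E i\<^esub>}) \<and>
      \<eta> \<in> module_homs A (self_module A) (E 0) \<and>
      (\<forall>i. \<delta> i \<in> module_homs A (E i) (E (Suc i))) \<and>
      inj_on \<eta> (carrier A) \<and>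
      \<eta> ` carrier A = {x \<in> carrier (E 0). \<delta> 0 x = \<zero>\<^bsub>E 1\<^esub>} \<and>
      (\<forall>i. \<delta> i ` carrier (E i) = {x \<in> carrier (E (Suc i)). \<delta> (Suc i) x = \<zero>\<^bsub>E (Suc (Suc i))\<^esub>}))"

definition gorenstein_ring :: "('a, 'r) ring_scheme \<Rightarrow> bool" where
  "gorenstein_ring A \<longleftrightarrow>
    cring A \<and> noetherian_ring A \<and>
    (\<forall>M. maximalideal M A \<longrightarrow> finite_self_injective_dimension (localization A M))"

definition gorenstein_ideal :: "nat set \<Rightarrow> 'k::field mpoly set \<Rightarrow> bool" where
  "gorenstein_ideal V J \<longleftrightarrow>
    ideal J (mpoly_ring V) \<and> gorenstein_ring (mpoly_ring V Quot J)"


section \<open>The normal form\<close>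

definition K_mixed :: "nat \<Rightarrow> nat \<Rightarrow> 'k::field mpoly set" where
  "K_mixed r d = genideal (poly_ring d) {Var i * Var j | i j. 1 \<le> i \<and> i \<le> r \<and> i < j \<and> j \<le> d}"

definition K_complete :: "nat \<Rightarrow> nat \<Rightarrow> 'k::field mpoly set" where
  "K_complete r d = genideal (poly_ring d) {Var i * Var j | i j. r + 1 \<le> i \<and> i < j \<and> j \<le> d}"

definition squares :: "nat \<Rightarrow> nat \<Rightarrow> 'k::field mpoly set" where
  "squares r d = genideal (poly_ring d) {Var i ^ 2 | i. 1 \<le> i \<and> i \<le> r}"

definition signed_squares :: "nat \<Rightarrow> nat \<Rightarrow> (nat \<Rightarrow> 'k::field) \<Rightarrow> 'k mpoly set" where
  "signed_squares r d \<epsilon> =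
    genideal (poly_ring d) {Var (r + 1) ^ 2 + Const (\<epsilon> k) * Var k ^ 2 | k. r + 2 \<le> k \<and> k \<le> d}"

definition normal_form :: "nat \<Rightarrow> nat \<Rightarrow> (nat \<Rightarrow> 'k::field) \<Rightarrow> 'k mpoly set" where
  "normal_form r d \<epsilon> =
    K_mixed r d <+>\<^bsub>poly_ring d\<^esub> K_complete r d
      <+>\<^bsub>poly_ring d\<^esub> squares r d <+>\<^bsub>poly_ring d\<^esub> signed_squares r d \<epsilon>"

end

theory Submission
  imports Defs
begin

text \<open>
  Minimality of the generators makes the quadrics in \<open>I\<close> a hyperplane in the space of all quadrics,
  hence the kernel of a linear functional \<open>\<phi>\<close>, which amounts to a symmetric bilinear form
  \<open>(u, v) \<mapsto> \<phi> (u v)\<close> on linear forms. Over the reals this form is diagonal with entries \<open>0, 1, -1\<close>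
  in suitable coordinates. If its rank is one, \<open>I\<close> lies in a prime generated by \<open>d - 1\<close> linear forms,
  which has height less than \<open>d\<close> because chains of primes have length at most \<open>d\<close>
  (\<open>d + 1\<close> polynomials in \<open>d\<close> variables are algebraically dependent). If the rank is at least two,
  all cubics lie in \<open>I\<close>, so \<open>I\<close> is the normal form, and the socle of \<open>R/I\<close> is spanned by the
  radical of the form together with one quadric, which identifies \<open>r\<close>. The ideal \<open>I\<^bsub>d-r\<^esub>\<close>
  is Gorenstein because \<open>\<phi>\<close> induces a perfect pairing on the quotient: by Baer's criterion the
  quotient is injective over itself, every homomorphism from an ideal being multiplication by an
  element. The quotient is local, hence equal to its localization.
\<close>

text \<open>The number \<open>nu\<close> of generators of the square of the maximal ideal is a least
  cardinality and is never evaluated as a binomial coefficient. It enters through one observation: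
  for p of order at least two, the degree-two part of a p is the constant term of a times that of p.
  Hence the degree-two parts of any generating set span all quadrics, which bounds the dimension of
  the space of quadrics by \<open>nu\<close>. The same observation lets a linear functional on
  quadrics define an ideal by a membership condition, \<open>diag_ideal\<close>; the socle and the
  Gorenstein property are computed from this condition and not from generators. Rank two kills the
  cubics because each x_i^2 then lies in I or is proportional modulo I to the square of another
  variable x_k, while x_i x_k lies in I. Rank zero is excluded because the functional does not
  vanish on all quadrics. Dividing the functional by its first nonzero diagonal value does not
  change its kernel; this is why x_(r+1)^2 appears with coefficient 1 and only relative signs
  remain.\<close>

section \<open>Polynomial rings, their ideals and their cosets\<close>

lemma carrier_mpoly_ring: "p \<in> carrier (mpoly_ring V) \<longleftrightarrow> (\<forall>t\<in>Poly_Mapping.keys p. Poly_Mapping.keys t \<subseteq> V)"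
  by (simp add: mpoly_ring_def)

lemma mpoly_ring_simps [simp]:
  "monoid.mult (mpoly_ring V) = (*)" "monoid.one (mpoly_ring V) = 1"
  "ring.zero (mpoly_ring V) = 0" "add (mpoly_ring V) = (+)"
  by (simp_all add: mpoly_ring_def)

lemma keys_exp_add: "Poly_Mapping.keys (s + t) = Poly_Mapping.keys s \<union> Poly_Mapping.keys t"
  for s t :: "nat \<Rightarrow>\<^sub>0 nat"
  by (auto simp: in_keys_iff lookup_add)

lemma zero_in_mpoly [simp]: "0 \<in> carrier (mpoly_ring V)"
  by (simp add: carrier_mpoly_ring)

lemma Const_in_mpoly [simp]: "Const c \<in> carrier (mpoly_ring V)"
  by (simp add: carrier_mpoly_ring Const_def)

lemma Const_0 [simp]: "Const 0 = 0" by (simp add: Const_def)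
lemma Const_1 [simp]: "Const 1 = 1" by (simp add: Const_def)
lemma Const_add: "Const (a + b) = Const a + Const b" by (simp add: Const_def single_add)
lemma Const_mult: "Const (a * b) = Const a * Const b" by (simp add: Const_def mult_single)
lemma Const_uminus: "Const (- a) = - Const a" by (simp add: Const_def single_uminus)
lemma Const_diff: "Const (a - b) = Const a - Const b" by (simp add: Const_def single_diff)
lemma Const_sum: "Const (sum f A) = (\<Sum>a\<in>A. Const (f a))"
  by (induction A rule: infinite_finite_induct) (simp_all add: Const_add)

lemma one_in_mpoly [simp]: "1 \<in> carrier (mpoly_ring V)"
  using Const_in_mpoly[of 1] by simp

lemma Var_in_mpoly [simp]: "Var i \<in> carrier (mpoly_ring V) \<longleftrightarrow> i \<in> V"
  by (simp add: carrier_mpoly_ring Var_def)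

lemma add_in_mpoly [simp]:
  "p \<in> carrier (mpoly_ring V) \<Longrightarrow> q \<in> carrier (mpoly_ring V) \<Longrightarrow> p + q \<in> carrier (mpoly_ring V)"
  using Poly_Mapping.keys_add[of p q] by (auto simp: carrier_mpoly_ring)

lemma uminus_in_mpoly [simp]:
  "p \<in> carrier (mpoly_ring V) \<Longrightarrow> - p \<in> carrier (mpoly_ring V)"
  by (simp add: carrier_mpoly_ring)

lemma diff_in_mpoly [simp]:
  "p \<in> carrier (mpoly_ring V) \<Longrightarrow> q \<in> carrier (mpoly_ring V) \<Longrightarrow> p - q \<in> carrier (mpoly_ring V)"
  using add_in_mpoly[of p V "- q"] by simp

lemma mult_in_mpoly [simp]:
  assumes "p \<in> carrier (mpoly_ring V)" "q \<in> carrier (mpoly_ring V)"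
  shows "p * q \<in> carrier (mpoly_ring V)"
  unfolding carrier_mpoly_ring
proof
  fix t assume "t \<in> Poly_Mapping.keys (p * q)"
  then obtain a b where "a \<in> Poly_Mapping.keys p" "b \<in> Poly_Mapping.keys q" "t = a + b"
    using keys_mult[of p q] by auto
  then show "Poly_Mapping.keys t \<subseteq> V"
    using assms by (auto simp: carrier_mpoly_ring keys_exp_add)
qed

lemma power_in_mpoly [simp]:
  "p \<in> carrier (mpoly_ring V) \<Longrightarrow> p ^ n \<in> carrier (mpoly_ring V)"
  by (induction n) simp_all

lemma sum_in_mpoly [simp]:
  "(\<And>i. i \<in> A \<Longrightarrow> f i \<in> carrier (mpoly_ring V)) \<Longrightarrow> sum f A \<in> carrier (mpoly_ring V)"
  by (induction A rule: infinite_finite_induct) simp_all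

lemma prod_in_mpoly [simp]:
  "(\<And>i. i \<in> A \<Longrightarrow> f i \<in> carrier (mpoly_ring V)) \<Longrightarrow> prod f A \<in> carrier (mpoly_ring V)"
  by (induction A rule: infinite_finite_induct) simp_all

lemma mpoly_ring_cring: "cring (mpoly_ring V :: 'k::field mpoly ring)"
proof (rule cringI)
  show "abelian_group (mpoly_ring V :: 'k mpoly ring)"
  proof (rule abelian_groupI)
    fix x assume "x \<in> carrier (mpoly_ring V :: 'k mpoly ring)"
    then show "\<exists>y\<in>carrier (mpoly_ring V). y \<oplus>\<^bsub>mpoly_ring V\<^esub> x = \<zero>\<^bsub>mpoly_ring V\<^esub>"
      by (intro bexI[of _ "- x"]) auto
  qed (auto simp: algebra_simps)
  show "Group.comm_monoid (mpoly_ring V :: 'k mpoly ring)"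
    by (rule comm_monoidI) (auto simp: algebra_simps)
qed (auto simp: algebra_simps)

lemmas mpoly_ring_ring = cring.axioms(1)[OF mpoly_ring_cring]

lemma mpoly_ring_a_inv [simp]:
  assumes "p \<in> carrier (mpoly_ring V)"
  shows "\<ominus>\<^bsub>mpoly_ring V\<^esub> p = - p"
proof -
  interpret cring "mpoly_ring V" by (rule mpoly_ring_cring)
  show ?thesis using assms by (intro minus_equality) auto
qed

lemma mpoly_ring_minus [simp]:
  assumes "p \<in> carrier (mpoly_ring V)" "q \<in> carrier (mpoly_ring V)"
  shows "p \<ominus>\<^bsub>mpoly_ring V\<^esub> q = p - q"
  using assms by (simp add: a_minus_def)

text \<open>Negatives come from multiplication by \<open>Const (-1)\<close>, so the closure
  conditions listed suffice.\<close>

lemma ideal_mpolyI: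
  fixes I :: "'k::field mpoly set"
  assumes "I \<subseteq> carrier (mpoly_ring V)" "0 \<in> I"
    and "\<And>p q. p \<in> I \<Longrightarrow> q \<in> I \<Longrightarrow> p + q \<in> I"
    and "\<And>a p. a \<in> carrier (mpoly_ring V) \<Longrightarrow> p \<in> I \<Longrightarrow> a * p \<in> I"
  shows "ideal I (mpoly_ring V)"
proof (rule idealI[OF mpoly_ring_ring])
  interpret cring "mpoly_ring V" by (rule mpoly_ring_cring)
  have "- p \<in> I" if "p \<in> I" for p
    using assms(4)[of "Const (-1)" p] that by (simp add: Const_uminus)
  then show "subgroup I (add_monoid (mpoly_ring V))"
    using assms a_inv_def[of "mpoly_ring V"]
    by (intro add.subgroupI) (auto simp: subset_iff simp flip: a_inv_def)
  fix a x :: "'k mpoly" assume "a \<in> I" "x \<in> carrier (mpoly_ring V)"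
  then show "x \<otimes>\<^bsub>mpoly_ring V\<^esub> a \<in> I" "a \<otimes>\<^bsub>mpoly_ring V\<^esub> x \<in> I"
    using assms(4)[of x a] by (simp_all add: mult.commute)
qed

context
  fixes I :: "'k::field mpoly set" and V
  assumes I: "ideal I (mpoly_ring V)"
begin

lemma ideal_mpoly_subset: "p \<in> I \<Longrightarrow> p \<in> carrier (mpoly_ring V)"
  using ideal.Icarr[OF I] .

lemma ideal_mpoly_zero: "0 \<in> I"
  using additive_subgroup.zero_closed[OF ideal.axioms(1)[OF I]] by simp

lemma ideal_mpoly_add: "p \<in> I \<Longrightarrow> q \<in> I \<Longrightarrow> p + q \<in> I"
  using additive_subgroup.a_closed[OF ideal.axioms(1)[OF I]] by simp

lemma ideal_mpoly_mult: "a \<in> carrier (mpoly_ring V) \<Longrightarrow> p \<in> I \<Longrightarrow> a * p \<in> I"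
  using ideal.I_l_closed[OF I] by simp

lemma ideal_mpoly_mult': "p \<in> I \<Longrightarrow> a \<in> carrier (mpoly_ring V) \<Longrightarrow> p * a \<in> I"
  using ideal.I_r_closed[OF I] by simp

lemma ideal_mpoly_uminus: "p \<in> I \<Longrightarrow> - p \<in> I"
  using ideal_mpoly_mult[of "Const (-1)" p] by (simp add: Const_uminus)

lemma ideal_mpoly_diff: "p \<in> I \<Longrightarrow> q \<in> I \<Longrightarrow> p - q \<in> I"
  using ideal_mpoly_add[of p "- q"] ideal_mpoly_uminus[of q] by simp

lemma ideal_mpoly_sum: "(\<And>i. i \<in> A \<Longrightarrow> f i \<in> I) \<Longrightarrow> sum f A \<in> I"
  by (induction A rule: infinite_finite_induct) (simp_all add: ideal_mpoly_zero ideal_mpoly_add)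

lemma rcos_mpoly_eq_iff:
  "p \<in> carrier (mpoly_ring V) \<Longrightarrow> q \<in> carrier (mpoly_ring V) \<Longrightarrow>
    I +>\<^bsub>mpoly_ring V\<^esub> p = I +>\<^bsub>mpoly_ring V\<^esub> q \<longleftrightarrow> p - q \<in> I"
  using ring.quotient_eq_iff_same_a_r_cos[OF mpoly_ring_ring I, of p q] by auto

end

lemma genideal_mpoly_ideal:
  "S \<subseteq> carrier (mpoly_ring V) \<Longrightarrow> ideal (genideal (mpoly_ring V) S) (mpoly_ring V)"
  by (rule ring.genideal_ideal[OF mpoly_ring_ring])

lemma genideal_mpoly_minimal:
  "ideal I (mpoly_ring V) \<Longrightarrow> S \<subseteq> I \<Longrightarrow> genideal (mpoly_ring V) S \<subseteq> I"
  by (rule ring.genideal_minimal[OF mpoly_ring_ring])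

lemma genideal_mpoly_self:
  "S \<subseteq> carrier (mpoly_ring V) \<Longrightarrow> p \<in> S \<Longrightarrow> p \<in> genideal (mpoly_ring V) S"
  using ring.genideal_self[OF mpoly_ring_ring] by blast

lemma genideal_mpoly_mono:
  assumes "T \<subseteq> carrier (mpoly_ring V)" "S \<subseteq> T"
  shows "genideal (mpoly_ring V) S \<subseteq> genideal (mpoly_ring V) T"
  using assms genideal_mpoly_self[OF assms(1)]
  by (intro genideal_mpoly_minimal genideal_mpoly_ideal) auto

text \<open>Both sides are the least ideal containing S and T. Applied repeatedly, this flattens the
  fourfold sum in \<open>normal_form\<close> into one generated ideal.\<close>

lemma genideal_mpoly_Un:
  assumes "S \<subseteq> carrier (mpoly_ring V)" "T \<subseteq> carrier (mpoly_ring V)"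
  shows "genideal (mpoly_ring V) S <+>\<^bsub>mpoly_ring V\<^esub> genideal (mpoly_ring V) T
    = genideal (mpoly_ring V) (S \<union> T)" (is "?A <+>\<^bsub>_\<^esub> ?B = ?C")
proof -
  have A: "ideal ?A (mpoly_ring V)" and B: "ideal ?B (mpoly_ring V)" and C: "ideal ?C (mpoly_ring V)"
    using assms by (auto intro: genideal_mpoly_ideal)
  have "?A <+>\<^bsub>mpoly_ring V\<^esub> ?B = genideal (mpoly_ring V) (?A \<union> ?B)"
    using ring.union_genideal[OF mpoly_ring_ring A B] by simp
  also have "\<dots> = ?C"
  proof (rule antisym)
    show "genideal (mpoly_ring V) (?A \<union> ?B) \<subseteq> ?C"
      using assms by (intro genideal_mpoly_minimal C Un_least genideal_mpoly_mono) auto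
    show "?C \<subseteq> genideal (mpoly_ring V) (?A \<union> ?B)"
      using assms genideal_mpoly_self[of _ V] ideal_mpoly_subset[OF A] ideal_mpoly_subset[OF B]
      by (intro genideal_mpoly_mono) auto
  qed
  finally show ?thesis .
qed

subsection \<open>Degree and order\<close>

definition tdeg :: "(nat \<Rightarrow>\<^sub>0 nat) \<Rightarrow> nat" where
  "tdeg t = (\<Sum>i\<in>Poly_Mapping.keys t. Poly_Mapping.lookup t i)"

lemma tdeg_superset:
  "finite A \<Longrightarrow> Poly_Mapping.keys t \<subseteq> A \<Longrightarrow> tdeg t = (\<Sum>i\<in>A. Poly_Mapping.lookup t i)"
  unfolding tdeg_def by (rule sum.mono_neutral_left) (auto simp: in_keys_iff)

lemma tdeg_add: "tdeg (s + t) = tdeg s + tdeg t"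
  by (simp add: tdeg_superset[of "Poly_Mapping.keys s \<union> Poly_Mapping.keys t"] keys_exp_add
      lookup_add sum.distrib)

lemma tdeg_0 [simp]: "tdeg 0 = 0" by (simp add: tdeg_def)

lemma tdeg_single [simp]: "tdeg (Poly_Mapping.single i n) = n"
  by (simp add: tdeg_def)

lemma tdeg_eq_0_iff [simp]: "tdeg t = 0 \<longleftrightarrow> t = 0"
proof
  assume "tdeg t = 0"
  then show "t = 0"
    by (intro poly_mapping_eqI) (auto simp: tdeg_def in_keys_iff)
qed simp

lemma exp_Suc_cases:
  assumes "0 < tdeg t"
  obtains i s where "i \<in> Poly_Mapping.keys t" "t = Poly_Mapping.single i 1 + s" "tdeg t = Suc (tdeg s)"
proof -
  from assms have "t \<noteq> 0" by auto
  then obtain i where i: "i \<in> Poly_Mapping.keys t" by (metis keys_eq_empty ex_in_conv)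
  have "t = Poly_Mapping.single i 1 + (t - Poly_Mapping.single i 1)"
    using i by (intro poly_mapping_eqI)
      (auto simp: lookup_add lookup_minus lookup_single when_def in_keys_iff)
  moreover from this have "tdeg t = Suc (tdeg (t - Poly_Mapping.single i 1))"
    by (metis add_Suc plus_1_eq_Suc tdeg_add tdeg_single)
  ultimately show ?thesis using i that by blast
qed

text \<open>The filtration by powers of the ideal of the origin, stated on exponents. For n = 1 and
  n = 2 it is identified below with the ideal generated by the variables and with its
  square.\<close>

definition ord_ge :: "nat \<Rightarrow> 'k::field mpoly \<Rightarrow> bool" where
  "ord_ge n p \<longleftrightarrow> (\<forall>t\<in>Poly_Mapping.keys p. n \<le> tdeg t)"

lemma ord_ge_0 [simp]: "ord_ge 0 p" "ord_ge n 0"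
  by (simp_all add: ord_ge_def)

lemma ord_ge_mono: "ord_ge n p \<Longrightarrow> m \<le> n \<Longrightarrow> ord_ge m p"
  by (force simp: ord_ge_def)

lemma ord_ge_add: "ord_ge n p \<Longrightarrow> ord_ge n q \<Longrightarrow> ord_ge n (p + q)"
  using Poly_Mapping.keys_add[of p q] by (auto simp: ord_ge_def)

lemma ord_ge_uminus: "ord_ge n p \<Longrightarrow> ord_ge n (- p)"
  by (auto simp: ord_ge_def)

lemma ord_ge_diff: "ord_ge n p \<Longrightarrow> ord_ge n q \<Longrightarrow> ord_ge n (p - q)"
  using ord_ge_add[of n p "- q"] ord_ge_uminus[of n q] by simp

lemma ord_ge_sum: "(\<And>i. i \<in> A \<Longrightarrow> ord_ge n (f i)) \<Longrightarrow> ord_ge n (sum f A)"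
  by (induction A rule: infinite_finite_induct) (simp_all add: ord_ge_add)

lemma ord_ge_mult:
  assumes "ord_ge m p" "ord_ge n q"
  shows "ord_ge (m + n) (p * q)"
  unfolding ord_ge_def
proof
  fix t assume "t \<in> Poly_Mapping.keys (p * q)"
  then obtain a b where "a \<in> Poly_Mapping.keys p" "b \<in> Poly_Mapping.keys q" "t = a + b"
    using keys_mult[of p q] by auto
  then show "m + n \<le> tdeg t"
    using assms by (auto simp: ord_ge_def tdeg_add intro: add_mono)
qed

lemma ord_ge_Var [simp]: "ord_ge 1 (Var i)" "ord_ge (Suc 0) (Var i)"
  by (simp_all add: ord_ge_def Var_def)

lemma ord_ge_Var_mult [simp]: "ord_ge 2 (Var i * Var j)"
  using ord_ge_mult[of 1 "Var i" 1 "Var j"] by (simp add: numeral_2_eq_2)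

lemma lookup_ord_ge: "ord_ge n p \<Longrightarrow> tdeg t < n \<Longrightarrow> Poly_Mapping.lookup p t = 0"
  by (force simp: ord_ge_def in_keys_iff)

lemma lookup_Const: "Poly_Mapping.lookup (Const c) t = (if t = 0 then c else 0)"
  by (auto simp: Const_def lookup_single when_def)

lemma lookup_Const_mult [simp]:
  "Poly_Mapping.lookup (Const c * p) t = c * Poly_Mapping.lookup p t"
proof -
  have "Const c * p = Poly_Mapping.map ((*) c) p"
    by (simp add: Const_def mult_map_scale_conv_mult)
  then show ?thesis by (simp add: map.rep_eq when_def)
qed

lemma ord_ge_1_diff_Const: "ord_ge 1 (p - Const (Poly_Mapping.lookup p 0))"
proof -
  have "tdeg t \<noteq> 0" if "t \<in> Poly_Mapping.keys (p - Const (Poly_Mapping.lookup p 0))" for t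
    using that by (auto simp: in_keys_iff lookup_minus lookup_Const)
  then show ?thesis unfolding ord_ge_def by (metis less_one linorder_not_le)
qed

lemma lookup_0_mult [simp]:
  "Poly_Mapping.lookup (p * q) 0 = Poly_Mapping.lookup p 0 * Poly_Mapping.lookup q (0 :: nat \<Rightarrow>\<^sub>0 nat)"
  for p q :: "'k::field mpoly"
proof -
  let ?c = "Poly_Mapping.lookup p 0"
  have "p * q = Const ?c * q + (p - Const ?c) * q" by (simp add: algebra_simps)
  moreover have "ord_ge 1 ((p - Const ?c) * q)"
    using ord_ge_mult[OF ord_ge_1_diff_Const, of 0 q p] by simp
  ultimately show ?thesis using lookup_ord_ge[of 1 "(p - Const ?c) * q" 0]
    by (simp add: lookup_add)
qed

text \<open>Split a into its constant term and a part of order at least one: the second part pushes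
  p beyond degree n. Multiplication thus acts on lowest-degree parts by a scalar, which is why
  linear conditions on quadrics define ideals.\<close>

lemma lookup_mult_ord_ge:
  assumes "ord_ge n p" "tdeg t = n"
  shows "Poly_Mapping.lookup (a * p) t = Poly_Mapping.lookup a 0 * Poly_Mapping.lookup p t"
proof -
  let ?c = "Poly_Mapping.lookup a 0"
  have "a * p = Const ?c * p + (a - Const ?c) * p" by (simp add: algebra_simps)
  moreover have "ord_ge (1 + n) ((a - Const ?c) * p)"
    using ord_ge_mult[OF ord_ge_1_diff_Const assms(1)] .
  ultimately show ?thesis using lookup_ord_ge[of "1 + n" "(a - Const ?c) * p" t] assms(2)
    by (simp add: lookup_add)
qed

subsection \<open>Monomial expansion and substitution\<close>

definition monom_eval :: "(nat \<Rightarrow> 'a::comm_monoid_mult) \<Rightarrow> (nat \<Rightarrow>\<^sub>0 nat) \<Rightarrow> 'a" where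
  "monom_eval f t = (\<Prod>i\<in>Poly_Mapping.keys t. f i ^ Poly_Mapping.lookup t i)"

lemma monom_eval_superset:
  "finite A \<Longrightarrow> Poly_Mapping.keys t \<subseteq> A \<Longrightarrow> monom_eval f t = (\<Prod>i\<in>A. f i ^ Poly_Mapping.lookup t i)"
  unfolding monom_eval_def by (rule prod.mono_neutral_left) (auto simp: in_keys_iff)

lemma monom_eval_add: "monom_eval f (s + t) = monom_eval f s * monom_eval f t"
  by (simp add: monom_eval_superset[of "Poly_Mapping.keys s \<union> Poly_Mapping.keys t"] keys_exp_add
      lookup_add power_add prod.distrib)

lemma monom_eval_0 [simp]: "monom_eval f 0 = 1" by (simp add: monom_eval_def)

lemma monom_eval_single [simp]: "monom_eval f (Poly_Mapping.single i n) = f i ^ n"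
  by (simp add: monom_eval_def)

lemma single_eq_monom_eval: "Poly_Mapping.single t c = Const c * monom_eval Var t"
proof -
  have "Poly_Mapping.single t 1 = monom_eval (Var :: nat \<Rightarrow> 'a mpoly) t"
  proof (induction "tdeg t" arbitrary: t)
    case 0
    then show ?case by simp
  next
    case (Suc n)
    then obtain i s where "t = Poly_Mapping.single i 1 + s" "tdeg t = Suc (tdeg s)"
      by (metis exp_Suc_cases zero_less_Suc)
    with Suc show ?case
      by (metis Var_def monom_eval_add monom_eval_single mult_single mult_1 nat.inject power_one_right)
  qed
  then show ?thesis by (metis Const_def add_0 mult.right_neutral mult_single)
qed

lemma mpoly_expansion:
  "p = (\<Sum>t\<in>Poly_Mapping.keys p. Const (Poly_Mapping.lookup p t) * monom_eval Var t)"
proof -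
  have "p = (\<Sum>t\<in>Poly_Mapping.keys p. Poly_Mapping.single t (Poly_Mapping.lookup p t))"
    by (intro poly_mapping_eqI)
       (auto simp: lookup_sum lookup_single when_def in_keys_iff sum.delta)
  then show ?thesis by (simp add: single_eq_monom_eval)
qed

lemma mpoly_induct [consumes 1, case_names Const Var add mult]:
  assumes "p \<in> carrier (mpoly_ring V)"
    and Const: "\<And>c. P (Const c)"
    and Var: "\<And>i. i \<in> V \<Longrightarrow> P (Var i)"
    and add: "\<And>p q. p \<in> carrier (mpoly_ring V) \<Longrightarrow> q \<in> carrier (mpoly_ring V) \<Longrightarrow>
      P p \<Longrightarrow> P q \<Longrightarrow> P (p + q)"
    and mult: "\<And>p q. p \<in> carrier (mpoly_ring V) \<Longrightarrow> q \<in> carrier (mpoly_ring V) \<Longrightarrow>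
      P p \<Longrightarrow> P q \<Longrightarrow> P (p * q)"
  shows "P p"
proof -
  \<comment> \<open>Carrying membership in the ring along with \<open>P\<close> makes the cases
    \<open>add\<close> and \<open>mult\<close> applicable to every intermediate sum and
    product.\<close>
  define Q where "Q q \<longleftrightarrow> q \<in> carrier (mpoly_ring V) \<and> P q" for q
  have Q0: "Q (Const c)" for c by (simp add: Q_def Const)
  have Q1: "Q (a ^ n)" if "Q a" for a n
    using that Q0[of 1] by (induction n) (auto simp: Q_def mult)
  have Q2: "Q (monom_eval Var t)" if "Poly_Mapping.keys t \<subseteq> V" for t
  proof -
    have "Q (\<Prod>i\<in>A. Var i ^ Poly_Mapping.lookup t i)" if "finite A" "A \<subseteq> V" for A
      using that Q0[of 1] Q1[of "Var _"]
      by (induction A rule: finite_induct) (auto simp: Q_def mult Var)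
    then show ?thesis using that by (simp add: monom_eval_def)
  qed
  have "Q (\<Sum>t\<in>A. Const (Poly_Mapping.lookup p t) * monom_eval Var t)"
    if "finite A" "A \<subseteq> Poly_Mapping.keys p" for A
    using that
  proof (induction A rule: finite_induct)
    case empty
    then show ?case using Q0[of 0] by simp
  next
    case (insert t A)
    then have "Q (monom_eval Var t)"
      using assms(1) by (intro Q2) (auto simp: carrier_mpoly_ring)
    with insert Q0 show ?case by (auto simp: Q_def intro!: mult add)
  qed
  from this[of "Poly_Mapping.keys p"] show ?thesis
    using mpoly_expansion[of p] by (simp add: Q_def)
qed

text \<open>The algebra homomorphism sending x_i to \<open>f i\<close>, for arbitrary
  \<open>f\<close>: linear changes of variables, restriction to a coordinate axis and composites of
  the two are all instances.\<close>

definition subst_poly :: "(nat \<Rightarrow> 'k mpoly) \<Rightarrow> 'k::field mpoly \<Rightarrow> 'k mpoly" where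
  "subst_poly f p = (\<Sum>t\<in>Poly_Mapping.keys p. Const (Poly_Mapping.lookup p t) * monom_eval f t)"

lemma subst_poly_superset:
  assumes "finite A" "Poly_Mapping.keys p \<subseteq> A"
  shows "subst_poly f p = (\<Sum>t\<in>A. Const (Poly_Mapping.lookup p t) * monom_eval f t)"
  unfolding subst_poly_def using assms by (intro sum.mono_neutral_left) (auto simp: in_keys_iff)

lemma subst_poly_add: "subst_poly f (p + q) = subst_poly f p + subst_poly f q"
proof -
  let ?A = "Poly_Mapping.keys p \<union> Poly_Mapping.keys q"
  have "subst_poly f (p + q) = (\<Sum>t\<in>?A. Const (Poly_Mapping.lookup (p + q) t) * monom_eval f t)"
    using Poly_Mapping.keys_add[of p q] by (intro subst_poly_superset) auto
  then show ?thesis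
    by (simp add: subst_poly_superset[of ?A] lookup_add Const_add algebra_simps sum.distrib)
qed

lemma subst_poly_0 [simp]: "subst_poly f 0 = 0" by (simp add: subst_poly_def)

lemma subst_poly_sum: "subst_poly f (sum g A) = (\<Sum>a\<in>A. subst_poly f (g a))"
  by (induction A rule: infinite_finite_induct) (simp_all add: subst_poly_add)

lemma subst_poly_single [simp]: "subst_poly f (Poly_Mapping.single t c) = Const c * monom_eval f t"
  by (cases "c = 0") (simp_all add: subst_poly_def)

lemma subst_poly_Const [simp]: "subst_poly f (Const c) = Const c"
  by (metis Const_def monom_eval_0 mult.right_neutral subst_poly_single)

lemma subst_poly_1 [simp]: "subst_poly f 1 = 1"
  using subst_poly_Const[of f 1] by simp

lemma subst_poly_Var [simp]: "subst_poly f (Var i) = f i"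
  by (simp add: Var_def)

lemma subst_poly_mult: "subst_poly f (p * q) = subst_poly f p * subst_poly f q"
proof -
  have single: "subst_poly f (Poly_Mapping.single s a * Poly_Mapping.single t b) =
    subst_poly f (Poly_Mapping.single s a) * subst_poly f (Poly_Mapping.single t b)" for s t a b
    by (simp add: mult_single Const_mult monom_eval_add algebra_simps)
  have exp: "p = (\<Sum>t\<in>Poly_Mapping.keys p. Poly_Mapping.single t (Poly_Mapping.lookup p t))" for p :: "'a mpoly"
    using mpoly_expansion[of p] by (simp add: single_eq_monom_eval)
  show ?thesis
    apply (subst (1 2) exp[of p], subst (1 2) exp[of q])
    apply (simp only: sum_product subst_poly_sum single)
    done
qed

lemma subst_poly_uminus: "subst_poly f (- p) = - subst_poly f p"
  using subst_poly_add[of f p "- p"] by (simp add: eq_neg_iff_add_eq_0 add.commute)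

lemma subst_poly_diff: "subst_poly f (p - q) = subst_poly f p - subst_poly f q"
  using subst_poly_add[of f p "- q"] by (simp add: subst_poly_uminus)

lemma subst_poly_in_mpoly:
  assumes "p \<in> carrier (mpoly_ring V)" "\<And>i. i \<in> V \<Longrightarrow> f i \<in> carrier (mpoly_ring W)"
  shows "subst_poly f p \<in> carrier (mpoly_ring W)"
  using assms(1) by (induction rule: mpoly_induct) (auto simp: subst_poly_add subst_poly_mult assms(2))

text \<open>Two algebra homomorphisms agree on the ring once they agree on the variables in
  V.\<close>

lemma subst_poly_comp_eq:
  assumes "p \<in> carrier (mpoly_ring V)" "\<And>i. i \<in> V \<Longrightarrow> subst_poly f (g i) = h i"
  shows "subst_poly f (subst_poly g p) = subst_poly h p"
  using assms(1) by (induction rule: mpoly_induct) (auto simp: subst_poly_add subst_poly_mult assms(2))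

lemma subst_poly_Var_id: "subst_poly Var p = p"
  using mpoly_expansion[of p] by (simp add: subst_poly_def)

section \<open>Linear changes of variables and their inverses\<close>

lemma linear_subst_eq: "linear_subst d A = subst_poly (\<lambda>i. \<Sum>j=1..d. Const (A i j) * Var j)"
  by (simp add: fun_eq_iff linear_subst_def subst_poly_def monom_eval_def)

lemma invertible_matrix_inverse:
  fixes A :: "nat \<Rightarrow> nat \<Rightarrow> 'a::field"
  assumes "invertible_matrix d A"
  obtains B where "invertible_matrix d B"
    "\<And>p. p \<in> carrier (poly_ring d) \<Longrightarrow> linear_subst d A (linear_subst d B p) = p"
    "\<And>p. p \<in> carrier (poly_ring d) \<Longrightarrow> linear_subst d B (linear_subst d A p) = p"
proof -
  obtain B where
    AB: "\<And>i k. i \<in> {1..d} \<Longrightarrow> k \<in> {1..d} \<Longrightarrow> (\<Sum>j=1..d. A i j * B j k) = (if i = k then 1 else 0)"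
        "\<And>i k. i \<in> {1..d} \<Longrightarrow> k \<in> {1..d} \<Longrightarrow> (\<Sum>j=1..d. B i j * A j k) = (if i = k then 1 else 0)"
    using assms unfolding invertible_matrix_def by blast
  have "invertible_matrix d B" unfolding invertible_matrix_def using AB by blast
  \<comment> \<open>Substituting by A and then by B is substitution by the product AB, so each of
    the two matrix identities yields one of the two composites; the claim is used a second time with
    A and B exchanged.\<close>
  moreover have *: "linear_subst d B (linear_subst d A p) = p"
    if p: "p \<in> carrier (poly_ring d)" and
     AB: "\<And>i k. i \<in> {1..d} \<Longrightarrow> k \<in> {1..d} \<Longrightarrow> (\<Sum>j=1..d. A i j * B j k) = (if i = k then 1 else 0)"
    for A B :: "nat \<Rightarrow> nat \<Rightarrow> 'a" and p
  proof -
    have "linear_subst d B (linear_subst d A p) = subst_poly Var p"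
      unfolding linear_subst_eq
    proof (rule subst_poly_comp_eq[OF p])
      fix i assume i: "i \<in> {1..d}"
      have "subst_poly (\<lambda>i. \<Sum>j=1..d. Const (B i j) * Var j) (\<Sum>j=1..d. Const (A i j) * Var j)
        = (\<Sum>j=1..d. \<Sum>k=1..d. Const (A i j * B j k) * Var k)"
        by (simp add: subst_poly_sum subst_poly_mult Const_mult sum_distrib_left algebra_simps)
      also have "\<dots> = (\<Sum>k=1..d. Const (\<Sum>j=1..d. A i j * B j k) * Var k)"
        by (subst sum.swap) (simp add: Const_sum sum_distrib_right)
      also have "\<dots> = (\<Sum>k=1..d. if k = i then Var k else 0)"
      proof (intro sum.cong refl)
        fix k assume "k \<in> {1..d}"
        from AB(1)[OF i this]
        show "Const (\<Sum>j=1..d. A i j * B j k) * Var k = (if k = i then Var k else 0)"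
          by (simp only: Const_0 Const_1 mult_1 mult_zero_left split: if_split) auto
      qed
      also have "\<dots> = Var i" using i by (simp add: sum.delta)
      finally show "subst_poly (\<lambda>i. \<Sum>j=1..d. Const (B i j) * Var j) (\<Sum>j=1..d. Const (A i j) * Var j) = Var i" .
    qed
    then show ?thesis by (simp add: subst_poly_Var_id)
  qed
  ultimately show ?thesis using that[of B] *[of _ A B] *[of _ B A] AB by blast
qed

lemma change_of_variables_inverse:
  assumes "change_of_variables d \<sigma>"
  obtains A B where "\<sigma> = linear_subst d A"
    "\<And>p. p \<in> carrier (poly_ring d) \<Longrightarrow> linear_subst d B (\<sigma> p) = p"
    "\<And>p. p \<in> carrier (poly_ring d) \<Longrightarrow> \<sigma> (linear_subst d B p) = p"
  using assms invertible_matrix_inverse unfolding change_of_variables_def by metis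

lemma linear_subst_in_mpoly [simp]:
  "p \<in> carrier (poly_ring d) \<Longrightarrow> linear_subst d A p \<in> carrier (poly_ring d)"
  unfolding linear_subst_eq
  by (erule subst_poly_in_mpoly, intro sum_in_mpoly mult_in_mpoly) (simp_all only: Const_in_mpoly Var_in_mpoly)

lemmas linear_subst_in_mpoly_Suc [simp] = linear_subst_in_mpoly[unfolded One_nat_def]

lemma linear_subst_Const [simp]: "linear_subst d A (Const c) = Const c"
  by (simp add: linear_subst_eq)

lemma linear_subst_add: "linear_subst d A (p + q) = linear_subst d A p + linear_subst d A q"
  by (simp add: linear_subst_eq subst_poly_add)

lemma linear_subst_mult: "linear_subst d A (p * q) = linear_subst d A p * linear_subst d A q"
  by (simp add: linear_subst_eq subst_poly_mult)

lemma linear_subst_diff: "linear_subst d A (p - q) = linear_subst d A p - linear_subst d A q"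
  by (simp add: linear_subst_eq subst_poly_diff)

lemma linear_subst_sum: "linear_subst d A (sum f S) = (\<Sum>s\<in>S. linear_subst d A (f s))"
  by (simp add: linear_subst_eq subst_poly_sum)

lemma linear_subst_0 [simp]: "linear_subst d A 0 = 0"
  by (simp add: linear_subst_eq)

interpretation mp: vector_space "\<lambda>(c::'k::field) (p::'k mpoly). Const c * p"
  by unfold_locales (simp_all add: algebra_simps Const_add Const_mult)

subsection \<open>The Krull dimension of a polynomial ring\<close>

text \<open>Stated for a family, because two of its members may coincide: then their difference is
  the relation, and otherwise the bound on the size of independent sets applies. Indices with
  coefficient 0 are dropped from \<open>T\<close>.\<close>

lemma (in vector_space) exists_nontrivial_relation:
  assumes E: "finite E" and F: "finite F" "card F < card E" and sp: "f ` E \<subseteq> span F"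
  obtains T c where "T \<subseteq> E" "T \<noteq> {}" "\<And>t. t \<in> T \<Longrightarrow> c t \<noteq> 0" "(\<Sum>t\<in>T. scale (c t) (f t)) = 0"
proof (cases "inj_on f E")
  case True
  then have "dependent (f ` E)"
    using independent_span_bound[OF F(1) _ sp] F(2) by (auto simp: card_image)
  then obtain S u where S: "finite S" "S \<subseteq> f ` E" "(\<Sum>v\<in>S. scale (u v) v) = 0" "\<exists>v\<in>S. u v \<noteq> 0"
    unfolding dependent_explicit by blast
  define T where "T = {t \<in> E. f t \<in> S \<and> u (f t) \<noteq> 0}"
  have img: "f ` T = {v \<in> S. u v \<noteq> 0}" using S(2) by (auto simp: T_def)
  have "(\<Sum>t\<in>T. scale (u (f t)) (f t)) = (\<Sum>v\<in>f ` T. scale (u v) v)"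
    using True by (subst sum.reindex) (auto simp: T_def inj_on_def)
  also have "\<dots> = (\<Sum>v\<in>S. scale (u v) v)"
    unfolding img using S(1) by (intro sum.mono_neutral_left) auto
  finally have "(\<Sum>t\<in>T. scale (u (f t)) (f t)) = 0" using S(3) by simp
  moreover have "T \<noteq> {}" using img S(4) by blast
  ultimately show ?thesis using that[of T "u \<circ> f"] by (auto simp: T_def)
next
  case False
  then obtain s t where st: "s \<in> E" "t \<in> E" "f s = f t" "s \<noteq> t" by (auto simp: inj_on_def)
  show ?thesis
    by (rule that[of "{s, t}" "\<lambda>x. if x = s then 1 else - 1"]) (use st in auto)
qed

text \<open>Bounding each exponent separately, not the total degree, makes the admissible monomials
  in V a box with \<open>(M + 1) ^ card V\<close> points.\<close>

definition degs_le :: "nat \<Rightarrow> 'k::field mpoly \<Rightarrow> bool" where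
  "degs_le M p \<longleftrightarrow> (\<forall>t\<in>Poly_Mapping.keys p. \<forall>i. Poly_Mapping.lookup t i \<le> M)"

lemma degs_le_mono: "degs_le M p \<Longrightarrow> M \<le> N \<Longrightarrow> degs_le N p"
  by (auto simp: degs_le_def intro: order_trans)

lemma degs_le_1 [simp]: "degs_le M 1"
  by (auto simp: degs_le_def)

lemma degs_le_mult:
  assumes "degs_le M p" "degs_le N q"
  shows "degs_le (M + N) (p * q)"
  unfolding degs_le_def
proof
  fix t assume "t \<in> Poly_Mapping.keys (p * q)"
  then obtain a b where "a \<in> Poly_Mapping.keys p" "b \<in> Poly_Mapping.keys q" "t = a + b"
    using keys_mult[of p q] by auto
  then show "\<forall>i. Poly_Mapping.lookup t i \<le> M + N"
    using assms by (auto simp: degs_le_def lookup_add intro: add_mono)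
qed

lemma degs_le_power: "degs_le M p \<Longrightarrow> degs_le (n * M) (p ^ n)"
  by (induction n) (auto dest: degs_le_mult[of M p])

lemma degs_le_prod:
  assumes "finite A" "\<And>i. i \<in> A \<Longrightarrow> degs_le M (f i)"
  shows "degs_le (card A * M) (prod f A)"
  using assms by (induction A rule: finite_induct) (auto intro: degs_le_mult)

lemma degs_le_exists: "\<exists>M. degs_le M p"
proof -
  let ?S = "\<Union>t\<in>Poly_Mapping.keys p. insert 0 (Poly_Mapping.lookup t ` Poly_Mapping.keys t)"
  have "degs_le (Max ?S) p"
    unfolding degs_le_def
  proof (intro ballI allI)
    fix t i assume "t \<in> Poly_Mapping.keys p"
    then have "Poly_Mapping.lookup t i \<in> ?S" by (cases "i \<in> Poly_Mapping.keys t") (blast, auto simp: in_keys_iff)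
    then show "Poly_Mapping.lookup t i \<le> Max ?S" by (intro Max_ge) auto
  qed
  then show ?thesis ..
qed

lemma mpoly_in_span_monomials:
  assumes "\<And>t. t \<in> Poly_Mapping.keys p \<Longrightarrow> monom_eval Var t \<in> F"
  shows "p \<in> mp.span F"
  by (subst mpoly_expansion[of p]) (intro mp.span_sum mp.span_scale mp.span_base assms)

lemma degs_le_span:
  fixes V :: "nat set"
  assumes "finite V"
  obtains F :: "'k::field mpoly set" where "finite F" "card F \<le> (M + 1) ^ card V"
    "\<And>p. p \<in> carrier (mpoly_ring V) \<Longrightarrow> degs_le M p \<Longrightarrow> p \<in> mp.span F"
proof -
  define G where "G = {t. Poly_Mapping.keys t \<subseteq> V \<and> (\<forall>i. Poly_Mapping.lookup t i \<le> M)}"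
  let ?r = "\<lambda>t. restrict (Poly_Mapping.lookup t) V"
  have inj: "inj_on ?r G"
  proof (rule inj_onI, rule poly_mapping_eqI)
    fix s t i assume st: "s \<in> G" "t \<in> G" "?r s = ?r t"
    show "Poly_Mapping.lookup s i = Poly_Mapping.lookup t i"
    proof (cases "i \<in> V")
      case True
      then show ?thesis using fun_cong[OF st(3), of i] by simp
    next
      case False
      then have "i \<notin> Poly_Mapping.keys s" "i \<notin> Poly_Mapping.keys t" using st by (auto simp: G_def)
      then show ?thesis by (simp add: in_keys_iff)
    qed
  qed
  have sub: "?r ` G \<subseteq> V \<rightarrow>\<^sub>E {..M}" by (auto simp: G_def)
  have fin: "finite (V \<rightarrow>\<^sub>E {..M})" using assms by (intro finite_PiE) auto
  then have G: "finite G" using inj sub by (meson finite_imageD finite_subset)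
  have "card G \<le> card (V \<rightarrow>\<^sub>E {..M})"
    using card_image[OF inj] card_mono[OF fin sub] by simp
  then have cG: "card G \<le> (M + 1) ^ card V" using assms by (simp add: card_PiE)
  show ?thesis
  proof (rule that[of "monom_eval Var ` G"])
    show "card (monom_eval (Var :: nat \<Rightarrow> 'k mpoly) ` G) \<le> (M + 1) ^ card V"
      using card_image_le[OF G] cG order_trans by blast
    fix p :: "'k mpoly" assume "p \<in> carrier (mpoly_ring V)" "degs_le M p"
    then show "p \<in> mp.span (monom_eval Var ` G)"
      by (intro mpoly_in_span_monomials) (auto simp: G_def carrier_mpoly_ring degs_le_def)
  qed (use G in simp)
qed

text \<open>There are \<open>N ^ (d + 1)\<close> exponent vectors with entries below N, while the
  products lie in a space spanned by at most \<open>(M + 1) ^ d\<close> monomials, with M linear in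
  N; for large N there is a relation. Injectivity of the restriction says that the exponent vectors
  are distinct on \<open>{0..d}\<close>, the form in which the induction along a chain of primes
  consumes them.\<close>

lemma algebraically_dependent:
  fixes a :: "nat \<Rightarrow> 'k::field mpoly"
  assumes a: "\<And>i. i \<le> d \<Longrightarrow> a i \<in> carrier (poly_ring d)"
  obtains T c where "finite T" "T \<noteq> {}" "\<And>t. t \<in> T \<Longrightarrow> c t \<noteq> 0"
    "inj_on (\<lambda>t. restrict t {0..d}) T" "(\<Sum>t\<in>T. Const (c t) * (\<Prod>i=0..d. a i ^ t i)) = 0"
proof -
  have "\<forall>i. \<exists>M. degs_le M (a i)" using degs_le_exists by blast
  then obtain m where m: "\<And>i. degs_le (m i) (a i)" by metis
  define D where "D = Max (m ` {0..d})"
  have D: "degs_le D (a i)" if "i \<le> d" for i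
    using that by (intro degs_le_mono[OF m]) (auto simp: D_def intro: Max_ge)
  \<comment> \<open>The constants are chosen so that \<open>M + 1 \<le> b * N\<close> and
    \<open>b ^ d < N\<close>; then
    \<open>(M + 1) ^ d \<le> b ^ d * N ^ d < N * N ^ d\<close>.\<close>
  define b where "b = (d + 1) * D + 1"
  define N where "N = b ^ d + 1"
  define M where "M = (d + 1) * (N * D)"
  obtain F :: "'k mpoly set" where F: "finite F" "card F \<le> (M + 1) ^ d"
    "\<And>p. p \<in> carrier (poly_ring d) \<Longrightarrow> degs_le M p \<Longrightarrow> p \<in> mp.span F"
    using degs_le_span[of "{1..d}" M] by auto
  define E where "E = {0..d} \<rightarrow>\<^sub>E {..<N}"
  have "M + 1 \<le> b * N" by (simp add: M_def b_def algebra_simps N_def)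
  then have "(M + 1) ^ d \<le> b ^ d * N ^ d" by (metis power_mono power_mult_distrib zero_le)
  also have "\<dots> < N * N ^ d" by (intro mult_strict_right_mono) (auto simp: N_def)
  finally have card: "card F < card E" using F(2) by (simp add: E_def card_PiE)
  have sp: "(\<lambda>t. \<Prod>i=0..d. a i ^ t i) ` E \<subseteq> mp.span F"
  proof safe
    fix t assume t: "t \<in> E"
    have "degs_le (card {0..d} * (N * D)) (\<Prod>i=0..d. a i ^ t i)"
    proof (rule degs_le_prod)
      fix i assume i: "i \<in> {0..d}"
      then have "t i < N" using t by (auto simp: E_def)
      then have "t i * D \<le> N * D" by simp
      then show "degs_le (N * D) (a i ^ t i)" using degs_le_mono[OF degs_le_power[OF D]] i by simp
    qed simp
    then have "degs_le M (\<Prod>i=0..d. a i ^ t i)" by (simp add: M_def)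
    moreover have "(\<Prod>i=0..d. a i ^ t i) \<in> carrier (poly_ring d)"
      using a by (intro prod_in_mpoly power_in_mpoly) simp
    ultimately show "(\<Prod>i=0..d. a i ^ t i) \<in> mp.span F" by (intro F(3))
  qed
  have finE: "finite E" by (auto simp: E_def intro: finite_PiE)
  obtain T c where T: "T \<subseteq> E" "T \<noteq> {}" "\<And>t. t \<in> T \<Longrightarrow> c t \<noteq> 0"
    "(\<Sum>t\<in>T. Const (c t) * (\<Prod>i=0..d. a i ^ t i)) = 0"
    by (rule mp.exists_nontrivial_relation[OF finE F(1) card sp]) (assumption | blast)+
  show ?thesis
  proof (rule that[of T c])
    show "inj_on (\<lambda>t. restrict t {0..d}) T"
      using T(1) unfolding inj_on_def E_def by (metis PiE_restrict subsetD)
    show "finite T" using T(1) finE by (rule finite_subset)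
  qed (use T in auto)
qed

lemma primeideal_mpoly_power:
  assumes P: "primeideal P (mpoly_ring V)" and "a \<in> carrier (mpoly_ring V)" "b \<in> carrier (mpoly_ring V)"
    "a ^ n * b \<in> P" "a \<notin> P"
  shows "b \<in> P"
  using assms(4)
proof (induction n)
  case (Suc n)
  then have "a * (a ^ n * b) \<in> P" by (simp add: mult.assoc)
  then show ?case using primeideal.I_prime[OF P, of a "a ^ n * b"] assms Suc.IH by auto
qed simp

text \<open>A relation among \<open>a\<^sub>j, \<dots>, a\<^sub>d\<close> modulo \<open>C\<^sub>j\<close>, divided by the largest possible power of \<open>a\<^sub>j\<close>,
  leaves a relation among \<open>a\<^sub>j\<^sub>+\<^sub>1, \<dots>, a\<^sub>d\<close> modulo \<open>C\<^sub>j\<^sub>+\<^sub>1\<close>.\<close>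

lemma krull_dimension_poly_ring:
  fixes C :: "nat \<Rightarrow> 'k::field mpoly set"
  assumes C: "\<And>i. i \<le> d + 1 \<Longrightarrow> primeideal (C i) (poly_ring d)"
    and strict: "\<And>i. i < d + 1 \<Longrightarrow> C i \<subset> C (Suc i)"
  shows False
proof -
  have ideal: "ideal (C i) (poly_ring d)" if "i \<le> d + 1" for i
    using C[OF that] by (simp add: primeideal_def)
  have "\<exists>x. x \<in> C (Suc i) \<and> x \<notin> C i" if "i \<le> d" for i
    using strict[of i] that by auto
  then obtain a where a: "\<And>i. i \<le> d \<Longrightarrow> a i \<in> C (Suc i)" "\<And>i. i \<le> d \<Longrightarrow> a i \<notin> C i"
    by metis
  have ac: "a i \<in> carrier (poly_ring d)" if "i \<le> d" for i
    using ideal_mpoly_subset[OF ideal a(1)] that by simp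
  have pc: "(\<Prod>i=j..d. a i ^ t i) \<in> carrier (poly_ring d)" for j t
    using ac by (intro prod_in_mpoly power_in_mpoly) simp
  have "\<exists>T c. finite T \<and> T \<noteq> {} \<and> (\<forall>t\<in>T. c t \<noteq> 0) \<and> inj_on (\<lambda>t. restrict t {j..d}) T \<and>
    (\<Sum>t\<in>T. Const (c t) * (\<Prod>i=j..d. a i ^ t i)) \<in> C j" if "j \<le> d + 1" for j
    using that
  proof (induction j)
    case 0
    obtain T c where T: "finite T" "T \<noteq> {}" "\<And>t. t \<in> T \<Longrightarrow> c t \<noteq> 0"
      "inj_on (\<lambda>t. restrict t {0..d}) T" "(\<Sum>t\<in>T. Const (c t) * (\<Prod>i=0..d. a i ^ t i)) = 0"
      using algebraically_dependent[of d a] ac by blast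
    have "(\<Sum>t\<in>T. Const (c t) * (\<Prod>i=0..d. a i ^ t i)) \<in> C 0"
      unfolding T(5) using ideal_mpoly_zero[OF ideal[of 0]] by simp
    with T(1-4) show ?case by blast
  next
    case (Suc j)
    then have j: "j \<le> d" by simp
    obtain T c where T: "finite T" "T \<noteq> {}" "\<And>t. t \<in> T \<Longrightarrow> c t \<noteq> 0"
      "inj_on (\<lambda>t. restrict t {j..d}) T" "(\<Sum>t\<in>T. Const (c t) * (\<Prod>i=j..d. a i ^ t i)) \<in> C j"
    proof -
      have "j \<le> d + 1" using j by simp
      from Suc.IH[OF this] show ?thesis using that by blast
    qed
    define m where "m = Min ((\<lambda>t. t j) ` T)"
    define T' where "T' = {t \<in> T. t j = m}"
    have le: "m \<le> t j" if "t \<in> T" for t using T(1) that by (simp add: m_def)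
    have "m \<in> (\<lambda>t. t j) ` T" unfolding m_def using T by (intro Min_in) auto
    then have ne: "T' \<noteq> {}" by (auto simp: T'_def)
    let ?P = "\<lambda>t. \<Prod>i=Suc j..d. a i ^ t i"
    define X where "X = (\<Sum>t\<in>T'. Const (c t) * ?P t)"
    define Y where "Y = (\<Sum>t\<in>T - T'. Const (c t) * a j ^ (t j - m - 1) * ?P t)"
    have X: "X \<in> carrier (poly_ring d)" and Y: "Y \<in> carrier (poly_ring d)"
      unfolding X_def Y_def by (intro sum_in_mpoly mult_in_mpoly Const_in_mpoly pc power_in_mpoly ac j)+
    have P: "(\<Prod>i=j..d. a i ^ t i) = a j ^ t j * ?P t" for t
      using j by (simp add: prod.atLeast_Suc_atMost)
    have eq: "(\<Sum>t\<in>T. Const (c t) * (\<Prod>i=j..d. a i ^ t i)) = a j ^ m * (X + a j * Y)"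
    proof -
      have "(\<Sum>t\<in>T. Const (c t) * (\<Prod>i=j..d. a i ^ t i)) =
        (\<Sum>t\<in>T'. Const (c t) * (a j ^ t j * ?P t)) + (\<Sum>t\<in>T - T'. Const (c t) * (a j ^ t j * ?P t))"
        unfolding P by (subst sum.subset_diff[OF _ T(1), of T']) (auto simp only: T'_def add.commute)
      also have "(\<Sum>t\<in>T'. Const (c t) * (a j ^ t j * ?P t)) = a j ^ m * X"
        unfolding X_def sum_distrib_left by (intro sum.cong) (auto simp: T'_def)
      also have "(\<Sum>t\<in>T - T'. Const (c t) * (a j ^ t j * ?P t)) = a j ^ m * (a j * Y)"
        unfolding Y_def sum_distrib_left
      proof (intro sum.cong refl)
        fix t assume "t \<in> T - T'"
        then have "t j > m" using le[of t] by (auto simp: T'_def)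
        then have "a j ^ t j = a j ^ m * (a j * a j ^ (t j - m - 1))"
          by (subst power_Suc[symmetric], subst power_add[symmetric]) simp
        then show "Const (c t) * (a j ^ t j * ?P t)
          = a j ^ m * (a j * (Const (c t) * a j ^ (t j - m - 1) * ?P t))"
          by (simp add: mult_ac)
      qed
      finally show ?thesis by (simp add: algebra_simps)
    qed
    have "X + a j * Y \<in> C j"
      using primeideal_mpoly_power[OF C[of j] ac[OF j] _ T(5)[unfolded eq] a(2)[OF j]] X Y j ac
      by simp
    then have "X + a j * Y \<in> C (Suc j)" using strict[of j] j by auto
    moreover have "a j * Y \<in> C (Suc j)"
      using ideal_mpoly_mult'[OF ideal a(1)[OF j] Y] j by simp
    ultimately have "X \<in> C (Suc j)"
      using ideal_mpoly_diff[OF ideal[of "Suc j"], of "X + a j * Y" "a j * Y"] j by simp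
    \<comment> \<open>On \<open>T'\<close> the coordinate j has the constant value m, so forgetting
      it loses nothing.\<close>
    moreover have "inj_on (\<lambda>t. restrict t {Suc j..d}) T'"
    proof (rule inj_onI)
      fix s t assume st: "s \<in> T'" "t \<in> T'" and eq: "restrict s {Suc j..d} = restrict t {Suc j..d}"
      have "restrict s {j..d} = restrict t {j..d}"
      proof
        fix i
        show "restrict s {j..d} i = restrict t {j..d} i"
          using fun_cong[OF eq, of i] st by (cases "i = j") (auto simp: T'_def restrict_def split: if_splits)
      qed
      then show "s = t" using T(4) st by (auto simp: inj_on_def T'_def)
    qed
    moreover have "finite T'" "\<forall>t\<in>T'. c t \<noteq> 0" using T(1,3) by (simp_all add: T'_def)
    ultimately show ?case using ne unfolding X_def by blast
  qed
  \<comment> \<open>At \<open>j = d + 1\<close> the interval \<open>{d + 1..d}\<close> is empty: all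
    products are 1, and injectivity of the restriction leaves a single exponent function. The last
    prime of the chain then contains a nonzero constant.\<close>
  from this[OF order_refl] obtain T c where T: "T \<noteq> {}" "\<And>t. t \<in> T \<Longrightarrow> c t \<noteq> (0::'k)"
      "inj_on (\<lambda>t. restrict t {d + 1..d}) T"
      and "(\<Sum>t\<in>T. Const (c t) * (\<Prod>i=d+1..d. a i ^ t i)) \<in> C (d + 1)"
    by blast
  then have sum: "(\<Sum>t\<in>T. Const (c t)) \<in> C (d + 1)" by simp
  obtain t where "t \<in> T" using T(1) by blast
  moreover have "s = t" if "s \<in> T" for s
    using inj_onD[OF T(3) _ that \<open>t \<in> T\<close>] by (simp add: restrict_def)
  ultimately have "T = {t}" by blast
  then have t: "Const (c t) \<in> C (d + 1)" "c t \<noteq> 0" using T(2) sum by simp_all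
  have "x \<in> C (d + 1)" if "x \<in> carrier (poly_ring d)" for x
  proof -
    have "(x * Const (inverse (c t))) * Const (c t) \<in> C (d + 1)"
      using that t by (intro ideal_mpoly_mult[OF ideal]) auto
    moreover have "(x * Const (inverse (c t))) * Const (c t) = x"
      using t(2) by (simp add: mult.assoc flip: Const_mult)
    ultimately show ?thesis by simp
  qed
  then show False
    using primeideal.I_notcarr[OF C[of "d + 1"]] ideal_mpoly_subset[OF ideal[of "d + 1"]] by auto
qed

section \<open>Upper bounds for the codimension\<close>

text \<open>A chain ending in P can be prolonged by Q, so its length stays below d; since P contains
  I, its height bounds the codimension.\<close>

lemma codim_less:
  fixes P Q :: "'k::field mpoly set"
  assumes P: "primeideal P (poly_ring d)" and Q: "primeideal Q (poly_ring d)" "P \<subset> Q" and I: "I \<subseteq> P"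
  shows "codim (poly_ring d) I < enat d"
proof -
  have len: "n < d" if C: "\<forall>i\<le>n. primeideal (C i) (poly_ring d)" "\<forall>i<n. C i \<subset> C (Suc i)" "C n = P" for n C
  proof (rule ccontr)
    assume "\<not> n < d"
    \<comment> \<open>For n = d the chain used ends in Q; for n > d the first d + 2 members of C are
      already too many.\<close>
    show False
    proof (rule krull_dimension_poly_ring[of d "\<lambda>i. if i \<le> n then C i else Q"])
      show "primeideal (if i \<le> n then C i else Q) (poly_ring d)" for i using C Q by simp
      fix i assume "i < d + 1"
      then show "(if i \<le> n then C i else Q) \<subset> (if Suc i \<le> n then C (Suc i) else Q)"
        using C Q \<open>\<not> n < d\<close> by (cases "i = n") auto
    qed
  qed
  \<comment> \<open>The chain consisting of P alone forces d to be positive, so \<open>d - 1\<close>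
    is not truncated.\<close>
  have "0 < d" using len[of 0 "\<lambda>_. P"] P by auto
  have "codim (poly_ring d) I \<le> prime_height (poly_ring d) P"
    unfolding codim_def using P I by (intro INF_lower) simp
  also have "\<dots> \<le> enat (d - 1)"
    unfolding prime_height_def
  proof (rule SUP_least)
    fix n assume "n \<in> {n. \<exists>C. (\<forall>i\<le>n. primeideal (C i) (poly_ring d)) \<and> (\<forall>i<n. C i \<subset> C (Suc i)) \<and> C n = P}"
    then have "n < d" using len by blast
    then show "enat n \<le> enat (d - 1)" by simp
  qed
  also have "\<dots> < enat d" using \<open>0 < d\<close> by simp
  finally show ?thesis .
qed

lemma primeideal_mpolyI:
  fixes P :: "'k::field mpoly set"
  assumes "ideal P (mpoly_ring V)" "1 \<notin> P"
    "\<And>p q. p \<in> carrier (mpoly_ring V) \<Longrightarrow> q \<in> carrier (mpoly_ring V) \<Longrightarrow> p * q \<in> P \<Longrightarrow> p \<in> P \<or> q \<in> P"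
  shows "primeideal P (mpoly_ring V)"
proof (rule primeidealI[OF assms(1) mpoly_ring_cring])
  show "carrier (mpoly_ring V) \<noteq> P" using assms(2) one_in_mpoly[of V] by metis
qed (use assms(3) in simp)

text \<open>The kernel of a homomorphism into an integral domain; 1 lies outside because constants
  are fixed.\<close>

lemma primeideal_subst_kernel:
  "primeideal {p \<in> carrier (mpoly_ring V). subst_poly f p = 0} (mpoly_ring V)"
  by (intro primeideal_mpolyI ideal_mpolyI) (auto simp: subst_poly_add subst_poly_mult)

lemma primeideal_no_constant_term:
  "primeideal {p \<in> carrier (mpoly_ring V). Poly_Mapping.lookup p 0 = 0} (mpoly_ring V)"
  by (intro primeideal_mpolyI ideal_mpolyI) (auto simp: lookup_add)

text \<open>The kernel of the substitution is a prime containing I. Since each \<open>f i\<close>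
  vanishes at the origin, constant terms are preserved, so the kernel lies in the prime of
  polynomials without constant term; \<open>nz\<close> makes this inclusion proper.\<close>

lemma codim_subst_kernel_less:
  fixes f :: "nat \<Rightarrow> 'k::field mpoly"
  assumes I: "\<And>p. p \<in> I \<Longrightarrow> p \<in> carrier (poly_ring d) \<and> subst_poly f p = 0"
    and f: "\<And>i. i \<in> {1..d} \<Longrightarrow> Poly_Mapping.lookup (f i) 0 = 0"
    and nz: "\<exists>p\<in>carrier (poly_ring d). Poly_Mapping.lookup p 0 = 0 \<and> subst_poly f p \<noteq> 0"
  shows "codim (poly_ring d) I < enat d"
proof (rule codim_less[OF primeideal_subst_kernel primeideal_no_constant_term])
  have "Poly_Mapping.lookup (subst_poly f p) 0 = Poly_Mapping.lookup p 0"
    if "p \<in> carrier (poly_ring d)" for p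
    using that by (induction rule: mpoly_induct)
      (auto simp: subst_poly_add subst_poly_mult lookup_add f lookup_Const lookup_ord_ge[OF ord_ge_Var(1)])
  then show "{p \<in> carrier (poly_ring d). subst_poly f p = 0} \<subset>
    {p \<in> carrier (poly_ring d). Poly_Mapping.lookup p 0 = 0}"
    using nz by fastforce
qed (use I in auto)

subsection \<open>Ideals of diagonal forms\<close>

text \<open>\<open>diag_ideal V D\<close> is spanned by all monomials of degree at least three and the quadrics
  annihilated by the functional \<open>x\<^sub>ix\<^sub>j \<mapsto> \<delta>\<^sub>i\<^sub>j D\<^sub>i\<close>; this is the normal form of the theorem
  when at least two of the \<open>D\<^sub>i\<close> are nonzero.\<close>

definition diag_form :: "nat set \<Rightarrow> (nat \<Rightarrow> 'k::field) \<Rightarrow> 'k mpoly \<Rightarrow> 'k" where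
  "diag_form V D p = (\<Sum>k\<in>V. D k * Poly_Mapping.lookup p (Poly_Mapping.single k 2))"

definition diag_ideal :: "nat set \<Rightarrow> (nat \<Rightarrow> 'k::field) \<Rightarrow> 'k mpoly set" where
  "diag_ideal V D = {p \<in> carrier (mpoly_ring V). ord_ge 2 p \<and> diag_form V D p = 0}"

lemma ord_ge_mult_left: "ord_ge n q \<Longrightarrow> ord_ge n (p * q)"
  using ord_ge_mult[of 0 p n q] by simp

lemma diag_form_0 [simp]: "diag_form V D 0 = 0"
  by (simp add: diag_form_def)

lemma diag_form_add: "diag_form V D (p + q) = diag_form V D p + diag_form V D q"
  by (simp add: diag_form_def lookup_add algebra_simps sum.distrib)

lemma diag_form_diff: "diag_form V D (p - q) = diag_form V D p - diag_form V D q"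
  by (simp add: diag_form_def lookup_minus algebra_simps sum_subtractf)

lemma diag_form_Const_mult: "diag_form V D (Const c * p) = c * diag_form V D p"
  unfolding diag_form_def sum_distrib_left by (intro sum.cong refl) simp

lemma diag_form_sum: "diag_form V D (sum f A) = (\<Sum>a\<in>A. diag_form V D (f a))"
  by (induction A rule: infinite_finite_induct) (simp_all add: diag_form_add)

lemma diag_form_mult:
  "ord_ge 2 p \<Longrightarrow> diag_form V D (a * p) = Poly_Mapping.lookup a 0 * diag_form V D p"
  by (simp add: diag_form_def lookup_mult_ord_ge sum_distrib_left mult_ac)

lemma diag_form_ord_ge_3: "ord_ge 3 p \<Longrightarrow> diag_form V D p = 0"
  by (simp add: diag_form_def lookup_ord_ge[of 3 p])

lemma lookup_Var_mult:
  "Poly_Mapping.lookup (Var i * Var j :: 'k::field mpoly) (Poly_Mapping.single k 2)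
    = (if i = k \<and> j = k then 1 else 0)"
proof -
  have "Poly_Mapping.single i 1 + Poly_Mapping.single j 1 = Poly_Mapping.single k (2::nat) \<longleftrightarrow> i = k \<and> j = k"
    (is "?l = ?r \<longleftrightarrow> _")
  proof
    assume eq: "?l = ?r"
    have "Poly_Mapping.lookup ?l i = Poly_Mapping.lookup ?r i"
      "Poly_Mapping.lookup ?l j = Poly_Mapping.lookup ?r j" using eq by simp_all
    then show "i = k \<and> j = k" by (auto simp: lookup_add lookup_single when_def split: if_splits)
  qed (simp flip: single_add add: numeral_2_eq_2)
  then show ?thesis by (simp add: Var_def mult_single lookup_single when_def)
qed

lemma diag_form_Var_mult:
  assumes "finite V"
  shows "diag_form V D (Var i * Var j) = (if i = j \<and> i \<in> V then D i else 0)"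
proof -
  have "diag_form V D (Var i * Var j) = (\<Sum>k\<in>V. if k = i then (if i = j then D i else 0) else 0)"
    unfolding diag_form_def lookup_Var_mult by (intro sum.cong) auto
  then show ?thesis using assms by simp
qed

text \<open>By \<open>diag_form_mult\<close> a factor a multiplies the value of the form by its
  constant term, so the kernel absorbs multiplication although the form is linear only over the
  constants.\<close>

lemma diag_ideal_ideal: "ideal (diag_ideal V D) (mpoly_ring V)"
proof (rule ideal_mpolyI)
  fix a p :: "'a mpoly" assume "a \<in> carrier (mpoly_ring V)" "p \<in> diag_ideal V D"
  then show "a * p \<in> diag_ideal V D"
    by (auto simp: diag_ideal_def diag_form_mult ord_ge_mult_left)
qed (auto simp: diag_ideal_def diag_form_add ord_ge_add)

lemma exp_split:
  assumes "0 < tdeg t" "Poly_Mapping.keys t \<subseteq> V"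
  obtains i s where "i \<in> V" "Poly_Mapping.keys s \<subseteq> V" "t = Poly_Mapping.single i 1 + s"
    "tdeg t = Suc (tdeg s)"
proof -
  obtain i s where w: "i \<in> Poly_Mapping.keys t" "t = Poly_Mapping.single i 1 + s" "tdeg t = Suc (tdeg s)"
    using assms(1) by (rule exp_Suc_cases)
  have "Poly_Mapping.keys s \<subseteq> Poly_Mapping.keys t"
    unfolding w(2) keys_exp_add by blast
  with w assms(2) show ?thesis using that[of i s] by auto
qed

lemma monom_eval_Var_in_mpoly [simp]:
  "Poly_Mapping.keys t \<subseteq> V \<Longrightarrow> monom_eval Var t \<in> carrier (mpoly_ring V)"
  unfolding monom_eval_def by (auto intro!: prod_in_mpoly power_in_mpoly)

lemma ord_ge_monom_eval [simp]: "ord_ge (tdeg t) (monom_eval Var t)"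
  by (metis Const_1 keys_single mult_1 ord_ge_def order_refl single_eq_monom_eval singletonD zero_neq_one)

lemma monom_eval_single_add: "monom_eval f (Poly_Mapping.single i 1 + s) = f i * monom_eval f s"
  by (simp add: monom_eval_add)

lemma monomial_split:
  fixes t :: "nat \<Rightarrow>\<^sub>0 nat"
  assumes "2 \<le> tdeg t" "Poly_Mapping.keys t \<subseteq> V"
  obtains i j u where "i \<in> V" "j \<in> V" "Poly_Mapping.keys u \<subseteq> V" "tdeg t = Suc (Suc (tdeg u))"
    "monom_eval Var t = Var i * Var j * (monom_eval Var u :: 'k::field mpoly)"
proof -
  have "0 < tdeg t" using assms(1) by simp
  then obtain i s where s: "i \<in> V" "Poly_Mapping.keys s \<subseteq> V" "t = Poly_Mapping.single i 1 + s"
    "tdeg t = Suc (tdeg s)" using assms(2) by (rule exp_split)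
  have "0 < tdeg s" using assms(1) s(4) by simp
  then obtain j u where u: "j \<in> V" "Poly_Mapping.keys u \<subseteq> V" "s = Poly_Mapping.single j 1 + u"
    "tdeg s = Suc (tdeg u)" using s(2) by (rule exp_split)
  have "monom_eval Var t = Var i * Var j * (monom_eval Var u :: 'k mpoly)"
    by (simp only: s(3) u(3) monom_eval_single_add mult.assoc)
  with s u show ?thesis using that[of i j u] by simp
qed

lemma mpoly_expansion_in_ideal:
  assumes I: "ideal I (mpoly_ring V)" and p: "p \<in> carrier (mpoly_ring V)"
    and mon: "\<And>t. t \<in> Poly_Mapping.keys p \<Longrightarrow> Poly_Mapping.keys t \<subseteq> V \<Longrightarrow> monom_eval Var t \<in> I"
  shows "p \<in> I"
  by (subst mpoly_expansion[of p], intro ideal_mpoly_sum[OF I] ideal_mpoly_mult[OF I] mon)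
    (use p in \<open>simp_all add: carrier_mpoly_ring[of p]\<close>)

section \<open>The maximal ideal and its square\<close>

lemma ord_ge_1_eq:
  "genideal (mpoly_ring V) (Var ` V) = {p \<in> carrier (mpoly_ring V :: 'a::field mpoly ring). ord_ge 1 p}"
proof (rule antisym)
  have "ideal {p \<in> carrier (mpoly_ring V). ord_ge 1 p} (mpoly_ring V :: 'a mpoly ring)"
    by (rule ideal_mpolyI) (auto simp: ord_ge_add ord_ge_mult_left)
  then show "genideal (mpoly_ring V) (Var ` V) \<subseteq> {p \<in> carrier (mpoly_ring V :: 'a mpoly ring). ord_ge 1 p}"
    by (rule genideal_mpoly_minimal) auto
  have I: "ideal (genideal (mpoly_ring V) (Var ` V)) (mpoly_ring V :: 'a mpoly ring)"
    by (rule genideal_mpoly_ideal) auto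
  show "{p \<in> carrier (mpoly_ring V :: 'a mpoly ring). ord_ge 1 p} \<subseteq> genideal (mpoly_ring V) (Var ` V)"
  proof safe
    fix p :: "'a mpoly" assume p: "p \<in> carrier (mpoly_ring V)" "ord_ge 1 p"
    show "p \<in> genideal (mpoly_ring V) (Var ` V)"
    proof (rule mpoly_expansion_in_ideal[OF I p(1)])
      fix t assume t: "t \<in> Poly_Mapping.keys p" "Poly_Mapping.keys t \<subseteq> V"
      then have "0 < tdeg t" using p(2) by (force simp: ord_ge_def)
      then obtain i s where "i \<in> V" "Poly_Mapping.keys s \<subseteq> V" "t = Poly_Mapping.single i 1 + s"
        using exp_split[OF _ t(2)] by metis
      then show "monom_eval Var t \<in> (genideal (mpoly_ring V) (Var ` V) :: 'a mpoly set)"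
        by (simp only: monom_eval_single_add)
          (rule ideal_mpoly_mult'[OF I genideal_mpoly_self], auto simp: image_subset_iff)
    qed
  qed
qed

lemma max_ideal_eq: "max_ideal d = {p \<in> carrier (poly_ring d). ord_ge 1 p}"
  unfolding max_ideal_def by (rule ord_ge_1_eq)

text \<open>Generators are replaced one factor at a time: for fixed b in B the elements a with a b
  in the right-hand ideal form an ideal containing A, and then the same argument runs in the second
  factor.\<close>

lemma genideal_prod:
  assumes A: "A \<subseteq> carrier (mpoly_ring V)" and B: "B \<subseteq> carrier (mpoly_ring V)"
  shows "genideal (mpoly_ring V) A \<cdot>\<^bsub>mpoly_ring V\<^esub> genideal (mpoly_ring V) B
    = genideal (mpoly_ring V) {a * b | a b. a \<in> A \<and> b \<in> B}" (is "?A \<cdot>\<^bsub>_\<^esub> ?B = ?C")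
proof -
  have sub: "{a * b | a b. a \<in> A \<and> b \<in> B} \<subseteq> carrier (mpoly_ring V)"
    using A B by (auto intro!: mult_in_mpoly)
  have IA: "ideal ?A (mpoly_ring V)" and IB: "ideal ?B (mpoly_ring V)" and IC: "ideal ?C (mpoly_ring V)"
    using A B sub by (auto intro!: genideal_mpoly_ideal)
  have IP: "ideal (?A \<cdot>\<^bsub>mpoly_ring V\<^esub> ?B) (mpoly_ring V)"
    by (rule ring.ideal_prod_is_ideal[OF mpoly_ring_ring IA IB])
  have 1: "a * b \<in> ?C" if "a \<in> ?A" "b \<in> B" for a b
  proof -
    have "?A \<subseteq> {a \<in> carrier (mpoly_ring V). a * b \<in> ?C}"
    proof (rule genideal_mpoly_minimal)
      show "ideal {a \<in> carrier (mpoly_ring V). a * b \<in> ?C} (mpoly_ring V)"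
        by (rule ideal_mpolyI)
          (auto simp: distrib_right mult.assoc ideal_mpoly_zero[OF IC] ideal_mpoly_add[OF IC] ideal_mpoly_mult[OF IC])
      show "A \<subseteq> {a \<in> carrier (mpoly_ring V). a * b \<in> ?C}"
        using A that by (auto intro!: genideal_mpoly_self[OF sub])
    qed
    then show ?thesis using that by auto
  qed
  have 2: "a * b \<in> ?C" if "a \<in> ?A" "b \<in> ?B" for a b
  proof -
    have "?B \<subseteq> {b \<in> carrier (mpoly_ring V). a * b \<in> ?C}"
    proof (rule genideal_mpoly_minimal)
      show "ideal {b \<in> carrier (mpoly_ring V). a * b \<in> ?C} (mpoly_ring V)"
        by (rule ideal_mpolyI)
          (auto simp: distrib_left mult.left_commute ideal_mpoly_zero[OF IC] ideal_mpoly_add[OF IC] ideal_mpoly_mult[OF IC])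
    qed (use B that 1 in auto)
    then show ?thesis using that by auto
  qed
  show ?thesis
  proof (rule antisym)
    show "?C \<subseteq> ?A \<cdot>\<^bsub>mpoly_ring V\<^esub> ?B"
    proof (rule genideal_mpoly_minimal[OF IP])
      show "{a * b | a b. a \<in> A \<and> b \<in> B} \<subseteq> ?A \<cdot>\<^bsub>mpoly_ring V\<^esub> ?B"
      proof safe
        fix a b assume "a \<in> A" "b \<in> B"
        then have "a \<in> ?A" "b \<in> ?B" using A B genideal_mpoly_self by blast+
        then show "a * b \<in> ?A \<cdot>\<^bsub>mpoly_ring V\<^esub> ?B"
          using ideal_prod.prod[of a ?A b ?B "mpoly_ring V"] by simp
      qed
    qed
    show "?A \<cdot>\<^bsub>mpoly_ring V\<^esub> ?B \<subseteq> ?C"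
    proof
      fix x assume "x \<in> ?A \<cdot>\<^bsub>mpoly_ring V\<^esub> ?B"
      then show "x \<in> ?C" by induction (auto simp: 2 ideal_mpoly_add[OF IC])
    qed
  qed
qed

text \<open>The first description supplies generators; the second decides membership and gives
  access to degree-two parts.\<close>

lemma max_ideal_prod_eq:
  "max_ideal d \<cdot>\<^bsub>poly_ring d\<^esub> (max_ideal d :: 'a::field mpoly set) = genideal (poly_ring d) {Var i * Var j | i j. i \<in> {1..d} \<and> j \<in> {1..d}}"
  (is ?A)
  "max_ideal d \<cdot>\<^bsub>poly_ring d\<^esub> (max_ideal d :: 'a mpoly set) = {p \<in> carrier (poly_ring d). ord_ge 2 p}"
  (is ?B)
proof -
  let ?R = "poly_ring d :: 'a mpoly ring" and ?S = "{Var i * Var j | i j. i \<in> {1..d} \<and> j \<in> {1..d}} :: 'a mpoly set"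
  have sub: "?S \<subseteq> carrier ?R" by (auto intro!: mult_in_mpoly)
  have I: "ideal (genideal ?R ?S) ?R"
    by (rule genideal_mpoly_ideal[OF sub])
  have "{a * b | a b. a \<in> Var ` {1..d} \<and> b \<in> Var ` {1..d}} = ?S"
    by blast
  then show A: ?A
    unfolding max_ideal_def by (subst genideal_prod) auto
  have "ideal {p \<in> carrier ?R. ord_ge 2 p} ?R"
    by (rule ideal_mpolyI) (auto simp: ord_ge_add ord_ge_mult_left)
  then have "genideal ?R ?S \<subseteq> {p \<in> carrier ?R. ord_ge 2 p}"
    by (rule genideal_mpoly_minimal) (use sub in auto)
  moreover have "p \<in> genideal ?R ?S" if p: "p \<in> carrier ?R" "ord_ge 2 p" for p
  proof (rule mpoly_expansion_in_ideal[OF I p(1)])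
    fix t assume t: "t \<in> Poly_Mapping.keys p" "Poly_Mapping.keys t \<subseteq> {1..d}"
    then have "2 \<le> tdeg t" using p(2) by (force simp: ord_ge_def)
    from this t(2) obtain i j u where "i \<in> {1..d}" "j \<in> {1..d}" "Poly_Mapping.keys u \<subseteq> {1..d}"
      "tdeg t = Suc (Suc (tdeg u))" "monom_eval Var t = Var i * Var j * (monom_eval Var u :: 'a mpoly)"
      by (rule monomial_split)
    then show "monom_eval Var t \<in> genideal ?R ?S"
      by (simp only:) (rule ideal_mpoly_mult'[OF I genideal_mpoly_self[OF sub]], blast, simp)
  qed
  ultimately show ?B unfolding A by blast
qed

subsection \<open>The normal form\<close>

text \<open>The monomial generators of three summands of \<open>normal_form\<close> at once: ordered
  pairs merge the mixed products with the squares x_i^2 for i \<le> r.\<close>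

definition nf_monomials :: "nat \<Rightarrow> nat \<Rightarrow> 'k::field mpoly set" where
  "nf_monomials r d = {Var i * Var j | i j. i \<in> {1..d} \<and> j \<in> {1..d} \<and> (i \<noteq> j \<or> i \<le> r)}"

definition nf_binomials :: "nat \<Rightarrow> nat \<Rightarrow> (nat \<Rightarrow> 'k::field) \<Rightarrow> 'k mpoly set" where
  "nf_binomials r d \<epsilon> = (\<lambda>k. Var (r + 1) ^ 2 + Const (\<epsilon> k) * Var k ^ 2) ` {r + 2..d}"

text \<open>The diagonal values of a functional that kills the normal form, normalized to 1 at
  x_(r+1)^2. The binomial with sign \<epsilon> k forces the value -1/\<epsilon> k at x_k^2, which is
  -\<epsilon> k when \<epsilon> k squares to 1.\<close>

definition nf_coeff :: "nat \<Rightarrow> (nat \<Rightarrow> 'k::field) \<Rightarrow> nat \<Rightarrow> 'k" where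
  "nf_coeff r \<epsilon> k = (if k \<le> r then 0 else if k = r + 1 then 1 else - \<epsilon> k)"

lemma nf_monomials_carrier: "nf_monomials r d \<subseteq> carrier (poly_ring d)"
  by (auto simp: nf_monomials_def intro!: mult_in_mpoly)

lemma nf_binomials_carrier: "nf_binomials r d \<epsilon> \<subseteq> carrier (poly_ring d)"
  by (auto simp: nf_binomials_def intro!: add_in_mpoly mult_in_mpoly power_in_mpoly)

lemma Var_ideal_prod:
  assumes "r \<le> d"
  shows "genideal (poly_ring d) (Var ` {1..r}) \<cdot>\<^bsub>poly_ring d\<^esub> max_ideal d
    = genideal (poly_ring d) {Var i * Var j | i j. i \<in> {1..r} \<and> j \<in> {1..d}}"
proof -
  have "{a * b | a b. a \<in> Var ` {1..r} \<and> b \<in> Var ` {1..d}}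
    = ({Var i * Var j | i j. i \<in> {1..r} \<and> j \<in> {1..d}} :: 'a mpoly set)"
    by blast
  then show ?thesis
    unfolding max_ideal_def using assms by (subst genideal_prod) auto
qed

lemma K_mixed_squares:
  assumes "r \<le> d"
  shows "K_mixed r d <+>\<^bsub>poly_ring d\<^esub> squares r d
    = genideal (poly_ring d) (Var ` {1..r}) \<cdot>\<^bsub>poly_ring d\<^esub> (max_ideal d :: 'k::field mpoly set)"
proof -
  let ?A = "{Var i * Var j | i j. 1 \<le> i \<and> i \<le> r \<and> i < j \<and> j \<le> d} \<union> {Var i ^ 2 | i. 1 \<le> i \<and> i \<le> r} :: 'k mpoly set"
  let ?B = "{Var i * Var j | i j. i \<in> {1..r} \<and> j \<in> {1..d}} :: 'k mpoly set"
  have eq: "K_mixed r d <+>\<^bsub>poly_ring d\<^esub> squares r d = genideal (poly_ring d) ?A"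
    unfolding K_mixed_def squares_def
    using assms by (intro genideal_mpoly_Un) (auto intro!: mult_in_mpoly power_in_mpoly)
  have "?A = ?B"
  proof (intro equalityI subsetI)
    fix x assume "x \<in> ?A"
    then show "x \<in> ?B"
      using assms unfolding power2_eq_square by (elim UnE CollectE exE conjE) (fastforce intro!: exI)+
  next
    fix x assume "x \<in> ?B"
    then obtain i j where ij: "x = Var i * Var j" "1 \<le> i" "i \<le> r" "1 \<le> j" "j \<le> d" by auto
    then consider "i < j" | "i = j" | "j < i" by linarith
    then show "x \<in> ?A"
    proof cases
      case 1
      with ij show ?thesis by blast
    next
      case 2
      with ij have "x = Var i ^ 2" by (simp add: power2_eq_square)
      with ij show ?thesis by blast
    next
      case 3
      with ij assms have "x = Var j * Var i" "j \<le> r" "i \<le> d" by (auto simp: mult.commute)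
      with ij 3 show ?thesis by blast
    qed
  qed
  then show ?thesis by (simp only: eq Var_ideal_prod[OF assms])
qed

lemma normal_form_eq:
  fixes \<epsilon> :: "nat \<Rightarrow> 'a::field"
  assumes "r \<le> d"
  shows "normal_form r d \<epsilon> = genideal (poly_ring d) (nf_monomials r d \<union> nf_binomials r d \<epsilon>)"
proof -
  let ?A = "{Var i * Var j | i j. 1 \<le> i \<and> i \<le> r \<and> i < j \<and> j \<le> d} :: 'a mpoly set"
  let ?B = "{Var i * Var j | i j. r + 1 \<le> i \<and> i < j \<and> j \<le> d} :: 'a mpoly set"
  let ?C = "{Var i ^ 2 | i. 1 \<le> i \<and> i \<le> r} :: 'a mpoly set"
  let ?D = "{Var (r + 1) ^ 2 + Const (\<epsilon> k) * Var k ^ 2 | k. r + 2 \<le> k \<and> k \<le> d}"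
  have sub: "?A \<subseteq> carrier (poly_ring d)" "?B \<subseteq> carrier (poly_ring d)" "?C \<subseteq> carrier (poly_ring d)"
    "?D \<subseteq> carrier (poly_ring d)"
    using assms by (auto intro!: add_in_mpoly mult_in_mpoly power_in_mpoly)
  have D: "?D = nf_binomials r d \<epsilon>" by (auto simp: nf_binomials_def)
  have "?A \<union> ?B \<union> ?C = nf_monomials r d"
  proof (intro equalityI subsetI)
    fix x :: "'a mpoly" assume "x \<in> ?A \<union> ?B \<union> ?C"
    then show "x \<in> nf_monomials r d"
      using assms unfolding nf_monomials_def power2_eq_square
      by (elim UnE CollectE exE conjE) (force intro!: exI)+
  next
    fix x :: "'a mpoly" assume "x \<in> nf_monomials r d"
    then obtain i j where ij: "x = Var i * Var j" "1 \<le> i" "i \<le> d" "1 \<le> j" "j \<le> d" "i \<noteq> j \<or> i \<le> r"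
      by (auto simp: nf_monomials_def)
    have *: "Var a * Var b \<in> ?A \<union> ?B" if "1 \<le> a" "a < b" "b \<le> d" for a b
      using that by (cases "a \<le> r") (blast, force)
    consider "i < j" | "i = j" | "j < i" by linarith
    then show "x \<in> ?A \<union> ?B \<union> ?C"
    proof cases
      case 1
      with ij * have "x \<in> ?A \<union> ?B" by simp
      then show ?thesis by (rule UnI1)
    next
      case 2
      with ij have "x = Var i ^ 2" "i \<le> r" by (auto simp: power2_eq_square)
      with ij show ?thesis by blast
    next
      case 3
      with ij have "x = Var j * Var i" by (simp add: mult.commute)
      with ij 3 * have "x \<in> ?A \<union> ?B" by simp
      then show ?thesis by (rule UnI1)
    qed
  qed
  then show ?thesis
    unfolding normal_form_def K_mixed_def K_complete_def squares_def signed_squares_def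
    using sub by (simp only: genideal_mpoly_Un D Un_subset_iff simp_thms nf_monomials_carrier)
qed

lemma nf_coeff_square:
  assumes "\<And>k. \<epsilon> k * \<epsilon> k = 1" "r < k"
  shows "nf_coeff r \<epsilon> k * nf_coeff r \<epsilon> k = 1"
  using assms by (auto simp: nf_coeff_def)

lemma normal_form_subset_diag_ideal:
  fixes \<epsilon> :: "nat \<Rightarrow> 'a::field"
  assumes "r \<le> d" "\<And>k. \<epsilon> k * \<epsilon> k = 1"
  shows "nf_monomials r d \<subseteq> diag_ideal {1..d} (nf_coeff r \<epsilon>)"
    "nf_binomials r d \<epsilon> \<subseteq> diag_ideal {1..d} (nf_coeff r \<epsilon>)"
proof -
  show "nf_monomials r d \<subseteq> diag_ideal {1..d} (nf_coeff r \<epsilon>)"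
  proof
    fix p :: "'a mpoly" assume p: "p \<in> nf_monomials r d"
    then obtain i j where "p = Var i * Var j" "i \<noteq> j \<or> i \<le> r"
      unfolding nf_monomials_def by blast
    then show "p \<in> diag_ideal {1..d} (nf_coeff r \<epsilon>)"
      using p nf_monomials_carrier[of r d] by (auto simp: diag_ideal_def diag_form_Var_mult nf_coeff_def)
  qed
  show "nf_binomials r d \<epsilon> \<subseteq> diag_ideal {1..d} (nf_coeff r \<epsilon>)"
  proof
    fix p assume p: "p \<in> nf_binomials r d \<epsilon>"
    then obtain k where k: "k \<in> {r + 2..d}" "p = Var (r + 1) * Var (r + 1) + Const (\<epsilon> k) * (Var k * Var k)"
      unfolding nf_binomials_def power2_eq_square by blast
    then have "ord_ge 2 p" by (auto intro!: ord_ge_add ord_ge_mult_left[of _ "Var k * Var k"])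
    then show "p \<in> diag_ideal {1..d} (nf_coeff r \<epsilon>)"
      using p k nf_binomials_carrier[of r d \<epsilon>] assms
      by (auto simp: diag_ideal_def diag_form_Var_mult nf_coeff_def diag_form_add diag_form_Const_mult)
  qed
qed

text \<open>Modulo the generators each monomial of degree two is congruent to its value under the
  form times x_(r+1)^2, and each monomial of higher degree to 0. Summed over the expansion of p this
  leaves the value of p times x_(r+1)^2, that is, 0.\<close>

lemma normal_form_diag_ideal:
  assumes rd: "r + 2 \<le> d" and \<epsilon>: "\<And>k. \<epsilon> k * \<epsilon> k = (1 :: 'k::field)"
  shows "normal_form r d \<epsilon> = diag_ideal {1..d} (nf_coeff r \<epsilon>)"
proof (rule antisym)
  let ?R = "poly_ring d :: 'k mpoly ring" and ?D = "nf_coeff r \<epsilon>"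
  have r: "r \<le> d" using rd by simp
  define N where "N = genideal ?R (nf_monomials r d \<union> nf_binomials r d \<epsilon>)"
  have gens: "nf_monomials r d \<union> nf_binomials r d \<epsilon> \<subseteq> carrier ?R"
    using nf_monomials_carrier nf_binomials_carrier by blast
  have N: "ideal N ?R" unfolding N_def by (rule genideal_mpoly_ideal[OF gens])
  have nf: "normal_form r d \<epsilon> = N" unfolding N_def by (rule normal_form_eq[OF r])
  show "normal_form r d \<epsilon> \<subseteq> diag_ideal {1..d} ?D"
    unfolding nf N_def using normal_form_subset_diag_ideal[where \<epsilon>=\<epsilon>, OF r \<epsilon>]
    by (intro genideal_mpoly_minimal diag_ideal_ideal) auto
  define x where "x i = (Var i :: 'k mpoly)" for i
  have x: "x i \<in> carrier ?R" if "i \<in> {1..d}" for i using that by (simp add: x_def)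
  have mixed: "x i * x j \<in> N" if "i \<in> {1..d}" "j \<in> {1..d}" "i \<noteq> j \<or> i \<le> r" for i j
    unfolding N_def x_def
    by (rule genideal_mpoly_self[OF gens]) (use that in \<open>auto simp: nf_monomials_def\<close>)
  \<comment> \<open>For k beyond r + 1 this is the binomial multiplied by \<epsilon> k, whose square
    is 1.\<close>
  have square: "x k * x k - Const (?D k) * (x (r + 1) * x (r + 1)) \<in> N" if k: "k \<in> {1..d}" for k
  proof -
    consider "k \<le> r" | "k = r + 1" | "r + 2 \<le> k" by linarith
    then show ?thesis
    proof cases
      case 1
      then show ?thesis using mixed[OF k k] by (simp add: nf_coeff_def)
    next
      case 2
      then show ?thesis using ideal_mpoly_zero[OF N] by (simp add: nf_coeff_def)
    next
      case 3
      then have "x (r + 1) ^ 2 + Const (\<epsilon> k) * x k ^ 2 \<in> N"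
        unfolding N_def x_def nf_binomials_def using k
        by (intro genideal_mpoly_self[OF gens[unfolded nf_binomials_def]] UnI2 image_eqI[of _ _ k]) simp_all
      then have "Const (\<epsilon> k) * (x (r + 1) ^ 2 + Const (\<epsilon> k) * x k ^ 2) \<in> N"
        by (rule ideal_mpoly_mult[OF N Const_in_mpoly])
      moreover have "Const (\<epsilon> k) * (x (r + 1) ^ 2 + Const (\<epsilon> k) * x k ^ 2)
        = Const (\<epsilon> k * \<epsilon> k) * x k ^ 2 + Const (\<epsilon> k) * x (r + 1) ^ 2"
        by (simp only: Const_mult distrib_left mult.assoc add.commute)
      ultimately show ?thesis
        using 3 by (simp add: \<epsilon> nf_coeff_def Const_uminus power2_eq_square)
    qed
  qed
  have swap: "x i * (x k * x k) \<in> N" if "i \<in> {1..d}" "k \<in> {1..d}" "i \<noteq> k" for i k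
    using ideal_mpoly_mult'[OF N mixed x, of i k k] that by (simp add: mult.assoc)
  have cube: "x i * (x i * x i) \<in> N" if i: "i \<in> {1..d}" for i
  proof (cases "i \<le> r")
    case True
    then show ?thesis using ideal_mpoly_mult[OF N x mixed, of i i i] i by simp
  next
    case False
    \<comment> \<open>A variable beyond r needs a partner k whose square is proportional to x_i^2:
      then x_i^3 is congruent to c x_i x_k^2, which contains the mixed product x_i x_k. The partner
      is r + 1, except for i = r + 1 itself, whose partner r + 2 exists by
      \<open>rd\<close>.\<close>
    obtain c k where k: "k \<in> {1..d}" "k \<noteq> i" "x i * x i - Const c * (x k * x k) \<in> N"
    proof (cases "i = r + 1")
      case True
      let ?c = "?D (r + 2)" and ?k = "r + 2"
      have k: "?k \<in> {1..d}" using rd by simp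
      have "Const (- ?c) * (x ?k * x ?k - Const ?c * (x (r + 1) * x (r + 1))) \<in> N"
        by (intro ideal_mpoly_mult[OF N] square k) auto
      moreover have "Const (- ?c) * (x ?k * x ?k - Const ?c * (x (r + 1) * x (r + 1)))
        = Const (?c * ?c) * (x (r + 1) * x (r + 1)) - Const ?c * (x ?k * x ?k)"
        by (simp only: Const_mult Const_uminus) (simp add: algebra_simps)
      moreover have "?c * ?c = 1" using nf_coeff_square[where \<epsilon>=\<epsilon>, OF \<epsilon>] by simp
      ultimately have "x i * x i - Const ?c * (x ?k * x ?k) \<in> N" using True by simp
      with True show ?thesis by (intro that[of ?k ?c] k) simp_all
    next
      case False
      with square[OF i] rd show ?thesis by (intro that[of "r + 1" "?D i"]) simp_all
    qed
    have "x i * (x i * x i - Const c * (x k * x k)) + Const c * (x i * (x k * x k)) \<in> N"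
      using k i by (intro ideal_mpoly_add[OF N] ideal_mpoly_mult[OF N] swap x) auto
    then show ?thesis by (simp add: algebra_simps)
  qed
  have high: "monom_eval Var t \<in> N" if t: "Poly_Mapping.keys t \<subseteq> {1..d}" "3 \<le> tdeg t" for t
  proof -
    have t2: "2 \<le> tdeg t" using t(2) by simp
    obtain i j u where u: "i \<in> {1..d}" "j \<in> {1..d}" "Poly_Mapping.keys u \<subseteq> {1..d}"
      "tdeg t = Suc (Suc (tdeg u))" "monom_eval Var t = x i * x j * monom_eval Var u"
      unfolding x_def by (rule monomial_split[OF t2 t(1)])
    have "0 < tdeg u" using u(4) t(2) by simp
    then obtain l w where w: "l \<in> {1..d}" "Poly_Mapping.keys w \<subseteq> {1..d}" "u = Poly_Mapping.single l 1 + w"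
      using exp_split[OF _ u(3)] by metis
    have "x i * (x j * x l) \<in> N"
    proof (cases "i = j")
      case True
      then show ?thesis using cube[of i] swap[of l i] u(1) w(1) by (cases "l = i") (auto simp: mult_ac)
    next
      case False
      then show ?thesis using ideal_mpoly_mult'[OF N mixed x, of i j l] u(1,2) w(1)
        by (simp add: mult.assoc)
    qed
    then have "x i * (x j * x l) * monom_eval Var w \<in> N"
      using w(2) by (rule ideal_mpoly_mult'[OF N _ monom_eval_Var_in_mpoly])
    then show ?thesis by (simp only: u(5) w(3) monom_eval_single_add x_def mult.assoc)
  qed
  have mono: "monom_eval Var t - Const (diag_form {1..d} ?D (monom_eval Var t)) * (x (r + 1) * x (r + 1)) \<in> N"
    if t: "Poly_Mapping.keys t \<subseteq> {1..d}" "2 \<le> tdeg t" for t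
  proof (cases "3 \<le> tdeg t")
    case True
    have "ord_ge 3 (monom_eval Var t :: 'k mpoly)"
      using ord_ge_mono[OF ord_ge_monom_eval True] .
    then show ?thesis using high[OF t(1) True] by (simp add: diag_form_ord_ge_3)
  next
    case False
    obtain i j u where u: "i \<in> {1..d}" "j \<in> {1..d}" "Poly_Mapping.keys u \<subseteq> {1..d}"
      "tdeg t = Suc (Suc (tdeg u))" "monom_eval Var t = x i * x j * monom_eval Var u"
      unfolding x_def by (rule monomial_split[OF t(2,1)])
    have "tdeg u = 0" using False u(4) by linarith
    then have eq: "monom_eval Var t = x i * x j" using u(5) by simp
    show ?thesis
    proof (cases "i = j")
      case True
      then show ?thesis unfolding eq using square[OF u(1)] u(1)
        by (simp add: x_def diag_form_Var_mult)
    next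
      case False
      then show ?thesis unfolding eq using mixed[OF u(1,2)]
        by (simp add: x_def diag_form_Var_mult)
    qed
  qed
  show "diag_ideal {1..d} ?D \<subseteq> normal_form r d \<epsilon>"
    unfolding nf
  proof
    fix p assume p: "p \<in> diag_ideal {1..d} ?D"
    let ?m = "\<lambda>t. monom_eval Var t :: 'k mpoly" and ?c = "Poly_Mapping.lookup p" and ?y = "x (r + 1) * x (r + 1)"
    have exp: "p = (\<Sum>t\<in>Poly_Mapping.keys p. Const (?c t) * ?m t)" by (rule mpoly_expansion)
    have "(\<Sum>t\<in>Poly_Mapping.keys p. ?c t * diag_form {1..d} ?D (?m t)) = diag_form {1..d} ?D p"
      unfolding diag_form_Const_mult[symmetric] diag_form_sum[symmetric] by (simp only: exp[symmetric])
    also have "\<dots> = 0" using p by (simp add: diag_ideal_def)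
    finally have 0: "(\<Sum>t\<in>Poly_Mapping.keys p. ?c t * diag_form {1..d} ?D (?m t)) = 0" .
    have "(\<Sum>t\<in>Poly_Mapping.keys p. Const (?c t) * (?m t - Const (diag_form {1..d} ?D (?m t)) * ?y)) \<in> N"
    proof (intro ideal_mpoly_sum[OF N] ideal_mpoly_mult[OF N] mono)
      fix t assume "t \<in> Poly_Mapping.keys p"
      then show "Poly_Mapping.keys t \<subseteq> {1..d}" "2 \<le> tdeg t"
        using p by (auto simp: diag_ideal_def carrier_mpoly_ring ord_ge_def)
    qed simp
    also have "(\<Sum>t\<in>Poly_Mapping.keys p. Const (?c t) * (?m t - Const (diag_form {1..d} ?D (?m t)) * ?y))
      = p - Const (\<Sum>t\<in>Poly_Mapping.keys p. ?c t * diag_form {1..d} ?D (?m t)) * ?y"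
      unfolding right_diff_distrib sum_subtractf exp[symmetric] Const_sum Const_mult sum_distrib_right mult.assoc ..
    also have "\<dots> = p" unfolding 0 by simp
    finally show "p \<in> N" .
  qed
qed

text \<open>Each generator either has a factor x_i with i \<le> r or involves only variables beyond
  r. Because the first r diagonal values are 0, the functional of the full ring restricts to the one
  that defines the ideal in the smaller ring.\<close>

lemma normal_form_decomposition:
  assumes rd: "r + 2 \<le> d" and \<epsilon>: "\<And>k. \<epsilon> k * \<epsilon> k = (1 :: 'k::field)"
  shows "normal_form r d \<epsilon> = (genideal (poly_ring d) (Var ` {1..r}) \<cdot>\<^bsub>poly_ring d\<^esub> max_ideal d)
    <+>\<^bsub>poly_ring d\<^esub> genideal (poly_ring d) (diag_ideal {r + 1..d} (nf_coeff r \<epsilon>))"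
    (is "_ = ?A \<cdot>\<^bsub>_\<^esub> _ <+>\<^bsub>_\<^esub> genideal _ ?J")
proof -
  let ?R = "poly_ring d :: 'k mpoly ring"
  let ?B = "{Var i * Var j | i j. i \<in> {1..r} \<and> j \<in> {1..d}} :: 'k mpoly set"
  have r: "r \<le> d" using rd by simp
  have B: "?B \<subseteq> carrier ?R" using r by (auto intro!: mult_in_mpoly)
  have Jc: "p \<in> carrier ?R" if "p \<in> ?J" for p
  proof -
    have "p \<in> carrier (mpoly_ring {r + 1..d})" using that by (simp add: diag_ideal_def)
    then show ?thesis by (fastforce simp: carrier_mpoly_ring)
  qed
  have form: "diag_form {1..d} (nf_coeff r \<epsilon>) p = diag_form {r + 1..d} (nf_coeff r \<epsilon>) p" for p
    unfolding diag_form_def by (rule sum.mono_neutral_right) (auto simp: nf_coeff_def)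
  have "?A \<cdot>\<^bsub>?R\<^esub> max_ideal d <+>\<^bsub>?R\<^esub> genideal ?R ?J = genideal ?R (?B \<union> ?J)"
    unfolding Var_ideal_prod[OF r] using B Jc by (intro genideal_mpoly_Un) auto
  also have "\<dots> = normal_form r d \<epsilon>"
  proof (rule antisym)
    have "?B \<subseteq> nf_monomials r d"
    proof
      fix x assume "x \<in> ?B"
      then obtain i j where ij: "x = Var i * Var j" "i \<in> {1..r}" "j \<in> {1..d}" by blast
      then have "i \<in> {1..d}" "i \<le> r" using r by auto
      with ij show "x \<in> nf_monomials r d" unfolding nf_monomials_def by blast
    qed
    then have "?B \<subseteq> diag_ideal {1..d} (nf_coeff r \<epsilon>)"
      using normal_form_subset_diag_ideal(1)[where \<epsilon>=\<epsilon>, OF r \<epsilon>] by (rule subset_trans)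
    moreover have "?J \<subseteq> diag_ideal {1..d} (nf_coeff r \<epsilon>)"
    proof
      fix p assume "p \<in> ?J"
      then show "p \<in> diag_ideal {1..d} (nf_coeff r \<epsilon>)"
        using Jc[of p] form[of p] by (simp add: diag_ideal_def)
    qed
    ultimately show "genideal ?R (?B \<union> ?J) \<subseteq> normal_form r d \<epsilon>"
      unfolding normal_form_diag_ideal[where \<epsilon>=\<epsilon>, OF rd \<epsilon>]
      by (intro genideal_mpoly_minimal diag_ideal_ideal Un_least)
    have "nf_monomials r d \<union> nf_binomials r d \<epsilon> \<subseteq> ?B \<union> ?J"
    proof
      fix p assume p: "p \<in> nf_monomials r d \<union> nf_binomials r d \<epsilon>"
      then have p': "p \<in> diag_ideal {1..d} (nf_coeff r \<epsilon>)"
        using normal_form_subset_diag_ideal[where \<epsilon>=\<epsilon>, OF r \<epsilon>] by blast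
      have "p \<in> ?B \<or> p \<in> carrier (mpoly_ring {r + 1..d})"
        using p
      proof
        assume "p \<in> nf_monomials r d"
        then obtain i j where ij: "p = Var i * Var j" "i \<in> {1..d}" "j \<in> {1..d}"
          unfolding nf_monomials_def by blast
        consider "i \<le> r" | "j \<le> r" | "r < i \<and> r < j" by linarith
        then show ?thesis
        proof cases
          case 1
          with ij have "i \<in> {1..r}" by simp
          with ij show ?thesis by blast
        next
          case 2
          with ij have "p = Var j * Var i" by (simp add: mult.commute)
          moreover from ij 2 have "j \<in> {1..r}" by simp
          ultimately show ?thesis using ij(2) by blast
        next
          case 3
          with ij have "p \<in> carrier (mpoly_ring {r + 1..d})" by simp
          then show ?thesis ..
        qed
      qed (auto simp: nf_binomials_def intro!: add_in_mpoly mult_in_mpoly power_in_mpoly)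
      then show "p \<in> ?B \<union> ?J"
      proof
        assume "p \<in> carrier (mpoly_ring {r + 1..d})"
        then have "p \<in> ?J" using p' form[of p] by (simp add: diag_ideal_def)
        then show ?thesis ..
      qed (rule UnI1)
    qed
    then show "normal_form r d \<epsilon> \<subseteq> genideal ?R (?B \<union> ?J)"
      unfolding normal_form_eq[OF r] using B Jc by (intro genideal_mpoly_mono) auto
  qed
  finally show ?thesis by simp
qed

section \<open>Monomials and binomials among the generators\<close>

lemma monomial_nf_monomials: "p \<in> nf_monomials r d \<Longrightarrow> monomial p"
  by (auto simp: nf_monomials_def monomial_def Var_def mult_single)

lemma lookup_nf_binomial:
  fixes c :: "'k::field"
  assumes "k \<noteq> l"
  shows "Poly_Mapping.lookup (Var l ^ 2 + Const c * Var k ^ 2) t =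
    (if t = Poly_Mapping.single l 2 then 1 else if t = Poly_Mapping.single k 2 then c else 0)"
proof -
  have "Poly_Mapping.single l (2::nat) \<noteq> Poly_Mapping.single k 2"
    using assms by (metis lookup_single_eq lookup_single_not_eq zero_neq_numeral)
  moreover have "Var i ^ 2 = (Poly_Mapping.single (Poly_Mapping.single i 2) 1 :: 'k mpoly)" for i
    by (simp add: Var_def power2_eq_square mult_single flip: single_add add: numeral_2_eq_2)
  ultimately show ?thesis by (auto simp: lookup_add lookup_single when_def)
qed

lemma single_inject_2: "Poly_Mapping.single k (2::nat) = Poly_Mapping.single l 2 \<longleftrightarrow> k = l"
  by (metis lookup_single_eq lookup_single_not_eq zero_neq_numeral)

lemma binomial_nf_binomials:
  assumes "\<And>k. \<epsilon> k \<noteq> 0" "p \<in> nf_binomials r d \<epsilon>"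
  shows "binomial_poly p"
proof -
  obtain k where k: "r + 2 \<le> k" "p = Var (r + 1) ^ 2 + Const (\<epsilon> k) * Var k ^ 2"
    using assms(2) by (auto simp: nf_binomials_def)
  have "Poly_Mapping.keys p = {Poly_Mapping.single (r + 1) 2, Poly_Mapping.single k 2}"
    using k assms(1) by (auto simp: in_keys_iff lookup_nf_binomial split: if_splits)
  then show ?thesis using k by (simp add: binomial_poly_def single_inject_2)
qed

text \<open>The coefficient at x_k^2, which is the nonzero \<epsilon> k, tells the binomial of k
  apart from all others; the index set \<open>{r + 2..d}\<close> has d - r - 1 elements.\<close>

lemma card_nf_binomials:
  assumes "\<And>k. \<epsilon> k \<noteq> 0"
  shows "card (nf_binomials r d \<epsilon>) = d - r - 1"
proof -
  have "inj_on (\<lambda>k. Var (r + 1) ^ 2 + Const (\<epsilon> k) * Var k ^ 2) {r + 2..d}"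
  proof (rule inj_onI)
    fix k l assume kl: "k \<in> {r + 2..d}" "l \<in> {r + 2..d}"
      and eq: "Var (r + 1) ^ 2 + Const (\<epsilon> k) * Var k ^ 2 = Var (r + 1) ^ 2 + Const (\<epsilon> l) * Var l ^ 2"
    have "Poly_Mapping.lookup (Var (r + 1) ^ 2 + Const (\<epsilon> k) * Var k ^ 2) (Poly_Mapping.single k 2) = \<epsilon> k"
      using kl by (subst lookup_nf_binomial) (auto simp: single_inject_2)
    moreover have "Poly_Mapping.lookup (Var (r + 1) ^ 2 + Const (\<epsilon> l) * Var l ^ 2) (Poly_Mapping.single k 2)
      = (if k = l then \<epsilon> l else 0)"
      using kl by (subst lookup_nf_binomial) (auto simp: single_inject_2)
    ultimately show "k = l" using eq assms by (metis (full_types))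
  qed
  then show ?thesis unfolding nf_binomials_def by (simp add: card_image)
qed

subsection \<open>Quotient rings\<close>

context
  fixes I :: "'k::field mpoly set" and V
  assumes I: "ideal I (mpoly_ring V)"
begin

private abbreviation (input) "Q \<equiv> mpoly_ring V Quot I"
private abbreviation (input) "coset p \<equiv> I +>\<^bsub>mpoly_ring V\<^esub> p"

lemma quot_mpoly_ring_hom: "ring_hom_ring (mpoly_ring V) Q coset"
  by (rule ideal.rcos_ring_hom_ring[OF I])

lemma quot_mpoly_cring: "cring Q"
  by (rule ideal.quotient_is_cring[OF I mpoly_ring_cring])

lemma quot_mpoly_carrier: "carrier Q = coset ` carrier (mpoly_ring V)"
  by (auto simp: FactRing_def A_RCOSETS_def' image_def a_r_coset_def')

lemma quot_mpoly_closed: "p \<in> carrier (mpoly_ring V) \<Longrightarrow> coset p \<in> carrier Q"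
  by (simp add: quot_mpoly_carrier)

lemma quot_mpoly_mult:
  "p \<in> carrier (mpoly_ring V) \<Longrightarrow> q \<in> carrier (mpoly_ring V) \<Longrightarrow> coset p \<otimes>\<^bsub>Q\<^esub> coset q = coset (p * q)"
  using ring_hom_mult[OF ring_hom_ring.homh[OF quot_mpoly_ring_hom], of p q] by simp

lemma quot_mpoly_add:
  "p \<in> carrier (mpoly_ring V) \<Longrightarrow> q \<in> carrier (mpoly_ring V) \<Longrightarrow> coset p \<oplus>\<^bsub>Q\<^esub> coset q = coset (p + q)"
  using ring_hom_add[OF ring_hom_ring.homh[OF quot_mpoly_ring_hom], of p q] by simp

lemma quot_mpoly_one: "\<one>\<^bsub>Q\<^esub> = coset 1"
  by (simp add: FactRing_def)

lemma quot_mpoly_zero: "\<zero>\<^bsub>Q\<^esub> = coset 0"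
proof -
  have "\<zero>\<^bsub>mpoly_ring V\<^esub> = (0 :: 'k mpoly)" by simp
  then show ?thesis using ring_hom_zero[OF ring_hom_ring.homh[OF quot_mpoly_ring_hom] mpoly_ring_ring
      ideal.quotient_is_ring[OF I]] by simp
qed

lemma coset_eq_zero_iff:
  "p \<in> carrier (mpoly_ring V) \<Longrightarrow> coset p = \<zero>\<^bsub>Q\<^esub> \<longleftrightarrow> p \<in> I"
  using rcos_mpoly_eq_iff[OF I, of p 0] by (simp add: quot_mpoly_zero)

subsection \<open>Dimensions over the field of constants\<close>

lemma subfield_Const_mpoly: "subfield (range Const) (mpoly_ring V :: 'k mpoly ring)"
proof -
  interpret cring "mpoly_ring V :: 'k mpoly ring" by (rule mpoly_ring_cring)
  show ?thesis
  proof (rule subfieldI)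
    have "subring (range Const) (mpoly_ring V :: 'k mpoly ring)"
    proof (rule subringI)
      show "\<one>\<^bsub>mpoly_ring V\<^esub> \<in> range (Const :: 'k \<Rightarrow> 'k mpoly)"
        using rangeI[of Const 1] by simp
    qed (auto simp flip: Const_add Const_mult Const_uminus)
    then show "subcring (range Const) (mpoly_ring V :: 'k mpoly ring)"
      by (rule subcringI')
    show "Units (mpoly_ring V\<lparr>carrier := range Const\<rparr>) = range Const - {\<zero>\<^bsub>mpoly_ring V :: 'k mpoly ring\<^esub>}"
    proof (intro equalityI subsetI)
      fix x :: "'k mpoly" assume "x \<in> Units (mpoly_ring V\<lparr>carrier := range Const\<rparr>)"
      then show "x \<in> range Const - {\<zero>\<^bsub>mpoly_ring V\<^esub>}" by (auto simp: Units_def)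
    next
      fix x :: "'k mpoly" assume "x \<in> range Const - {\<zero>\<^bsub>mpoly_ring V\<^esub>}"
      then obtain c where c: "x = Const c" "c \<noteq> 0" by (metis Const_0 DiffE imageE mpoly_ring_simps(3) singletonI)
      then have "Const (inverse c) * x = 1" "x * Const (inverse c) = 1"
        by (simp_all flip: Const_mult)
      then show "x \<in> Units (mpoly_ring V\<lparr>carrier := range Const\<rparr>)"
        unfolding Units_def using c by auto
    qed
  qed
qed

private abbreviation (input) "K \<equiv> (\<lambda>c. coset (Const c)) ` (UNIV :: 'k set)"

lemma subfield_Const_quot:
  assumes "1 \<notin> I"
  shows "subfield K Q"
proof -
  have "\<one>\<^bsub>Q\<^esub> \<noteq> \<zero>\<^bsub>Q\<^esub>" using assms coset_eq_zero_iff[of 1] by (simp add: quot_mpoly_one)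
  then have "subfield (coset ` range Const) Q"
    using ring_hom_ring.img_is_subfield(2)[OF quot_mpoly_ring_hom subfield_Const_mpoly] by blast
  then show ?thesis by (simp add: image_image)
qed

text \<open>\<open>dimension\<close> is built from successive line extensions, so the classes of
  \<open>u 0\<close>, \<open>u 1\<close>, ... are adjoined one at a time; independence modulo I puts
  each new class outside the space reached so far.\<close>

lemma dimension_quot:
  assumes "\<And>i. i < n \<Longrightarrow> u i \<in> carrier (mpoly_ring V)"
    and "\<And>c. (\<Sum>i<n. Const (c i) * u i) \<in> I \<Longrightarrow> \<forall>i<n. c i = 0"
  shows "ring.dimension Q n K {coset (\<Sum>i<n. Const (c i) * u i) | c. True}"
  using assms
proof (induction n)
  case 0
  interpret Q: cring Q by (rule quot_mpoly_cring)
  show ?case using Q.zero_dim[of K] by (simp add: quot_mpoly_zero)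
next
  case (Suc n)
  interpret Q: cring Q by (rule quot_mpoly_cring)
  define E where "E = {coset (\<Sum>i<n. Const (c i) * u i) | c. True}"
  have u: "u i \<in> carrier (mpoly_ring V)" if "i \<le> n" for i using Suc.prems(1)[of i] that by simp
  have s: "(\<Sum>i<n. Const (c i) * u i) \<in> carrier (mpoly_ring V)" for c
    using u by (intro sum_in_mpoly mult_in_mpoly) auto
  have "\<forall>i<n. c i = 0" if "(\<Sum>i<n. Const (c i) * u i) \<in> I" for c
  proof -
    \<comment> \<open>A relation of length n is padded by a zero coefficient to fit the hypothesis
      for n + 1.\<close>
    let ?c = "c(n := 0)"
    have "(\<Sum>i<n. Const (?c i) * u i) = (\<Sum>i<n. Const (c i) * u i)" by (intro sum.cong) auto
    then have "(\<Sum>i<Suc n. Const (?c i) * u i) \<in> I" using that by simp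
    then have "\<forall>i<Suc n. ?c i = 0" by (rule Suc.prems(2))
    then show ?thesis by (metis fun_upd_other less_Suc_eq nat_neq_iff)
  qed
  then have dim: "Q.dimension n K E" unfolding E_def using u by (intro Suc.IH) auto
  have "coset (u n) \<notin> E"
  proof
    assume "coset (u n) \<in> E"
    then obtain c where "coset (u n) = coset (\<Sum>i<n. Const (c i) * u i)" unfolding E_def by blast
    then have "u n - (\<Sum>i<n. Const (c i) * u i) \<in> I"
      using rcos_mpoly_eq_iff[OF I u s] by blast
    moreover have "(\<Sum>i<Suc n. Const (if i = n then 1 else - c i) * u i) = u n - (\<Sum>i<n. Const (c i) * u i)"
      by (simp add: Const_uminus sum_negf)
    ultimately have "(\<Sum>i<Suc n. Const (if i = n then 1 else - c i) * u i) \<in> I" by simp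
    from Suc.prems(2)[OF this] show False by auto
  qed
  then have "Q.dimension (Suc n) K (Q.line_extension K (coset (u n)) E)"
    using dim u[of n] by (intro Q.Suc_dim quot_mpoly_closed) auto
  also have "Q.line_extension K (coset (u n)) E = {coset (\<Sum>i<Suc n. Const (c i) * u i) | c. True}"
  proof -
    have step: "(coset (Const a) \<otimes>\<^bsub>Q\<^esub> coset (u n)) \<oplus>\<^bsub>Q\<^esub> coset (\<Sum>i<n. Const (c i) * u i)
      = coset (\<Sum>i<Suc n. Const ((c(n := a)) i) * u i)" for a c
    proof -
      have "Const a * u n + (\<Sum>i<n. Const (c i) * u i) = (\<Sum>i<Suc n. Const ((c(n := a)) i) * u i)"
        by (simp add: add.commute)
      then show ?thesis using u[of n] s by (simp only: quot_mpoly_mult quot_mpoly_add mult_in_mpoly Const_in_mpoly)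
    qed
    have "Q.line_extension K (coset (u n)) E =
      {(coset (Const a) \<otimes>\<^bsub>Q\<^esub> coset (u n)) \<oplus>\<^bsub>Q\<^esub> coset (\<Sum>i<n. Const (c i) * u i) | a c. True}"
      unfolding Q.line_extension_def set_add_def' r_coset_def E_def by blast
    also have "\<dots> = {coset (\<Sum>i<Suc n. Const (c i) * u i) | c. True}"
    proof (intro equalityI subsetI)
      fix x assume "x \<in> {coset (\<Sum>i<Suc n. Const (c i) * u i) | c. True}"
      then obtain c where "x = coset (\<Sum>i<Suc n. Const (c i) * u i)" by blast
      then have "x = (coset (Const (c n)) \<otimes>\<^bsub>Q\<^esub> coset (u n)) \<oplus>\<^bsub>Q\<^esub> coset (\<Sum>i<n. Const (c i) * u i)"
        unfolding step by simp
      then show "x \<in> {(coset (Const a) \<otimes>\<^bsub>Q\<^esub> coset (u n)) \<oplus>\<^bsub>Q\<^esub> coset (\<Sum>i<n. Const (c i) * u i) | a c. True}"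
        by blast
    qed (unfold step, blast)
    finally show ?thesis .
  qed
  finally show ?case .
qed

end

subsection \<open>The Cohen--Macaulay type of the normal form\<close>

lemma lookup_Var: "Poly_Mapping.lookup (Var i) t = (if t = Poly_Mapping.single i 1 then 1 else 0)"
  by (auto simp: Var_def lookup_single when_def)

lemma single_inject_1: "Poly_Mapping.single k (1::nat) = Poly_Mapping.single l 1 \<longleftrightarrow> k = l"
  by (metis lookup_single_eq lookup_single_not_eq zero_neq_one)

definition lin_part :: "nat set \<Rightarrow> 'k::field mpoly \<Rightarrow> 'k mpoly" where
  "lin_part V p = (\<Sum>j\<in>V. Const (Poly_Mapping.lookup p (Poly_Mapping.single j 1)) * Var j)"

lemma lookup_linear:
  assumes "finite V"
  shows "Poly_Mapping.lookup (\<Sum>j\<in>V. Const (c j) * Var j) (Poly_Mapping.single i 1) = (if i \<in> V then c i else 0)"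
proof -
  have "Poly_Mapping.lookup (\<Sum>j\<in>V. Const (c j) * Var j) (Poly_Mapping.single i 1)
    = (\<Sum>j\<in>V. if j = i then c i else 0)"
    unfolding lookup_sum lookup_Const_mult lookup_Var single_inject_1 by (intro sum.cong) auto
  then show ?thesis using assms by simp
qed

lemma ord_ge_linear: "ord_ge 1 (\<Sum>j\<in>V. Const (c j) * Var j)"
  by (intro ord_ge_sum ord_ge_mult_left) simp

lemma ord_ge_2_remainder:
  assumes V: "finite V" and p: "p \<in> carrier (mpoly_ring V)"
  shows "ord_ge 2 (p - Const (Poly_Mapping.lookup p 0) - lin_part V p)" (is "ord_ge 2 ?q")
  unfolding ord_ge_def
proof (rule ballI, rule ccontr)
  fix t assume t: "t \<in> Poly_Mapping.keys ?q" and "\<not> 2 \<le> tdeg t"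
  then consider "tdeg t = 0" | "tdeg t = 1" by linarith
  then show False
  proof cases
    case 1
    then have "t = 0" by simp
    moreover have "Poly_Mapping.lookup (lin_part V p) 0 = 0"
      unfolding lin_part_def by (rule lookup_ord_ge[OF ord_ge_linear]) simp
    ultimately show False using t by (simp add: in_keys_iff lookup_minus lookup_Const)
  next
    case 2
    obtain i s where s: "t = Poly_Mapping.single i 1 + s" "tdeg t = Suc (tdeg s)"
      using exp_Suc_cases[of t] 2 by (metis zero_less_one)
    have "tdeg s = 0" using s(2) 2 by simp
    then have ti: "t = Poly_Mapping.single i 1" using s(1) by simp
    have "t \<noteq> 0" using 2 by auto
    have "Poly_Mapping.lookup p t = 0" if "i \<notin> V"
    proof (rule ccontr)
      assume "Poly_Mapping.lookup p t \<noteq> 0"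
      then have "Poly_Mapping.keys t \<subseteq> V" using p by (simp add: carrier_mpoly_ring in_keys_iff)
      then show False using that by (simp add: ti)
    qed
    then have "Poly_Mapping.lookup ?q t = 0"
      using \<open>t \<noteq> 0\<close> V by (auto simp: lookup_minus lookup_Const lin_part_def ti lookup_linear simp del: One_nat_def)
    then show False using t by (simp add: in_keys_iff)
  qed
qed

text \<open>Only the linear part of p contributes, since the rest times x_i has order at least
  three, and among the products x_j x_i only the square can have a nonzero value. Pairing with the
  variables thus reads off linear coefficients.\<close>

lemma diag_form_mult_Var:
  assumes V: "finite V" and p: "p \<in> carrier (mpoly_ring V)" "ord_ge 1 p" and i: "i \<in> V"
  shows "diag_form V D (p * Var i) = D i * Poly_Mapping.lookup p (Poly_Mapping.single i 1)"
proof -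
  let ?l = "\<lambda>j. Poly_Mapping.lookup p (Poly_Mapping.single j 1)"
  have "Poly_Mapping.lookup p 0 = 0" using p(2) by (rule lookup_ord_ge) simp
  then have "ord_ge 2 (p - lin_part V p)" using ord_ge_2_remainder[OF V p(1)] by simp
  then have "ord_ge (2 + 1) ((p - lin_part V p) * Var i)" by (rule ord_ge_mult) simp
  then have "diag_form V D ((p - lin_part V p) * Var i) = 0" by (intro diag_form_ord_ge_3) simp
  then have "diag_form V D (p * Var i) = diag_form V D (lin_part V p * Var i)"
    by (simp add: left_diff_distrib diag_form_diff)
  also have "\<dots> = (\<Sum>j\<in>V. ?l j * diag_form V D (Var j * Var i))"
    by (simp add: lin_part_def sum_distrib_right diag_form_sum mult.assoc diag_form_Const_mult del: One_nat_def)
  also have "\<dots> = (\<Sum>j\<in>V. if j = i then D i * ?l i else 0)"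
    by (intro sum.cong refl) (simp add: diag_form_Var_mult V)
  finally show ?thesis using V i by simp
qed

section \<open>The socle for a diagonal form with zero entries up to r and nonzero entries
  beyond\<close>

context
  fixes D :: "nat \<Rightarrow> 'k::field" and r d :: nat
  assumes rd: "r < d" and D0: "\<And>k. k \<le> r \<Longrightarrow> D k = 0" and D1: "D (r + 1) = 1"
    and Dnz: "\<And>k. r < k \<Longrightarrow> D k \<noteq> 0"
begin

text \<open>Representatives of the socle in diagonal coordinates, parametrized by r + 1 constants:
  the radical of the form, spanned by x_1, ..., x_r, and one quadric of value 1. The shift
  reconciles variables numbered from 1 with coefficients numbered from 0.\<close>

definition socle_elem :: "(nat \<Rightarrow> 'k) \<Rightarrow> 'k mpoly" where
  "socle_elem c = (\<Sum>i<r. Const (c i) * Var (i + 1)) + Const (c r) * (Var (r + 1) * Var (r + 1))"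

lemma socle_elem_eq:
  "socle_elem c = (\<Sum>j\<in>{1..r}. Const (c (j - 1)) * Var j) + Const (c r) * (Var (r + 1) * Var (r + 1))"
proof -
  have "(\<Sum>i<r. Const (c i) * Var (i + 1)) = (\<Sum>j\<in>{1..r}. Const (c (j - 1)) * Var j)"
    by (rule sum.reindex_bij_witness[of _ "\<lambda>j. j - 1" "\<lambda>i. i + 1"]) auto
  then show ?thesis by (simp add: socle_elem_def)
qed

lemma socle_elem_carrier: "socle_elem c \<in> carrier (poly_ring d)"
  unfolding socle_elem_def using rd by (intro add_in_mpoly sum_in_mpoly mult_in_mpoly) auto

text \<open>Membership forces order two, which kills the coefficients of the variables; the form,
  whose value at x_(r+1)^2 is 1, then kills \<open>c r\<close>.\<close>

lemma socle_elem_independent: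
  assumes "socle_elem c \<in> diag_ideal {1..d} D"
  shows "\<forall>i<r + 1. c i = 0"
proof -
  have o: "ord_ge 2 (socle_elem c)" and f: "diag_form {1..d} D (socle_elem c) = 0"
    using assms by (auto simp: diag_ideal_def)
  have sq: "ord_ge 2 (Const (c r) * (Var (r + 1) * Var (r + 1)))"
    by (intro ord_ge_mult_left ord_ge_Var_mult)
  have "c (j - 1) = 0" if j: "j \<in> {1..r}" for j
  proof -
    have "Poly_Mapping.lookup (socle_elem c) (Poly_Mapping.single j 1) = c (j - 1)"
      unfolding socle_elem_eq lookup_add lookup_linear[OF finite_atLeastAtMost]
      using lookup_ord_ge[OF sq, of "Poly_Mapping.single j 1"] j by simp
    moreover have "Poly_Mapping.lookup (socle_elem c) (Poly_Mapping.single j 1) = 0"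
      by (rule lookup_ord_ge[OF o]) simp
    ultimately show ?thesis by simp
  qed
  then have low: "c i = 0" if "i < r" for i using that by (metis Suc_eq_plus1 Suc_leI add_diff_cancel_right' atLeastAtMost_iff le_add2)
  then have "socle_elem c = Const (c r) * (Var (r + 1) * Var (r + 1))"
    by (simp add: socle_elem_def)
  then have "c r = 0" using f rd by (simp add: diag_form_Const_mult diag_form_Var_mult D1[simplified])
  with low show ?thesis by (metis Suc_eq_plus1 less_SucE)
qed

text \<open>The variables up to r pair to zero with every p of order at least one, and x_(r+1)^2
  times such a p has order at least three.\<close>

lemma mult_socle_elem:
  assumes p: "p \<in> carrier (poly_ring d)" "ord_ge 1 p"
  shows "p * socle_elem c \<in> diag_ideal {1..d} D"
proof -
  have I: "ideal (diag_ideal {1..d} D) (poly_ring d)" by (rule diag_ideal_ideal)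
  have "p * Var j \<in> diag_ideal {1..d} D" if "j \<in> {1..r}" for j
  proof -
    have "ord_ge (1 + 1) (p * Var j)" using p(2) by (rule ord_ge_mult) simp
    moreover have "diag_form {1..d} D (p * Var j) = 0"
      using that rd p D0[of j] by (subst diag_form_mult_Var) auto
    moreover have "p * Var j \<in> carrier (poly_ring d)"
      using that rd p by (intro mult_in_mpoly) auto
    ultimately show ?thesis by (simp add: diag_ideal_def numeral_2_eq_2)
  qed
  then have 1: "(\<Sum>j\<in>{1..r}. Const (c (j - 1)) * (p * Var j)) \<in> diag_ideal {1..d} D"
    by (intro ideal_mpoly_sum[OF I] ideal_mpoly_mult[OF I Const_in_mpoly])
  have "ord_ge (1 + 2) (p * (Var (r + 1) * Var (r + 1)))"
    using p(2) ord_ge_Var_mult by (rule ord_ge_mult)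
  then have "ord_ge 3 (p * (Var (r + 1) * Var (r + 1)))" by (simp add: numeral_3_eq_3)
  moreover have "p * (Var (r + 1) * Var (r + 1)) \<in> carrier (poly_ring d)"
    using rd p by (intro mult_in_mpoly) auto
  ultimately have "p * (Var (r + 1) * Var (r + 1)) \<in> diag_ideal {1..d} D"
    by (simp add: diag_ideal_def diag_form_ord_ge_3 ord_ge_mono[of 3 _ 2])
  then have 2: "Const (c r) * (p * (Var (r + 1) * Var (r + 1))) \<in> diag_ideal {1..d} D"
    by (rule ideal_mpoly_mult[OF I Const_in_mpoly])
  have "p * socle_elem c = (\<Sum>j\<in>{1..r}. Const (c (j - 1)) * (p * Var j)) + Const (c r) * (p * (Var (r + 1) * Var (r + 1)))"
    unfolding socle_elem_eq distrib_left sum_distrib_left by (simp add: mult.left_commute)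
  then show ?thesis using ideal_mpoly_add[OF I 1 2] by simp
qed

text \<open>Such a p has no constant term, since p x_1 has order two, and no linear coefficient
  beyond r, since pairing with x_j yields D j times that coefficient. Up to x_1, ..., x_r it has
  order two, hence is congruent to its value under the form times x_(r+1)^2.\<close>

lemma socle_elem_exists:
  assumes p: "p \<in> carrier (poly_ring d)"
    and ann: "\<And>j. j \<in> {1..d} \<Longrightarrow> p * Var j \<in> diag_ideal {1..d} D"
  obtains c where "p - socle_elem c \<in> diag_ideal {1..d} D"
proof -
  let ?l = "\<lambda>j. Poly_Mapping.lookup p (Poly_Mapping.single j 1)"
  have ann': "ord_ge 2 (p * Var j)" "diag_form {1..d} D (p * Var j) = 0" if "j \<in> {1..d}" for j
    using ann[OF that] by (auto simp: diag_ideal_def)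
  have p0: "Poly_Mapping.lookup p 0 = 0"
  proof -
    have "Poly_Mapping.lookup (p * Var 1) (Poly_Mapping.single 1 1) = Poly_Mapping.lookup p 0 * Poly_Mapping.lookup (Var 1) (Poly_Mapping.single 1 1)"
      by (rule lookup_mult_ord_ge[of 1]) simp_all
    moreover have "Poly_Mapping.lookup (p * Var 1) (Poly_Mapping.single 1 1) = 0"
      by (rule lookup_ord_ge[OF ann'(1)]) (use rd in auto)
    ultimately show ?thesis by (simp add: lookup_Var)
  qed
  have p1: "ord_ge 1 p" using ord_ge_1_diff_Const[of p] by (simp add: p0)
  have l0: "?l j = 0" if "j \<in> {1..d}" "r < j" for j
    using diag_form_mult_Var[OF _ p p1 that(1), of D] ann'(2)[OF that(1)] Dnz[OF that(2)] by simp
  define q where "q = p - lin_part {1..d} p"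
  have q2: "ord_ge 2 q" using ord_ge_2_remainder[OF _ p] by (simp add: q_def p0)
  define c where "c i = (if i < r then ?l (i + 1) else diag_form {1..d} D q)" for i
  have "lin_part {1..d} p = (\<Sum>j\<in>{1..r}. Const (?l j) * Var j)"
    unfolding lin_part_def
  proof (rule sum.mono_neutral_right)
    show "\<forall>i\<in>{1..d} - {1..r}. Const (?l i) * Var i = 0"
    proof
      fix i assume "i \<in> {1..d} - {1..r}"
      then have "?l i = 0" by (intro l0) auto
      then show "Const (?l i) * Var i = 0" by (simp only: Const_0 mult_zero_left)
    qed
  qed (use rd in auto)
  also have "\<dots> = (\<Sum>j\<in>{1..r}. Const (c (j - 1)) * Var j)"
    by (intro sum.cong) (auto simp: c_def)
  finally have "p - socle_elem c = q - Const (diag_form {1..d} D q) * (Var (r + 1) * Var (r + 1))"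
    by (simp add: socle_elem_eq q_def c_def)
  moreover have "ord_ge 2 (q - Const (diag_form {1..d} D q) * (Var (r + 1) * Var (r + 1)))"
    by (intro ord_ge_diff q2 ord_ge_mult_left ord_ge_Var_mult)
  moreover have "diag_form {1..d} D (q - Const (diag_form {1..d} D q) * (Var (r + 1) * Var (r + 1))) = 0"
    using rd D1 by (simp add: diag_form_diff diag_form_Const_mult diag_form_Var_mult)
  ultimately have "p - socle_elem c \<in> diag_ideal {1..d} D"
    using diff_in_mpoly[OF p socle_elem_carrier[of c]] by (simp add: diag_ideal_def)
  then show ?thesis by (rule that)
qed

declare One_nat_def [simp del] \<comment> \<open>keeps \<open>{1..d}\<close> syntactically stable\<close>

text \<open>The socle is computed in diagonal coordinates and its basis carried back by the inverse
  \<tau>; this is legitimate because linear substitutions fix constant terms and so map the maximal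
  ideal into itself.\<close>

lemma cm_type_diag_ideal:
  assumes \<sigma>: "change_of_variables d \<sigma>" and I: "ideal I (poly_ring d)"
    and img: "\<sigma> ` I = diag_ideal {1..d} D"
  shows "has_cm_type d I n \<longleftrightarrow> n = r + 1"
proof -
  obtain A B where A: "\<sigma> = linear_subst d A"
    and inv: "\<And>p. p \<in> carrier (poly_ring d) \<Longrightarrow> linear_subst d B (\<sigma> p) = p"
      "\<And>p. p \<in> carrier (poly_ring d) \<Longrightarrow> \<sigma> (linear_subst d B p) = p"
    using change_of_variables_inverse[OF \<sigma>] by metis
  define \<tau> where "\<tau> = linear_subst d B"
  have mem: "p \<in> I \<longleftrightarrow> \<sigma> p \<in> diag_ideal {1..d} D" if "p \<in> carrier (poly_ring d)" for p
  proof
    assume "\<sigma> p \<in> diag_ideal {1..d} D"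
    then obtain q where q: "q \<in> I" "\<sigma> p = \<sigma> q" unfolding img[symmetric] by blast
    then have "p = q" using inv(1)[OF that] inv(1)[OF ideal_mpoly_subset[OF I q(1)]] by metis
    with q show "p \<in> I" by simp
  qed (use img in blast)
  have \<sigma>c: "\<sigma> p \<in> carrier (poly_ring d)" if "p \<in> carrier (poly_ring d)" for p
    unfolding A using that by simp
  have \<tau>c: "\<tau> p \<in> carrier (poly_ring d)" if "p \<in> carrier (poly_ring d)" for p
    unfolding \<tau>_def using that by simp
  have ord: "ord_ge 1 (linear_subst d C p)" if "p \<in> carrier (poly_ring d)" "ord_ge 1 p" for C and p :: "'k mpoly"
  proof -
    have "Poly_Mapping.lookup (linear_subst d C p) 0 = Poly_Mapping.lookup p 0"
      using that(1)
    proof (induction rule: mpoly_induct)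
      case (Var i)
      have "Poly_Mapping.lookup (\<Sum>j=1..d. Const (C i j) * Var j) 0 = 0"
        by (rule lookup_ord_ge[OF ord_ge_linear]) simp
      then show ?case by (simp add: linear_subst_eq lookup_ord_ge[OF ord_ge_Var(1)])
    qed (auto simp: linear_subst_add linear_subst_mult lookup_add)
    then show ?thesis
      using ord_ge_1_diff_Const[of "linear_subst d C p"] lookup_ord_ge[OF that(2), of 0] by simp
  qed
  define u where "u i = \<tau> (if i < r then Var (i + 1) else Var (r + 1) * Var (r + 1))" for i
  have uc: "u i \<in> carrier (poly_ring d)" if "i < r + 1" for i
    unfolding u_def using that rd by (intro \<tau>c) auto
  have sum_u: "(\<Sum>i<r + 1. Const (c i) * u i) = \<tau> (socle_elem c)" for c
    unfolding Suc_eq_plus1[symmetric] sum.lessThan_Suc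
    by (simp add: u_def socle_elem_def \<tau>_def linear_subst_add linear_subst_sum linear_subst_mult)
  have \<sigma>\<tau>: "\<sigma> (\<tau> (socle_elem c)) = socle_elem c" for c
    unfolding \<tau>_def by (rule inv(2)[OF socle_elem_carrier])
  have indep: "\<forall>i<r + 1. c i = 0" if "(\<Sum>i<r + 1. Const (c i) * u i) \<in> I" for c
    using that socle_elem_independent[of c] mem[OF \<tau>c[OF socle_elem_carrier], of c]
    unfolding sum_u \<sigma>\<tau> by blast
  let ?co = "\<lambda>p. I +>\<^bsub>poly_ring d\<^esub> p"
  have soc: "socle d I = {?co (\<Sum>i<r + 1. Const (c i) * u i) | c. True}"
  proof (intro equalityI subsetI)
    fix a assume "a \<in> socle d I"
    then have a: "a \<in> carrier (poly_ring d Quot I)"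
      "\<And>y. y \<in> max_ideal d \<Longrightarrow> ?co y \<otimes>\<^bsub>poly_ring d Quot I\<^esub> a = \<zero>\<^bsub>poly_ring d Quot I\<^esub>"
      by (auto simp: socle_def)
    obtain p where p: "p \<in> carrier (poly_ring d)" "a = ?co p"
      using a(1) unfolding quot_mpoly_carrier[OF I] by blast
    have ann: "y * p \<in> I" if y: "y \<in> carrier (poly_ring d)" "ord_ge 1 y" for y
      using a(2)[of y] y p coset_eq_zero_iff[OF I, of "y * p"]
      by (simp add: max_ideal_eq quot_mpoly_mult[OF I])
    have "\<sigma> p * Var j \<in> diag_ideal {1..d} D" if j: "j \<in> {1..d}" for j
    proof -
      have vj: "Var j \<in> carrier (poly_ring d)" using j by simp
      have "\<tau> (Var j) * p \<in> I"
        unfolding \<tau>_def by (rule ann) (use vj ord[OF vj] in auto)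
      then have "\<sigma> (\<tau> (Var j) * p) \<in> diag_ideal {1..d} D" using img by blast
      moreover have "\<sigma> (\<tau> (Var j) * p) = \<sigma> p * Var j"
        unfolding A linear_subst_mult using inv(2)[OF vj] by (simp add: A \<tau>_def mult.commute)
      ultimately show ?thesis by simp
    qed
    then obtain c where c: "\<sigma> p - socle_elem c \<in> diag_ideal {1..d} D"
      using socle_elem_exists[OF \<sigma>c[OF p(1)]] by blast
    have "\<sigma> (p - \<tau> (socle_elem c)) = \<sigma> p - socle_elem c"
      using \<sigma>\<tau> unfolding A linear_subst_diff by simp
    then have "p - \<tau> (socle_elem c) \<in> I"
      using c mem[of "p - \<tau> (socle_elem c)"] p(1) \<tau>c[OF socle_elem_carrier] by simp
    then have "?co p = ?co (\<tau> (socle_elem c))"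
      using rcos_mpoly_eq_iff[OF I p(1) \<tau>c[OF socle_elem_carrier]] by blast
    then show "a \<in> {?co (\<Sum>i<r + 1. Const (c i) * u i) | c. True}" unfolding sum_u p(2) by blast
  next
    fix a assume "a \<in> {?co (\<Sum>i<r + 1. Const (c i) * u i) | c. True}"
    then obtain c where a: "a = ?co (\<tau> (socle_elem c))" unfolding sum_u by blast
    note t = \<tau>c[OF socle_elem_carrier[of c]]
    show "a \<in> socle d I"
      unfolding socle_def
    proof (rule CollectI, intro conjI ballI)
      show "a \<in> carrier (poly_ring d Quot I)" unfolding a by (rule quot_mpoly_closed[OF I t])
      fix y :: "'k mpoly" assume "y \<in> max_ideal d"
      then have y: "y \<in> carrier (poly_ring d)" "ord_ge 1 y" by (simp_all add: max_ideal_eq)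
      have "\<sigma> (y * \<tau> (socle_elem c)) = \<sigma> y * socle_elem c"
        using \<sigma>\<tau>[of c] unfolding A linear_subst_mult by simp
      then have "\<sigma> (y * \<tau> (socle_elem c)) \<in> diag_ideal {1..d} D"
        using mult_socle_elem[of "\<sigma> y" c] ord[OF y, of A] \<sigma>c[OF y(1)] by (simp add: A)
      then have "y * \<tau> (socle_elem c) \<in> I" using mem y t by simp
      then show "?co y \<otimes>\<^bsub>poly_ring d Quot I\<^esub> a = \<zero>\<^bsub>poly_ring d Quot I\<^esub>"
        unfolding a using y t coset_eq_zero_iff[OF I, of "y * \<tau> (socle_elem c)"]
        by (simp add: quot_mpoly_mult[OF I])
    qed
  qed
  have dim: "has_cm_type d I (r + 1)"
    unfolding has_cm_type_def soc using uc indep by (rule dimension_quot[OF I])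
  \<comment> \<open>Uniqueness of the dimension requires the constants to form a field inside the
    quotient, hence that I is proper.\<close>
  have "\<sigma> 1 = 1" unfolding A by (simp add: linear_subst_eq)
  then have "1 \<notin> I" using mem[of 1] by (simp add: diag_ideal_def ord_ge_def)
  then have "has_cm_type d I n \<Longrightarrow> n = r + 1"
    using dim ring.dimension_is_inj[OF ideal.quotient_is_ring[OF I] subfield_Const_quot[OF I]]
    unfolding has_cm_type_def by blast
  with dim show ?thesis by blast
qed

end

subsection \<open>Self-injective rings and localizations\<close>

text \<open>Baer's criterion for A as a module over itself: an endomorphism of A is multiplication
  by the image of 1, so extending f to A amounts to finding c.\<close>

definition self_injective :: "('a, 'r) ring_scheme \<Rightarrow> bool" where
  "self_injective A \<longleftrightarrow> (\<forall>J f. ideal J A \<longrightarrow> (\<forall>x\<in>J. f x \<in> carrier A) \<longrightarrow>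
    (\<forall>x\<in>J. \<forall>y\<in>J. f (x \<oplus>\<^bsub>A\<^esub> y) = f x \<oplus>\<^bsub>A\<^esub> f y) \<longrightarrow>
    (\<forall>a\<in>carrier A. \<forall>x\<in>J. f (a \<otimes>\<^bsub>A\<^esub> x) = a \<otimes>\<^bsub>A\<^esub> f x) \<longrightarrow>
    (\<exists>c\<in>carrier A. \<forall>x\<in>J. f x = x \<otimes>\<^bsub>A\<^esub> c))"

text \<open>A copy of the module A on one-element lists, since
  \<open>finite_self_injective_dimension\<close> asks for modules on lists.\<close>

definition list_module :: "('a, 'r) ring_scheme \<Rightarrow> ('a, 'a list) module" where
  "list_module A = \<lparr>carrier = (\<lambda>x. [x]) ` carrier A, monoid.mult = undefined, one = undefined,
     ring.zero = [\<zero>\<^bsub>A\<^esub>], add = (\<lambda>x y. [hd x \<oplus>\<^bsub>A\<^esub> hd y]), smult = (\<lambda>a x. [a \<otimes>\<^bsub>A\<^esub> hd x])\<rparr>"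

definition trivial_module :: "('a, 'a list) module" where
  "trivial_module = \<lparr>carrier = {[]}, monoid.mult = undefined, one = undefined,
     ring.zero = [], add = (\<lambda>x y. []), smult = (\<lambda>a x. [])\<rparr>"

lemma list_module_module:
  assumes "cring A"
  shows "module A (list_module A)"
proof -
  interpret cring A by (rule assms)
  show ?thesis
  proof (rule moduleI[OF assms])
    show "abelian_group (list_module A)"
    proof (rule abelian_groupI)
      fix x assume "x \<in> carrier (list_module A)"
      then obtain a where "a \<in> carrier A" "x = [a]" by (auto simp: list_module_def)
      then show "\<exists>y\<in>carrier (list_module A). y \<oplus>\<^bsub>list_module A\<^esub> x = \<zero>\<^bsub>list_module A\<^esub>"
        by (intro bexI[of _ "[\<ominus>\<^bsub>A\<^esub> a]"]) (auto simp: list_module_def l_neg)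
    qed (auto simp: list_module_def a_ac)
  qed (auto simp: list_module_def l_distr r_distr m_assoc)
qed

lemma trivial_module_module:
  assumes "cring A"
  shows "module A (trivial_module :: ('a, 'a list) module)"
proof (rule moduleI[OF assms])
  show "abelian_group (trivial_module :: ('a, 'a list) module)"
    by (rule abelian_groupI) (auto simp: trivial_module_def)
qed (auto simp: trivial_module_def)

lemma trivial_module_injective:
  assumes "cring A"
  shows "injective_module A (trivial_module :: ('a, 'a list) module)"
  unfolding injective_module_def
proof (intro conjI allI impI ballI trivial_module_module[OF assms])
  fix J f assume "f \<in> module_homs A ((self_module A)\<lparr>carrier := J\<rparr>) (trivial_module :: ('a, 'a list) module)"
  then have "\<forall>x\<in>J. f x = []" by (auto simp: module_homs_def trivial_module_def)
  then show "\<exists>g\<in>module_homs A (self_module A) trivial_module. \<forall>x\<in>J. g x = f x"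
    by (intro bexI[of _ "\<lambda>_. []"]) (auto simp: module_homs_def trivial_module_def)
qed

lemma list_module_injective:
  assumes "cring A" and si: "self_injective A"
  shows "injective_module A (list_module A)"
  unfolding injective_module_def
proof (intro conjI allI impI ballI list_module_module[OF assms(1)])
  interpret cring A by (rule assms(1))
  fix J f assume J: "ideal J A" and f: "f \<in> module_homs A ((self_module A)\<lparr>carrier := J\<rparr>) (list_module A)"
  have Jc: "x \<in> carrier A" if "x \<in> J" for x using ideal.Icarr[OF J that] .
  have Ja: "x \<oplus>\<^bsub>A\<^esub> y \<in> J" if "x \<in> J" "y \<in> J" for x y
    using additive_subgroup.a_closed[OF ideal.axioms(1)[OF J]] that .
  have fl: "f x \<in> (\<lambda>x. [x]) ` carrier A" if "x \<in> J" for x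
    using f that by (auto simp: module_homs_def list_module_def self_module_def)
  have "\<exists>c\<in>carrier A. \<forall>x\<in>J. hd (f x) = x \<otimes>\<^bsub>A\<^esub> c"
  proof (rule si[unfolded self_injective_def, rule_format, OF J])
    show "hd (f x) \<in> carrier A" if "x \<in> J" for x using fl[OF that] by auto
    show "hd (f (x \<oplus>\<^bsub>A\<^esub> y)) = hd (f x) \<oplus>\<^bsub>A\<^esub> hd (f y)" if "x \<in> J" "y \<in> J" for x y
      using f that by (simp add: module_homs_def list_module_def self_module_def)
    show "hd (f (a \<otimes>\<^bsub>A\<^esub> x)) = a \<otimes>\<^bsub>A\<^esub> hd (f x)" if "a \<in> carrier A" "x \<in> J" for a x
      using f that by (simp add: module_homs_def list_module_def self_module_def)
  qed
  then obtain c where c: "c \<in> carrier A" "\<And>x. x \<in> J \<Longrightarrow> hd (f x) = x \<otimes>\<^bsub>A\<^esub> c" by blast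
  show "\<exists>g\<in>module_homs A (self_module A) (list_module A). \<forall>x\<in>J. g x = f x"
  proof (intro bexI[of _ "\<lambda>x. [x \<otimes>\<^bsub>A\<^esub> c]"] ballI)
    fix x assume x: "x \<in> J"
    then obtain y where "f x = [y]" using fl by blast
    then show "[x \<otimes>\<^bsub>A\<^esub> c] = f x" using c(2)[OF x] by simp
  qed (use c(1) in \<open>auto simp: module_homs_def list_module_def self_module_def l_distr m_assoc\<close>)
qed

text \<open>The resolution has length 0: a copy of A in degree 0, zero modules afterwards, and zero
  maps as differentials.\<close>

lemma self_injective_finite_injective_dimension:
  assumes "cring A" "self_injective A"
  shows "finite_self_injective_dimension A"
proof -
  define E where "E i = (if i = 0 then list_module A else trivial_module)" for i :: nat
  have E0: "E 0 = list_module A" and ES: "E (Suc i) = trivial_module" for i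
    by (simp_all add: E_def)
  have E_pos: "0 < i \<Longrightarrow> E i = trivial_module" for i by (simp add: E_def)
  have inj: "injective_module A (E i)" for i
    using list_module_injective[OF assms] trivial_module_injective[OF assms(1)] by (simp add: E_def)
  have ne: "carrier (E i) \<noteq> {}" for i
    using cring.cring_simprules(2)[OF assms(1)] by (auto simp: E_def list_module_def trivial_module_def)
  have eta: "(\<lambda>x. [x]) \<in> module_homs A (self_module A) (E 0)"
    by (auto simp: E0 module_homs_def self_module_def list_module_def)
  have delta: "(\<lambda>_. []) \<in> module_homs A (E i) (E (Suc i))" for i
    by (auto simp: ES module_homs_def trivial_module_def)
  have im: "(\<lambda>_. []) ` carrier (E i) = {x \<in> carrier (E (Suc i)). [] = \<zero>\<^bsub>E (Suc (Suc i))\<^esub>}" for i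
    using ne[of i] by (auto simp: ES trivial_module_def)
  show ?thesis
    unfolding finite_self_injective_dimension_def
    using inj eta delta im E_pos
    by (intro exI[of _ 0] exI[of _ E] exI[of _ "\<lambda>x. [x]"] exI[of _ "\<lambda>_ _. []"] conjI allI impI)
      (auto simp: E0 ES inj_on_def list_module_def E_def trivial_module_def)
qed

text \<open>An ideal of L and a homomorphism on it are pulled back along h, the multiplier is found
  in A, and its image under h works in L.\<close>

lemma self_injective_ring_iso:
  assumes A: "cring A" and L: "cring L" and h: "h \<in> ring_iso A L" and si: "self_injective A"
  shows "self_injective L"
  unfolding self_injective_def
proof (intro allI impI)
  interpret A: cring A by (rule A)
  interpret L: cring L by (rule L)
  fix J f assume J: "ideal J L" and fc: "\<forall>x\<in>J. f x \<in> carrier L"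
    and fa: "\<forall>x\<in>J. \<forall>y\<in>J. f (x \<oplus>\<^bsub>L\<^esub> y) = f x \<oplus>\<^bsub>L\<^esub> f y"
    and fm: "\<forall>a\<in>carrier L. \<forall>x\<in>J. f (a \<otimes>\<^bsub>L\<^esub> x) = a \<otimes>\<^bsub>L\<^esub> f x"
  note hE = ring_iso_memE[OF h]
  define k where "k = inv_into (carrier A) h"
  have bij: "bij_betw h (carrier A) (carrier L)" by (rule hE(5))
  have kc: "k y \<in> carrier A" and hk: "h (k y) = y" if "y \<in> carrier L" for y
    unfolding k_def using that bij by (auto simp: bij_betw_def inv_into_into f_inv_into_f)
  have kh: "k (h x) = x" if "x \<in> carrier A" for x
    unfolding k_def using that bij by (simp add: bij_betw_inv_into_left)
  have k_eq: "k y = x" if "x \<in> carrier A" "h x = y" for x y using kh that by blast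
  have hom: "ring_hom_ring A L h"
    by (rule ring_hom_ringI2) (use h in \<open>auto simp: ring_iso_def A.ring_axioms L.ring_axioms\<close>)
  define J' where "J' = {x \<in> carrier A. h x \<in> J}"
  have Jc: "x \<in> carrier L" if "x \<in> J" for x using ideal.Icarr[OF J that] .
  have J': "ideal J' A"
    unfolding J'_def by (rule ring_hom_ring.ideal_vimage[OF hom J])
  have "\<exists>c\<in>carrier A. \<forall>x\<in>J'. k (f (h x)) = x \<otimes>\<^bsub>A\<^esub> c"
  proof (rule si[unfolded self_injective_def, rule_format, OF J'])
    show "k (f (h x)) \<in> carrier A" if "x \<in> J'" for x using that fc kc by (auto simp: J'_def)
    show "k (f (h (x \<oplus>\<^bsub>A\<^esub> y))) = k (f (h x)) \<oplus>\<^bsub>A\<^esub> k (f (h y))" if "x \<in> J'" "y \<in> J'" for x y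
      using that fc fa kc hk hE by (intro k_eq) (auto simp: J'_def)
    show "k (f (h (a \<otimes>\<^bsub>A\<^esub> x))) = a \<otimes>\<^bsub>A\<^esub> k (f (h x))" if "a \<in> carrier A" "x \<in> J'" for a x
      using that fc fm kc hk hE by (intro k_eq) (auto simp: J'_def)
  qed
  then obtain c where c: "c \<in> carrier A" "\<And>x. x \<in> J' \<Longrightarrow> k (f (h x)) = x \<otimes>\<^bsub>A\<^esub> c" by blast
  show "\<exists>c\<in>carrier L. \<forall>x\<in>J. f x = x \<otimes>\<^bsub>L\<^esub> c"
  proof (intro bexI[of _ "h c"] ballI)
    fix x assume x: "x \<in> J"
    then have "k x \<in> J'" using Jc kc hk by (simp add: J'_def)
    then have "k (f x) = k x \<otimes>\<^bsub>A\<^esub> c" using c(2)[of "k x"] hk Jc x by simp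
    then have "h (k (f x)) = x \<otimes>\<^bsub>L\<^esub> h c" using hE(2)[of "k x" c] kc hk Jc x c(1) by simp
    then show "f x = x \<otimes>\<^bsub>L\<^esub> h c" using hk fc x by simp
  qed (use hE(1) c(1) in blast)
qed

section \<open>Localization at a prime ideal whose complement consists of units\<close>

context
  fixes A :: "('a, 'r) ring_scheme" (structure) and M :: "'a set"
  assumes A: "cring A" and M: "primeideal M A"
    and unit: "\<And>x. x \<in> carrier A - M \<Longrightarrow> x \<in> Units A"
begin

interpretation cring A by (rule A)

lemma non_members_mult: "s \<in> carrier A - M \<Longrightarrow> t \<in> carrier A - M \<Longrightarrow> s \<otimes> t \<in> carrier A - M"
  using primeideal.I_prime[OF M] by blast

lemma one_non_member: "\<one> \<in> carrier A - M"
proof -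
  interpret primeideal M A by (rule M)
  show ?thesis using one_imp_carrier I_notcarr by auto
qed

text \<open>The factor u in the definition of \<open>frac\<close> is a unit and cancels.\<close>

lemma frac_units:
  assumes "a \<in> carrier A" "s \<in> carrier A - M"
  shows "frac A M a s = {(b, t). b \<in> carrier A \<and> t \<in> carrier A - M \<and> t \<otimes> a = s \<otimes> b}"
  unfolding frac_def
proof (intro Collect_cong, clarify, intro conj_cong refl iffI)
  fix b t assume bt: "b \<in> carrier A" "t \<in> carrier A - M"
  {
    assume "\<exists>u\<in>carrier A - M. u \<otimes> (t \<otimes> a) = u \<otimes> (s \<otimes> b)"
    then obtain u where u: "u \<in> carrier A - M" "u \<otimes> (t \<otimes> a) = u \<otimes> (s \<otimes> b)" by blast
    then show "t \<otimes> a = s \<otimes> b" using unit[OF u(1)] assms bt by (metis DiffD1 Units_l_cancel m_closed)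
  next
    assume "t \<otimes> a = s \<otimes> b"
    then show "\<exists>u\<in>carrier A - M. u \<otimes> (t \<otimes> a) = u \<otimes> (s \<otimes> b)" using one_non_member by auto
  }
qed

lemma frac_cancel:
  assumes "a \<in> carrier A" "s \<in> carrier A - M"
  shows "frac A M (s \<otimes> a) s = frac A M a \<one>"
proof -
  have sa: "s \<otimes> a \<in> carrier A" using assms by auto
  have "t \<otimes> (s \<otimes> a) = s \<otimes> b \<longleftrightarrow> t \<otimes> a = \<one> \<otimes> b" if "b \<in> carrier A" "t \<in> carrier A - M" for b t
  proof -
    have "t \<otimes> (s \<otimes> a) = s \<otimes> (t \<otimes> a)" using assms that by (simp add: m_lcomm)
    then show ?thesis using unit[OF assms(2)] assms that by (auto simp: Units_l_cancel)
  qed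
  then show ?thesis
    unfolding frac_units[OF sa assms(2)] frac_units[OF assms(1) one_non_member] by blast
qed

lemma frac_mem: "a \<in> carrier A \<Longrightarrow> (a, \<one>) \<in> frac A M a \<one>"
  using one_non_member by (simp add: frac_units)

lemma frac_one_memD:
  assumes "a \<in> carrier A" "(b, t) \<in> frac A M a \<one>"
  shows "b = t \<otimes> a" "t \<in> carrier A - M"
  using assms one_non_member by (auto simp: frac_units)

text \<open>Every representative of a/1 has the form (s a, s) with s outside M. An operation with
  the same value on all such pairs has that value as its union, which turns the unions in
  \<open>localization\<close> into ordinary values.\<close>

lemma UN_frac:
  assumes "a \<in> carrier A" "b \<in> carrier A"
    and "\<And>s t. s \<in> carrier A - M \<Longrightarrow> t \<in> carrier A - M \<Longrightarrow> F (s \<otimes> a) s (t \<otimes> b) t = X"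
  shows "(\<Union>(a, s)\<in>frac A M a \<one>. \<Union>(b, t)\<in>frac A M b \<one>. F a s b t) = X"
proof -
  have 1: "F a' s b' t = X" if "(a', s) \<in> frac A M a \<one>" "(b', t) \<in> frac A M b \<one>" for a' s b' t
    using frac_one_memD[OF assms(1) that(1)] frac_one_memD[OF assms(2) that(2)] assms(3) by simp
  then show ?thesis using frac_mem[OF assms(1)] frac_mem[OF assms(2)] by fastforce
qed

text \<open>Every denominator is already invertible in A, so a/s is the image of the inverse of s
  times a, and localizing changes nothing.\<close>

lemma localization_iso: "(\<lambda>a. frac A M a \<one>) \<in> ring_iso A (localization A M)"
proof (rule ring_iso_memI)
  show "frac A M x \<one> \<in> carrier (localization A M)" if "x \<in> carrier A" for x
    using that one_non_member by (auto simp: localization_def)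
  show "frac A M (x \<otimes> y) \<one> = frac A M x \<one> \<otimes>\<^bsub>localization A M\<^esub> frac A M y \<one>"
    if xy: "x \<in> carrier A" "y \<in> carrier A" for x y
  proof -
    have "frac A M ((s \<otimes> x) \<otimes> (t \<otimes> y)) (s \<otimes> t) = frac A M (x \<otimes> y) \<one>"
      if st: "s \<in> carrier A - M" "t \<in> carrier A - M" for s t
    proof -
      have "(s \<otimes> x) \<otimes> (t \<otimes> y) = (s \<otimes> t) \<otimes> (x \<otimes> y)" using xy st by (simp add: m_ac)
      then show ?thesis using frac_cancel[of "x \<otimes> y" "s \<otimes> t"] non_members_mult[OF st] xy by simp
    qed
    from UN_frac[OF xy, of "\<lambda>a s b t. frac A M (a \<otimes> b) (s \<otimes> t)", OF this]
    show ?thesis by (simp add: localization_def)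
  qed
  show "frac A M (x \<oplus> y) \<one> = frac A M x \<one> \<oplus>\<^bsub>localization A M\<^esub> frac A M y \<one>"
    if xy: "x \<in> carrier A" "y \<in> carrier A" for x y
  proof -
    have "frac A M ((t \<otimes> (s \<otimes> x)) \<oplus> (s \<otimes> (t \<otimes> y))) (s \<otimes> t) = frac A M (x \<oplus> y) \<one>"
      if st: "s \<in> carrier A - M" "t \<in> carrier A - M" for s t
    proof -
      have "(t \<otimes> (s \<otimes> x)) \<oplus> (s \<otimes> (t \<otimes> y)) = (s \<otimes> t) \<otimes> (x \<oplus> y)"
        using xy st by (simp add: m_ac r_distr)
      then show ?thesis using frac_cancel[of "x \<oplus> y" "s \<otimes> t"] non_members_mult[OF st] xy by simp
    qed
    from UN_frac[OF xy, of "\<lambda>a s b t. frac A M ((t \<otimes> a) \<oplus> (s \<otimes> b)) (s \<otimes> t)", OF this]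
    show ?thesis by (simp add: localization_def)
  qed
  show "frac A M \<one> \<one> = \<one>\<^bsub>localization A M\<^esub>" by (simp add: localization_def)
  show "bij_betw (\<lambda>a. frac A M a \<one>) (carrier A) (carrier (localization A M))"
  proof (rule bij_betw_imageI)
    show "inj_on (\<lambda>a. frac A M a \<one>) (carrier A)"
    proof (rule inj_onI)
      fix x y assume xy: "x \<in> carrier A" "y \<in> carrier A" "frac A M x \<one> = frac A M y \<one>"
      then have "(x, \<one>) \<in> frac A M y \<one>" using frac_mem by metis
      from frac_one_memD(1)[OF xy(2) this] xy show "x = y" by simp
    qed
    have "frac A M a s \<in> (\<lambda>a. frac A M a \<one>) ` carrier A" if as: "a \<in> carrier A" "s \<in> carrier A - M" for a s
    proof -
      have u: "s \<in> Units A" by (rule unit[OF as(2)])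
      then have "a = s \<otimes> (inv s \<otimes> a)" using as by (metis DiffD1 Units_inv_closed Units_r_inv l_one m_assoc)
      then have "frac A M a s = frac A M (inv s \<otimes> a) \<one>"
        using frac_cancel[of "inv s \<otimes> a" s] as u by (metis DiffD1 Units_inv_closed m_closed)
      then show ?thesis using as u by blast
    qed
    then show "(\<lambda>a. frac A M a \<one>) ` carrier A = carrier (localization A M)"
      using one_non_member by (auto simp: localization_def)
  qed
qed

lemma localization_self_injective:
  assumes "self_injective A"
  shows "finite_self_injective_dimension (localization A M)"
proof -
  have "cring (localization A M)"
    using ring_iso_imp_img_cring[OF localization_iso] by (simp add: localization_def)
  then show ?thesis
    using self_injective_ring_iso[OF A _ localization_iso assms] self_injective_finite_injective_dimension
    by blast
qed

end

declare One_nat_def [simp del]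

subsection \<open>The Gorenstein property\<close>

lemma single_eq_0_iff [simp]: "Poly_Mapping.single k v = 0 \<longleftrightarrow> v = 0"
  by (metis lookup_single_eq lookup_zero single_zero)

text \<open>The values on a basis of P are extended linearly to the whole space; the extension
  agrees with g on P because the set of agreement is a subspace containing the basis.\<close>

lemma extend_functional:
  fixes P :: "'k::field mpoly set" and g :: "'k mpoly \<Rightarrow> 'k"
  assumes P: "mp.subspace P" and ga: "\<And>p q. p \<in> P \<Longrightarrow> q \<in> P \<Longrightarrow> g (p + q) = g p + g q"
    and gm: "\<And>c p. p \<in> P \<Longrightarrow> g (Const c * p) = c * g p"
  obtains G where "\<And>p q. G (p + q) = G p + G q" "\<And>c p. G (Const c * p) = c * G p"
    "\<And>p. p \<in> P \<Longrightarrow> G p = g p"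
proof -
  interpret pair: vector_space_pair "\<lambda>(c::'k) (p::'k mpoly). Const c * p" "(*) :: 'k \<Rightarrow> 'k \<Rightarrow> 'k"
    by unfold_locales (simp_all add: algebra_simps Const_mult)
  obtain B where B: "B \<subseteq> P" "mp.independent B" "P \<subseteq> mp.span B"
    using mp.maximal_independent_subset by metis
  obtain G where G: "Vector_Spaces.linear (\<lambda>(c::'k) p. Const c * p) (*) G" "\<And>x. x \<in> B \<Longrightarrow> G x = g x"
    using pair.linear_independent_extend[OF B(2), of g] by blast
  have Ga: "G (p + q) = G p + G q" for p q using pair.linear_add[OF G(1)] .
  have Gm: "G (Const c * p) = c * G p" for c p using pair.linear_scale[OF G(1)] .
  have g0: "g 0 = 0" using gm[OF mp.subspace_0[OF P], of 0] by simp
  have "mp.subspace {p \<in> P. G p = g p}"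
    by (rule mp.subspaceI)
      (use mp.subspace_0[OF P] mp.subspace_add[OF P] mp.subspace_scale[OF P] Gm[of 0 0] in
        \<open>auto simp: Ga Gm ga gm g0\<close>)
  then have "mp.span B \<subseteq> {p \<in> P. G p = g p}"
    by (intro mp.span_minimal) (use B G in auto)
  then show ?thesis using that Ga Gm B(3) by blast
qed

section \<open>The quotient by the ideal of a nondegenerate diagonal form\<close>

context
  fixes V :: "nat set" and D :: "nat \<Rightarrow> 'k::field" and k0 :: nat
  assumes V: "finite V" "k0 \<in> V" and Dnz: "\<And>k. k \<in> V \<Longrightarrow> D k \<noteq> 0"
begin

private abbreviation (input) "R \<equiv> mpoly_ring V :: 'k mpoly ring"
private abbreviation (input) "J \<equiv> diag_ideal V D"
private abbreviation (input) "\<phi> \<equiv> diag_form V D"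
private abbreviation (input) "\<pi> p \<equiv> J +>\<^bsub>R\<^esub> p"
private abbreviation (input) "cf \<equiv> Poly_Mapping.lookup"

lemma J_ideal: "ideal J R" by (rule diag_ideal_ideal)

lemma x2: "Var k0 * Var k0 \<in> carrier R" using V by simp

text \<open>The classes of 1, the variables and x_k0^2 span the quotient: a remainder q of order two
  is congruent to (\<phi> q / D k0) x_k0^2, since both have the same value under \<phi>.\<close>

lemma quot_decomposition:
  assumes p: "p \<in> carrier R"
  obtains b where "p - (Const (cf p 0) + lin_part V p + Const b * (Var k0 * Var k0)) \<in> J"
    "\<phi> (p - Const (cf p 0) - lin_part V p) = b * D k0"
    "ord_ge 2 (p - Const (cf p 0) - lin_part V p)"
proof -
  define q where "q = p - Const (cf p 0) - lin_part V p"
  define b where "b = \<phi> q / D k0"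
  have lc: "lin_part V p \<in> carrier R" unfolding lin_part_def by (intro sum_in_mpoly mult_in_mpoly) auto
  have q: "ord_ge 2 q" unfolding q_def by (rule ord_ge_2_remainder[OF V(1) p])
  have eq: "p - (Const (cf p 0) + lin_part V p + Const b * (Var k0 * Var k0)) = q - Const b * (Var k0 * Var k0)"
    by (simp add: q_def)
  have mem: "q - Const b * (Var k0 * Var k0) \<in> J"
    using p lc x2 V Dnz[OF V(2)] q
    by (simp add: diag_ideal_def diag_form_diff diag_form_Const_mult diag_form_Var_mult b_def
        ord_ge_diff ord_ge_mult_left q_def)
  have "\<phi> q = b * D k0" using Dnz[OF V(2)] by (simp add: b_def)
  then show ?thesis using mem q by (intro that[of b]) (simp_all only: eq, simp_all only: q_def)
qed

lemma diag_form_Const: "\<phi> (Const c) = 0"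
  by (simp add: diag_form_def lookup_Const)

lemma diag_form_linear: "\<phi> (\<Sum>j\<in>W. Const (c j) * Var j) = 0"
proof -
  have "Poly_Mapping.single k (2::nat) \<noteq> Poly_Mapping.single j 1" for k j :: nat
    by (metis tdeg_single one_eq_numeral_iff semiring_norm(85))
  then show ?thesis by (simp add: diag_form_def lookup_sum lookup_Var)
qed

lemma diag_form_Var: "\<phi> (Var i) = 0"
  using diag_form_linear[of "\<lambda>_. 1" "{i}"] by simp

lemma diag_form_cong: "p - q \<in> J \<Longrightarrow> \<phi> p = \<phi> q"
  using diag_form_diff[of V D p q] by (simp add: diag_ideal_def)

lemma diag_form_mult_Var':
  assumes p: "p \<in> carrier R" and i: "i \<in> V"
  shows "\<phi> (p * Var i) = D i * cf p (Poly_Mapping.single i 1)"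
proof -
  let ?p = "p - Const (cf p 0)"
  have "\<phi> (?p * Var i) = D i * cf ?p (Poly_Mapping.single i 1)"
    using p ord_ge_1_diff_Const by (intro diag_form_mult_Var V i) auto
  moreover have "\<phi> (p * Var i) = \<phi> (?p * Var i) + \<phi> (Const (cf p 0) * Var i)"
    by (simp only: diag_form_add[symmetric] distrib_right[symmetric]) simp
  ultimately show ?thesis by (simp add: lookup_minus lookup_Const diag_form_Const_mult diag_form_Var)
qed

text \<open>The pairing \<open>(p, q) \<mapsto> \<phi> (p q)\<close> induces a perfect pairing on the quotient by \<open>J\<close>.\<close>

lemma pairing_nondegenerate:
  assumes p: "p \<in> carrier R" and z: "\<And>a. a \<in> carrier R \<Longrightarrow> \<phi> (a * p) = 0"
  shows "p \<in> J"
proof -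
  \<comment> \<open>Pairing with x_k0^2 isolates the constant term, pairing with x_i the linear
    coefficients, and pairing with 1 the value of \<phi>.\<close>
  have 0: "cf p 0 = 0"
    using z[OF x2] diag_form_mult[OF ord_ge_Var_mult[of k0 k0], of V D p] V Dnz[OF V(2)]
    by (simp add: diag_form_Var_mult mult.commute)
  have 1: "cf p (Poly_Mapping.single i 1) = 0" if "i \<in> V" for i
    using z[of "Var i"] diag_form_mult_Var'[OF p that] Dnz[OF that] that by (simp add: mult.commute)
  have "lin_part V p = 0" unfolding lin_part_def by (rule sum.neutral) (simp add: 1)
  then have "ord_ge 2 p" using ord_ge_2_remainder[OF V(1) p] 0 by simp
  then show ?thesis using p z[of 1] by (simp add: diag_ideal_def)
qed

text \<open>The pairing reaches every functional on the quotient: c is assembled from the dual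
  vectors x_k0^2 / D k0, x_k / D k and 1 / D k0 of 1, x_k and x_k0^2, weighted with the values of
  G.\<close>

lemma functional_representable:
  assumes Ga: "\<And>p q. G (p + q) = G p + G q" and Gm: "\<And>c p. G (Const c * p) = c * G p"
    and GJ: "\<And>p. p \<in> J \<Longrightarrow> G p = (0::'k)"
  obtains c where "c \<in> carrier R" "\<And>p. p \<in> carrier R \<Longrightarrow> \<phi> (c * p) = G p"
proof -
  let ?y = "Var k0 * Var k0 :: 'k mpoly"
  have G0: "G 0 = 0" using Gm[of 0 0] by simp
  have Gs: "G (sum f A) = (\<Sum>a\<in>A. G (f a))" for f and A :: "nat set"
    by (induction A rule: infinite_finite_induct) (simp_all add: Ga G0)
  have Gd: "G p = G q" if "p - q \<in> J" for p q
    using Ga[of "p - q" q] GJ[OF that] by simp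
  define b where "b = G ?y / D k0"
  define l where "l = (\<Sum>k\<in>V. Const (G (Var k) / D k) * Var k)"
  define a where "a = G 1 / D k0"
  define c where "c = Const b + l + Const a * ?y"
  have cc: "c \<in> carrier R"
    unfolding c_def l_def using V by (intro add_in_mpoly sum_in_mpoly mult_in_mpoly) auto
  have l1: "ord_ge 1 l" unfolding l_def by (rule ord_ge_linear)
  have y2: "ord_ge 2 (Const a * ?y)" by (intro ord_ge_mult_left ord_ge_Var_mult)
  have c0: "cf c 0 = b"
    using lookup_ord_ge[OF l1, of 0] lookup_ord_ge[OF y2, of 0] by (simp add: c_def lookup_add lookup_Const)
  have c1: "cf c (Poly_Mapping.single k 1) = G (Var k) / D k" if "k \<in> V" for k
  proof -
    show ?thesis
      using lookup_ord_ge[OF y2, of "Poly_Mapping.single k 1"] V that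
      by (simp add: c_def lookup_add lookup_Const l_def lookup_linear)
  qed
  have \<phi>c: "\<phi> c = G 1"
    using V Dnz[OF V(2)]
    by (simp add: c_def l_def diag_form_add diag_form_Const diag_form_linear diag_form_Const_mult diag_form_Var_mult a_def)
  have "\<phi> (c * p) = G p" if p: "p \<in> carrier R" for p
  proof -
    obtain e where e: "p - (Const (cf p 0) + lin_part V p + Const e * ?y) \<in> J"
      "\<phi> (p - Const (cf p 0) - lin_part V p) = e * D k0"
      "ord_ge 2 (p - Const (cf p 0) - lin_part V p)"
      using quot_decomposition[OF p] by blast
    define q where "q = p - Const (cf p 0) - lin_part V p"
    have "c * p = Const (cf p 0) * c + (\<Sum>k\<in>V. Const (cf p (Poly_Mapping.single k 1)) * (c * Var k)) + c * q"
    proof -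
      have "c * p = Const (cf p 0) * c + c * lin_part V p + c * q" by (simp add: q_def algebra_simps)
      moreover have "c * lin_part V p = (\<Sum>k\<in>V. Const (cf p (Poly_Mapping.single k 1)) * (c * Var k))"
        unfolding lin_part_def sum_distrib_left by (intro sum.cong refl) (simp add: mult.left_commute)
      ultimately show ?thesis by simp
    qed
    then have "\<phi> (c * p) = cf p 0 * G 1 + (\<Sum>k\<in>V. cf p (Poly_Mapping.single k 1) * \<phi> (c * Var k)) + \<phi> (c * q)"
      by (simp only: diag_form_add diag_form_sum diag_form_Const_mult \<phi>c)
    also have "(\<Sum>k\<in>V. cf p (Poly_Mapping.single k 1) * \<phi> (c * Var k)) =
      (\<Sum>k\<in>V. cf p (Poly_Mapping.single k 1) * G (Var k))"
      by (intro sum.cong refl) (simp add: diag_form_mult_Var'[OF cc] c1 Dnz)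
    also have "\<phi> (c * q) = e * G ?y"
      using diag_form_mult[of q V D c] e(2,3) Dnz[OF V(2)] by (simp add: q_def c0 b_def)
    also have "cf p 0 * G 1 + (\<Sum>k\<in>V. cf p (Poly_Mapping.single k 1) * G (Var k)) + e * G ?y
      = G (Const (cf p 0) * 1 + lin_part V p + Const e * ?y)"
      by (simp only: Ga Gm lin_part_def Gs)
    also have "\<dots> = G p" using Gd[OF e(1)] by simp
    finally show ?thesis .
  qed
  with cc show ?thesis by (rule that)
qed

lemma preimage_subspace:
  assumes A: "ideal A (R Quot J)"
  shows "mp.subspace {p \<in> carrier R. \<pi> p \<in> A}"
proof (rule mp.subspaceI)
  have "\<pi> 0 \<in> A"
    using additive_subgroup.zero_closed[OF ideal.axioms(1)[OF A]] quot_mpoly_zero[OF J_ideal] by simp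
  then show "0 \<in> {p \<in> carrier R. \<pi> p \<in> A}" by simp
  show "p + q \<in> {p \<in> carrier R. \<pi> p \<in> A}"
    if "p \<in> {p \<in> carrier R. \<pi> p \<in> A}" "q \<in> {p \<in> carrier R. \<pi> p \<in> A}" for p q
    using that additive_subgroup.a_closed[OF ideal.axioms(1)[OF A], of "\<pi> p" "\<pi> q"]
    by (simp add: quot_mpoly_add[OF J_ideal])
  show "Const c * p \<in> {p \<in> carrier R. \<pi> p \<in> A}" if "p \<in> {p \<in> carrier R. \<pi> p \<in> A}" for c p
    using that ideal.I_l_closed[OF A, of "\<pi> p" "\<pi> (Const c)"] quot_mpoly_closed[OF J_ideal, of "Const c"]
    by (simp add: quot_mpoly_mult[OF J_ideal])
qed

text \<open>Composing f with \<phi> turns a homomorphism into a linear functional on the preimage of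
  A. The functional extends, the extension is the pairing with some c, and nondegeneracy recovers f
  as multiplication by c.\<close>

lemma quot_self_injective: "self_injective (R Quot J)"
  unfolding self_injective_def
proof (intro allI impI)
  fix A f assume A: "ideal A (R Quot J)" and fc: "\<forall>x\<in>A. f x \<in> carrier (R Quot J)"
    and fa: "\<forall>x\<in>A. \<forall>y\<in>A. f (x \<oplus>\<^bsub>R Quot J\<^esub> y) = f x \<oplus>\<^bsub>R Quot J\<^esub> f y"
    and fm: "\<forall>a\<in>carrier (R Quot J). \<forall>x\<in>A. f (a \<otimes>\<^bsub>R Quot J\<^esub> x) = a \<otimes>\<^bsub>R Quot J\<^esub> f x"
  note qm = quot_mpoly_mult[OF J_ideal] and qa = quot_mpoly_add[OF J_ideal] and qc = quot_mpoly_closed[OF J_ideal]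
  define P where "P = {p \<in> carrier R. \<pi> p \<in> A}"
  have P: "mp.subspace P" unfolding P_def by (rule preimage_subspace[OF A])
  have Pc: "p \<in> carrier R" and PA: "\<pi> p \<in> A" if "p \<in> P" for p using that by (simp_all add: P_def)
  have Pm: "a * p \<in> P" if "a \<in> carrier R" "p \<in> P" for a p
    using that ideal.I_l_closed[OF A PA qc, of p a] by (simp add: P_def qm)
  have "\<forall>x\<in>A. \<exists>p\<in>carrier R. \<pi> p = f x" using fc unfolding quot_mpoly_carrier[OF J_ideal] by fastforce
  then obtain lift where lift: "\<And>x. x \<in> A \<Longrightarrow> lift x \<in> carrier R" "\<And>x. x \<in> A \<Longrightarrow> \<pi> (lift x) = f x"
    by metis
  \<comment> \<open>\<open>F\<close> is additive and linear only modulo J, but it depends on the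
    coset of p alone; hence \<open>F p = F 0\<close> for p in J, and the functional vanishes on
    J.\<close>
  define F where "F p = lift (\<pi> p)" for p
  have F: "F p \<in> carrier R" "\<pi> (F p) = f (\<pi> p)" if "p \<in> P" for p
    using lift[OF PA[OF that]] by (simp_all add: F_def)
  have Fa: "F (p + q) - (F p + F q) \<in> J" if "p \<in> P" "q \<in> P" for p q
  proof -
    have pq: "p + q \<in> P" using mp.subspace_add[OF P that] .
    have "\<pi> (F (p + q)) = f (\<pi> p \<oplus>\<^bsub>R Quot J\<^esub> \<pi> q)" using F(2)[OF pq] that Pc by (simp add: qa)
    also have "\<dots> = \<pi> (F p) \<oplus>\<^bsub>R Quot J\<^esub> \<pi> (F q)" using fa PA F(2) that by simp
    also have "\<dots> = \<pi> (F p + F q)" using F(1) that by (simp add: qa)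
    finally show ?thesis using rcos_mpoly_eq_iff[OF J_ideal] F(1) pq that by simp
  qed
  have Fm: "F (a * p) - a * F p \<in> J" if "a \<in> carrier R" "p \<in> P" for a p
  proof -
    have ap: "a * p \<in> P" using Pm[OF that] .
    have "\<pi> (F (a * p)) = f (\<pi> a \<otimes>\<^bsub>R Quot J\<^esub> \<pi> p)" using F(2)[OF ap] that Pc by (simp add: qm)
    also have "\<dots> = \<pi> a \<otimes>\<^bsub>R Quot J\<^esub> \<pi> (F p)" using fm PA F(2) that qc by simp
    also have "\<dots> = \<pi> (a * F p)" using F(1) that by (simp add: qm)
    finally show ?thesis using rcos_mpoly_eq_iff[OF J_ideal] F(1) ap that by simp
  qed
  define g where "g p = \<phi> (F p)" for p
  obtain G where G: "\<And>p q. G (p + q) = G p + G q" "\<And>c p. G (Const c * p) = c * G p" "\<And>p. p \<in> P \<Longrightarrow> G p = g p"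
  proof (rule extend_functional[OF P, of g])
    show "g (p + q) = g p + g q" if "p \<in> P" "q \<in> P" for p q
      using diag_form_cong[OF Fa[OF that]] by (simp add: g_def diag_form_add)
    show "g (Const c * p) = c * g p" if "p \<in> P" for c p
      using diag_form_cong[OF Fm[OF Const_in_mpoly that]] by (simp add: g_def diag_form_Const_mult)
  qed blast
  have "G p = 0" if "p \<in> J" for p
  proof -
    have p: "p \<in> carrier R" using ideal_mpoly_subset[OF J_ideal that] .
    have "\<pi> p = \<pi> 0" using coset_eq_zero_iff[OF J_ideal p] that quot_mpoly_zero[OF J_ideal] by simp
    moreover have "0 \<in> P" using mp.subspace_0[OF P] .
    ultimately have "p \<in> P" "F p = F 0" using p by (simp_all add: P_def F_def)
    then have "G p = G 0" using G(3) \<open>0 \<in> P\<close> by (simp add: g_def)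
    also have "G 0 = 0" using G(2)[of 0 0] by simp
    finally show ?thesis .
  qed
  then obtain c where c: "c \<in> carrier R" "\<And>p. p \<in> carrier R \<Longrightarrow> \<phi> (c * p) = G p"
    using functional_representable[of G] G(1,2) by blast
  show "\<exists>c\<in>carrier (R Quot J). \<forall>x\<in>A. f x = x \<otimes>\<^bsub>R Quot J\<^esub> c"
  proof (intro bexI[of _ "\<pi> c"] ballI qc c(1))
    fix x assume x: "x \<in> A"
    then obtain p where p: "p \<in> P" "x = \<pi> p"
      using ideal.Icarr[OF A x] unfolding quot_mpoly_carrier[OF J_ideal] P_def by blast
    \<comment> \<open>For every a both \<phi> (a F p) and \<phi> (a p c) equal G (a p), so the
      difference pairs to zero with the whole ring.\<close>
    have "F p - p * c \<in> J"
    proof (rule pairing_nondegenerate)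
      show "F p - p * c \<in> carrier R" using F(1) p(1) Pc c(1) by simp
      fix a :: "'k mpoly" assume a: "a \<in> carrier R"
      have "\<phi> (a * F p) = G (a * p)"
        using diag_form_cong[OF Fm[OF a p(1)]] G(3)[OF Pm[OF a p(1)]] by (simp add: g_def)
      also have "\<dots> = \<phi> (c * (a * p))" using c(2)[of "a * p"] a Pc[OF p(1)] by simp
      finally have "\<phi> (a * F p) - \<phi> (c * (a * p)) = 0" by simp
      then show "\<phi> (a * (F p - p * c)) = 0"
        by (simp add: diag_form_diff right_diff_distrib mult_ac)
    qed
    then have "\<pi> (F p) = \<pi> (p * c)" using rcos_mpoly_eq_iff[OF J_ideal, of "F p" "p * c"] F(1) p(1) Pc c(1) by simp
    then show "f x = x \<otimes>\<^bsub>R Quot J\<^esub> \<pi> c" using F(2)[OF p(1)] p(2) Pc[OF p(1)] c(1) by (simp add: qm)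
  qed
qed

text \<open>The quotient is spanned over the constants by the classes of a finite set F. The
  representatives of an ideal within the span of F have a finite basis, whose classes generate the
  ideal.\<close>

lemma quot_noetherian: "noetherian_ring (R Quot J)"
proof (rule ring.noetherian_ringI[OF ideal.quotient_is_ring[OF J_ideal]])
  fix A assume A: "ideal A (R Quot J)"
  interpret Q: ring "R Quot J" by (rule ideal.quotient_is_ring[OF J_ideal])
  note qm = quot_mpoly_mult[OF J_ideal] and qa = quot_mpoly_add[OF J_ideal] and qc = quot_mpoly_closed[OF J_ideal]
  define P where "P = {p \<in> carrier R. \<pi> p \<in> A}"
  define F :: "'k mpoly set" where "F = insert 1 (insert (Var k0 * Var k0) (Var ` V))"
  have finF: "finite F" using V by (simp add: F_def)
  obtain B where B: "B \<subseteq> P \<inter> mp.span F" "mp.independent B" "P \<inter> mp.span F \<subseteq> mp.span B"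
    using mp.maximal_independent_subset by metis
  have finB: "finite B" using mp.independent_span_bound[OF finF B(2)] B(1) by blast
  have Bc: "\<pi> ` B \<subseteq> carrier (R Quot J)" and BA: "\<pi> ` B \<subseteq> A"
    using B(1) qc by (auto simp: P_def)
  define I where "I = Idl\<^bsub>R Quot J\<^esub> (\<pi> ` B)"
  have I: "ideal I (R Quot J)" unfolding I_def by (rule Q.genideal_ideal[OF Bc])
  have "mp.span B \<subseteq> {p \<in> carrier R. \<pi> p \<in> I}"
  proof (rule mp.span_minimal[OF _ preimage_subspace[OF I]])
    show "B \<subseteq> {p \<in> carrier R. \<pi> p \<in> I}"
      using B(1) Q.genideal_self[OF Bc] by (auto simp: P_def I_def)
  qed
  then have PF: "\<pi> p \<in> I" if "p \<in> P" "p \<in> mp.span F" for p using B(3) that by blast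
  have "A = I"
  proof (rule antisym)
    show "I \<subseteq> A" unfolding I_def by (rule Q.genideal_minimal[OF A BA])
    show "A \<subseteq> I"
    proof
      fix x assume x: "x \<in> A"
      then obtain p where p: "p \<in> carrier R" "x = \<pi> p"
        using ideal.Icarr[OF A x] unfolding quot_mpoly_carrier[OF J_ideal] by blast
      obtain b where b: "p - (Const (cf p 0) + lin_part V p + Const b * (Var k0 * Var k0)) \<in> J"
        using quot_decomposition[OF p(1)] by blast
      let ?q = "Const (cf p 0) * 1 + lin_part V p + Const b * (Var k0 * Var k0)"
      have q: "?q \<in> carrier R" unfolding lin_part_def using V
        by (intro add_in_mpoly sum_in_mpoly mult_in_mpoly) auto
      have eq: "\<pi> p = \<pi> ?q" using rcos_mpoly_eq_iff[OF J_ideal p(1) q] b by simp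
      have "?q \<in> mp.span F"
        unfolding lin_part_def by (intro mp.span_add mp.span_sum mp.span_scale mp.span_base) (auto simp: F_def)
      moreover have "?q \<in> P" using q x eq p(2) by (simp add: P_def)
      ultimately show "x \<in> I" using PF eq p(2) by simp
    qed
  qed
  then show "\<exists>S\<subseteq>carrier (R Quot J). finite S \<and> A = Idl\<^bsub>R Quot J\<^esub> S"
    using Bc finB unfolding I_def by blast
qed

text \<open>Here p is a nonzero constant c plus n with n^3 in J, and (c + n)(c^2 - c n + n^2) = c^3
  + n^3 provides the inverse.\<close>

lemma quot_unit:
  assumes p: "p \<in> carrier R" "cf p 0 \<noteq> 0"
  shows "\<pi> p \<in> Units (R Quot J)"
proof -
  interpret Q: cring "R Quot J" by (rule quot_mpoly_cring[OF J_ideal])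
  define c n where "c = cf p 0" and "n = p - Const c"
  have n: "ord_ge 1 n" "n \<in> carrier R"
    using ord_ge_1_diff_Const[of p] p by (simp_all add: n_def c_def)
  have "ord_ge (1 + (1 + 1)) (n * (n * n))" by (intro ord_ge_mult n)
  then have n3: "n * (n * n) \<in> J"
    using n by (simp add: diag_ideal_def diag_form_ord_ge_3 ord_ge_mono[of 3 _ 2])
  define q where "q = Const (inverse (c ^ 3)) * (Const c * Const c - Const c * n + n * n)"
  have q: "q \<in> carrier R" unfolding q_def
    by (intro mult_in_mpoly add_in_mpoly diff_in_mpoly n Const_in_mpoly)
  have "(Const c + n) * (Const c * Const c - Const c * n + n * n) = Const (c ^ 3) + n * (n * n)"
  proof -
    have "(x + n) * (x * x - x * n + n * n) = x * x * x + n * (n * n)" for x :: "'k mpoly"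
      by (simp add: algebra_simps)
    then show ?thesis by (simp add: power3_eq_cube Const_mult)
  qed
  then have "p * q = Const (inverse (c ^ 3)) * (Const (c ^ 3) + n * (n * n))"
    unfolding q_def n_def by (simp add: mult.left_commute)
  also have "\<dots> = 1 + Const (inverse (c ^ 3)) * (n * (n * n))"
    using p(2) by (simp add: distrib_left c_def flip: Const_mult)
  finally have "p * q - 1 \<in> J" using n3 by (simp add: ideal_mpoly_mult[OF J_ideal])
  then have "\<pi> (p * q) = \<pi> 1" using rcos_mpoly_eq_iff[OF J_ideal] p q by simp
  then have "\<pi> p \<otimes>\<^bsub>R Quot J\<^esub> \<pi> q = \<one>\<^bsub>R Quot J\<^esub>"
    using p q by (simp add: quot_mpoly_mult[OF J_ideal] quot_mpoly_one[OF J_ideal])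
  then show ?thesis
    using quot_mpoly_closed[OF J_ideal p(1)] quot_mpoly_closed[OF J_ideal q] Q.m_comm[of "\<pi> q" "\<pi> p"]
    unfolding Units_def by (intro CollectI conjI bexI[of _ "\<pi> q"]) simp_all
qed

text \<open>An element without constant term has cube zero and so lies in every prime; the
  complement of a maximal ideal therefore consists of units, and
  \<open>localization_self_injective\<close> applies.\<close>

lemma gorenstein_diag_ideal: "gorenstein_ideal V J"
  unfolding gorenstein_ideal_def gorenstein_ring_def
proof (intro conjI allI impI J_ideal quot_mpoly_cring quot_noetherian)
  interpret Q: cring "R Quot J" by (rule quot_mpoly_cring[OF J_ideal])
  fix M assume "maximalideal M (R Quot J)"
  then have M: "primeideal M (R Quot J)" by (rule Q.maximalideal_prime)
  show "finite_self_injective_dimension (localization (R Quot J) M)"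
  proof (rule localization_self_injective[OF Q.is_cring M _ quot_self_injective])
    fix x assume x: "x \<in> carrier (R Quot J) - M"
    then obtain p where p: "p \<in> carrier R" "x = \<pi> p" unfolding quot_mpoly_carrier[OF J_ideal] by blast
    have "cf p 0 \<noteq> 0"
    proof
      assume "cf p 0 = 0"
      then have o: "ord_ge 1 p" using ord_ge_1_diff_Const[of p] by simp
      have "ord_ge (1 + (1 + 1)) (p * (p * p))" by (intro ord_ge_mult o)
      then have "p * (p * p) \<in> J"
        using p by (simp add: diag_ideal_def diag_form_ord_ge_3 ord_ge_mono[of 3 _ 2])
      then have "x \<otimes>\<^bsub>R Quot J\<^esub> (x \<otimes>\<^bsub>R Quot J\<^esub> x) = \<zero>\<^bsub>R Quot J\<^esub>"
        using p coset_eq_zero_iff[OF J_ideal, of "p * (p * p)"] by (simp add: quot_mpoly_mult[OF J_ideal])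
      also have "\<dots> \<in> M"
        using additive_subgroup.zero_closed[OF ideal.axioms(1)[OF primeideal.axioms(1)[OF M]]] .
      finally show False using primeideal.I_prime[OF M] x by (metis DiffD1 DiffD2 Q.m_closed)
    qed
    then show "x \<in> Units (R Quot J)" unfolding p(2) by (rule quot_unit[OF p(1)])
  qed
qed

end

declare mp.scale_scale [simp del] \<comment> \<open>the reverse of \<open>Const_mult\<close>\<close>

subsection \<open>Homogeneous polynomials\<close>

lemma homogeneous_iff: "homogeneous n p \<longleftrightarrow> (\<forall>t\<in>Poly_Mapping.keys p. tdeg t = n)"
  by (simp add: homogeneous_def tdeg_def)

lemma homogeneous_ord_ge: "homogeneous n p \<Longrightarrow> ord_ge n p"
  by (simp add: homogeneous_iff ord_ge_def)

lemma homogeneous_0 [simp]: "homogeneous n 0"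
  by (simp add: homogeneous_iff)

lemma homogeneous_add: "homogeneous n p \<Longrightarrow> homogeneous n q \<Longrightarrow> homogeneous n (p + q)"
  using Poly_Mapping.keys_add[of p q] by (auto simp: homogeneous_iff)

lemma homogeneous_mult:
  assumes "homogeneous m p" "homogeneous n q"
  shows "homogeneous (m + n) (p * q)"
  unfolding homogeneous_iff
proof
  fix t assume "t \<in> Poly_Mapping.keys (p * q)"
  then obtain a b where "a \<in> Poly_Mapping.keys p" "b \<in> Poly_Mapping.keys q" "t = a + b"
    using keys_mult[of p q] by auto
  then show "tdeg t = m + n" using assms by (simp add: homogeneous_iff tdeg_add)
qed

lemma homogeneous_Const: "homogeneous 0 (Const c)"
  by (simp add: homogeneous_iff Const_def)

lemma homogeneous_Const_mult: "homogeneous n p \<Longrightarrow> homogeneous n (Const c * p)"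
  using homogeneous_mult[OF homogeneous_Const] by force

lemma homogeneous_Var: "homogeneous 1 (Var i)"
  by (simp add: homogeneous_iff Var_def)

lemma quadric_Var_mult: "quadric (Var i * Var j)"
  using homogeneous_mult[OF homogeneous_Var homogeneous_Var, of i j] by simp

lemma homogeneous_sum: "(\<And>i. i \<in> A \<Longrightarrow> homogeneous n (f i)) \<Longrightarrow> homogeneous n (sum f A)"
  by (induction A rule: infinite_finite_induct) (simp_all add: homogeneous_add)

lemma homogeneous_monom_eval:
  assumes "\<And>i. homogeneous 1 (f i)"
  shows "homogeneous (tdeg t) (monom_eval f t)"
proof (induction "tdeg t" arbitrary: t)
  case 0
  then have "t = 0" by simp
  then show ?case using homogeneous_Const[of 1] by simp
next
  case (Suc n)
  then obtain i s where s: "t = Poly_Mapping.single i 1 + s" "tdeg t = Suc (tdeg s)"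
    by (metis exp_Suc_cases zero_less_Suc)
  then have "homogeneous (tdeg s) (monom_eval f s)" using Suc by simp
  then have "homogeneous (1 + tdeg s) (f i * monom_eval f s)" by (rule homogeneous_mult[OF assms])
  then show ?case using s(2) by (simp add: s(1) monom_eval_single_add tdeg_add)
qed

lemma homogeneous_subst_poly:
  assumes "\<And>i. homogeneous 1 (f i)" "homogeneous n p"
  shows "homogeneous n (subst_poly f p)"
  unfolding subst_poly_def
proof (intro homogeneous_sum homogeneous_Const_mult)
  fix t assume "t \<in> Poly_Mapping.keys p"
  then show "homogeneous n (monom_eval f t)"
    using homogeneous_monom_eval[of f t] assms by (simp add: homogeneous_iff)
qed

lemma homogeneous_linear_subst: "homogeneous n p \<Longrightarrow> homogeneous n (linear_subst d A p)"
  unfolding linear_subst_eq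
  by (intro homogeneous_subst_poly homogeneous_sum homogeneous_Const_mult homogeneous_Var)

text \<open>Quadrics are linear combinations of products of two variables; a statement stable under
  linear combinations is reduced to these products.\<close>

lemma quadric_induct [consumes 2, case_names add smult Var_mult]:
  assumes q: "quadric q" "q \<in> carrier (mpoly_ring V)"
    and add: "\<And>p q. P p \<Longrightarrow> P q \<Longrightarrow> P (p + q)"
    and smult: "\<And>c p. P p \<Longrightarrow> P (Const c * p)"
    and Var: "\<And>i j. i \<in> V \<Longrightarrow> j \<in> V \<Longrightarrow> P (Var i * Var j)"
    and 0: "P 0"
  shows "P q"
proof -
  have "P (monom_eval Var t)" if t: "t \<in> Poly_Mapping.keys q" for t
  proof -
    have t2: "tdeg t = 2" "Poly_Mapping.keys t \<subseteq> V" using q t by (auto simp: homogeneous_iff carrier_mpoly_ring)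
    have "2 \<le> tdeg t" using t2(1) by simp
    from this t2(2) obtain i j u where u: "i \<in> V" "j \<in> V" "Poly_Mapping.keys u \<subseteq> V"
      "tdeg t = Suc (Suc (tdeg u))" "monom_eval Var t = Var i * Var j * (monom_eval Var u :: 'a mpoly)"
      by (rule monomial_split)
    then have "tdeg u = 0" using t2(1) by simp
    then show ?thesis using u(5) Var[OF u(1,2)] by simp
  qed
  moreover have "P (\<Sum>t\<in>A. Const (Poly_Mapping.lookup q t) * monom_eval Var t)"
    if "finite A" "\<And>t. t \<in> A \<Longrightarrow> P (monom_eval Var t)" for A
    using that by (induction A rule: finite_induct) (simp_all add: 0 add smult)
  ultimately show ?thesis using mpoly_expansion[of q] finite_keys by metis
qed

subsection \<open>The quadrics of the ideal form a hyperplane\<close>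

text \<open>The homogeneous component of degree two.\<close>

definition hpart2 :: "'k::field mpoly \<Rightarrow> 'k mpoly" where
  "hpart2 p = (\<Sum>t\<in>{t \<in> Poly_Mapping.keys p. tdeg t = 2}. Poly_Mapping.single t (Poly_Mapping.lookup p t))"

lemma lookup_hpart2:
  "Poly_Mapping.lookup (hpart2 p) t = (if tdeg t = 2 then Poly_Mapping.lookup p t else 0)"
proof -
  have "Poly_Mapping.lookup (hpart2 p) t =
    (\<Sum>s\<in>{s \<in> Poly_Mapping.keys p. tdeg s = 2}. if s = t then Poly_Mapping.lookup p t else 0)"
    unfolding hpart2_def lookup_sum by (intro sum.cong) (auto simp: lookup_single when_def)
  then show ?thesis by (auto simp: in_keys_iff)
qed

lemma hpart2_add: "hpart2 (p + q) = hpart2 p + hpart2 q"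
  by (rule poly_mapping_eqI) (simp add: lookup_hpart2 lookup_add)

lemma hpart2_mult: "ord_ge 2 p \<Longrightarrow> hpart2 (a * p) = Const (Poly_Mapping.lookup a 0) * hpart2 p"
  by (rule poly_mapping_eqI) (simp add: lookup_hpart2 lookup_mult_ord_ge)

lemma hpart2_0 [simp]: "hpart2 0 = 0"
  by (rule poly_mapping_eqI) (simp add: lookup_hpart2)

lemma hpart2_quadric: "quadric p \<Longrightarrow> hpart2 p = p"
  by (rule poly_mapping_eqI) (auto simp: lookup_hpart2 homogeneous_iff in_keys_iff)

lemma span_subset_ideal:
  assumes "ideal I (mpoly_ring V)" "S \<subseteq> I"
  shows "mp.span S \<subseteq> I"
  using assms by (intro mp.span_minimal mp.subspaceI)
    (auto intro: ideal_mpoly_zero ideal_mpoly_add ideal_mpoly_mult)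

lemma max_ideal_square_minimal:
  assumes I: "ideal I (poly_ring d)"
    and q: "\<And>q. q \<in> carrier (poly_ring d) \<Longrightarrow> quadric q \<Longrightarrow> q \<in> I"
  shows "max_ideal d \<cdot>\<^bsub>poly_ring d\<^esub> max_ideal d \<subseteq> I"
  unfolding max_ideal_prod_eq(1)
proof (rule genideal_mpoly_minimal[OF I])
  show "{Var i * Var j | i j. i \<in> {1..d} \<and> j \<in> {1..d}} \<subseteq> I"
    by (auto intro!: q quadric_Var_mult)
qed

text \<open>A generator in the linear span of the others would be redundant, so minimal generation
  makes S independent over the constants.\<close>

lemma almost_square_quadric_idealE:
  fixes I :: "'k::field mpoly set"
  assumes "almost_square_quadric_ideal d I"
  obtains S where "S \<subseteq> carrier (poly_ring d)" "I = genideal (poly_ring d) S" "finite S"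
    "\<And>q. q \<in> S \<Longrightarrow> quadric q" "mp.independent S"
    "card S + 1 = nu (poly_ring d) (max_ideal d \<cdot>\<^bsub>poly_ring d\<^esub> (max_ideal d :: 'k mpoly set))"
proof -
  obtain S where S: "minimally_generates (poly_ring d) S I" "finite S" "\<And>q. q \<in> S \<Longrightarrow> quadric q"
    "card S + 1 = nu (poly_ring d) (max_ideal d \<cdot>\<^bsub>poly_ring d\<^esub> (max_ideal d :: 'k mpoly set))"
    using assms unfolding almost_square_quadric_ideal_def by blast
  have Sc: "S \<subseteq> carrier (poly_ring d)" and gen: "genideal (poly_ring d) S = I"
    and min: "\<And>T. T \<subset> S \<Longrightarrow> genideal (poly_ring d) T \<noteq> I"
    using S(1) by (auto simp: minimally_generates_def)
  have "mp.independent S"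
    unfolding mp.dependent_def
  proof
    assume "\<exists>a\<in>S. a \<in> mp.span (S - {a})"
    then obtain a where a: "a \<in> S" "a \<in> mp.span (S - {a})" by blast
    let ?T = "S - {a}"
    have Tc: "?T \<subseteq> carrier (poly_ring d)" using Sc by blast
    have T: "ideal (genideal (poly_ring d) ?T) (poly_ring d)" by (rule genideal_mpoly_ideal[OF Tc])
    have sub: "?T \<subseteq> genideal (poly_ring d) ?T" using genideal_mpoly_self[OF Tc] by blast
    have "a \<in> genideal (poly_ring d) ?T" using span_subset_ideal[OF T sub] a(2) by blast
    then have "genideal (poly_ring d) S \<subseteq> genideal (poly_ring d) ?T"
      using sub by (intro genideal_mpoly_minimal[OF T]) blast
    moreover have "genideal (poly_ring d) ?T \<subseteq> genideal (poly_ring d) S"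
      by (rule genideal_mpoly_mono[OF Sc]) blast
    ultimately show False using min[of ?T] a(1) gen by blast
  qed
  then show ?thesis using that[OF Sc gen[symmetric] S(2,3)] S(4) by blast
qed

text \<open>If I contained all quadrics, it would be the square of the maximal ideal, yet generated
  by fewer than \<open>nu\<close> elements.\<close>

lemma almost_square_quadric_ideal_missing:
  fixes I :: "'k::field mpoly set"
  assumes "almost_square_quadric_ideal d I"
  shows "\<exists>q\<in>carrier (poly_ring d). quadric q \<and> q \<notin> I"
proof (rule ccontr)
  assume no: "\<not> ?thesis"
  obtain S where S: "S \<subseteq> carrier (poly_ring d)" "I = genideal (poly_ring d) S" "finite S"
    "\<And>q. q \<in> S \<Longrightarrow> quadric q"
    "card S + 1 = nu (poly_ring d) (max_ideal d \<cdot>\<^bsub>poly_ring d\<^esub> (max_ideal d :: 'k mpoly set))"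
    using almost_square_quadric_idealE[OF assms] by metis
  have I: "ideal I (poly_ring d)" unfolding S(2) by (rule genideal_mpoly_ideal[OF S(1)])
  let ?M = "max_ideal d \<cdot>\<^bsub>poly_ring d\<^esub> (max_ideal d :: 'k mpoly set)"
  have "ideal (max_ideal d :: 'k mpoly set) (poly_ring d)"
    unfolding max_ideal_def by (rule genideal_mpoly_ideal) auto
  then have M: "ideal ?M (poly_ring d)"
    using ring.ideal_prod_is_ideal[OF mpoly_ring_ring] by blast
  have "?M \<subseteq> I" using no by (intro max_ideal_square_minimal[OF I]) blast
  moreover have "I \<subseteq> ?M"
    unfolding S(2) max_ideal_prod_eq(2)
    using S(1,4) homogeneous_ord_ge by (intro genideal_mpoly_minimal[OF M[unfolded max_ideal_prod_eq(2)]]) blast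
  ultimately have "genideal (poly_ring d) S = ?M" using S(2) by blast
  then have "nu (poly_ring d) ?M \<le> card S"
    unfolding nu_def using S(1,3) by (intro Least_le) blast
  then show False using S(5) by simp
qed

text \<open>The least number in \<open>nu\<close> is attained because the products of two variables
  form a finite generating set.\<close>

lemma nu_witness:
  obtains G :: "'k::field mpoly set" where "G \<subseteq> carrier (poly_ring d)" "finite G"
    "card G = nu (poly_ring d) (max_ideal d \<cdot>\<^bsub>poly_ring d\<^esub> (max_ideal d :: 'k mpoly set))"
    "genideal (poly_ring d) G = max_ideal d \<cdot>\<^bsub>poly_ring d\<^esub> (max_ideal d :: 'k mpoly set)"
proof -
  let ?M = "max_ideal d \<cdot>\<^bsub>poly_ring d\<^esub> (max_ideal d :: 'k mpoly set)"
  let ?G = "{Var i * Var j | i j. i \<in> {1..d} \<and> j \<in> {1..d}} :: 'k mpoly set"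
  have "?G = (\<Union>i\<in>{1..d}. (\<lambda>j. Var i * Var j) ` {1..d})" by blast
  then have "finite ?G" by simp
  moreover have "?G \<subseteq> carrier (poly_ring d)" by (auto intro!: mult_in_mpoly)
  ultimately have "\<exists>n S. S \<subseteq> carrier (poly_ring d) \<and> finite S \<and> card S = n \<and> genideal (poly_ring d) S = ?M"
    by (intro exI[of _ "card ?G"] exI[of _ ?G] conjI refl max_ideal_prod_eq(1)[symmetric])
  then have "\<exists>S \<subseteq> carrier (poly_ring d). finite S \<and> card S = nu (poly_ring d) ?M \<and> genideal (poly_ring d) S = ?M"
    unfolding nu_def by (rule LeastI_ex)
  then show ?thesis using that by blast
qed

text \<open>The degree-two parts of a generating set of least size span the quadrics, so these have
  dimension at most card S + 1. As S is independent and misses a quadric v, adding v to S gives a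
  basis, and \<phi> is the coordinate along v.\<close>

lemma quadric_functional:
  fixes I :: "'k::field mpoly set"
  assumes "almost_square_quadric_ideal d I"
  obtains S \<phi> where "S \<subseteq> carrier (poly_ring d)" "I = genideal (poly_ring d) S" "\<And>q. q \<in> S \<Longrightarrow> quadric q"
    "\<And>p q. \<phi> (p + q) = \<phi> p + (\<phi> q :: 'k)" "\<And>c p. \<phi> (Const c * p) = c * \<phi> p"
    "\<And>q. q \<in> carrier (poly_ring d) \<Longrightarrow> quadric q \<Longrightarrow> \<phi> q = 0 \<longleftrightarrow> q \<in> mp.span S"
    "\<exists>q\<in>carrier (poly_ring d). quadric q \<and> \<phi> q \<noteq> 0"
proof -
  let ?M = "max_ideal d \<cdot>\<^bsub>poly_ring d\<^esub> (max_ideal d :: 'k mpoly set)"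
  obtain S where S: "S \<subseteq> carrier (poly_ring d)" "I = genideal (poly_ring d) S" "finite S"
    "\<And>q. q \<in> S \<Longrightarrow> quadric q" "mp.independent S" "card S + 1 = nu (poly_ring d) ?M"
    using almost_square_quadric_idealE[OF assms] by metis
  have I: "ideal I (poly_ring d)" unfolding S(2) by (rule genideal_mpoly_ideal[OF S(1)])
  have SI: "S \<subseteq> I" unfolding S(2) using genideal_mpoly_self[OF S(1)] by blast
  obtain v where v: "v \<in> carrier (poly_ring d)" "quadric v" "v \<notin> I"
    using almost_square_quadric_ideal_missing[OF assms] by blast
  have vS: "v \<notin> mp.span S" using span_subset_ideal[OF I SI] v(3) by blast
  obtain G :: "'k mpoly set" where G: "G \<subseteq> carrier (poly_ring d)" "finite G" "card G = nu (poly_ring d) ?M"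
    "genideal (poly_ring d) G = ?M" by (rule nu_witness)
  define T where "T = hpart2 ` G"
  \<comment> \<open>X is an ideal because multiplication changes the degree-two part of an element
    of order two only by a scalar. It contains G, hence the whole square of the maximal
    ideal.\<close>
  define X where "X = {p \<in> carrier (poly_ring d). ord_ge 2 p \<and> hpart2 p \<in> mp.span T}"
  have X: "ideal X (poly_ring d)"
    unfolding X_def
    by (rule ideal_mpolyI)
      (auto simp: hpart2_add hpart2_mult ord_ge_add ord_ge_mult_left mp.span_zero
        intro: mp.span_add mp.span_scale)
  have "G \<subseteq> X"
  proof
    fix p assume p: "p \<in> G"
    then have "p \<in> ?M" using genideal_mpoly_self[OF G(1)] G(4) by blast
    then have "p \<in> carrier (poly_ring d)" "ord_ge 2 p" unfolding max_ideal_prod_eq(2) by auto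
    moreover have "hpart2 p \<in> mp.span T" using p by (intro mp.span_base) (simp add: T_def)
    ultimately show "p \<in> X" by (simp add: X_def)
  qed
  then have MX: "?M \<subseteq> X" unfolding G(4)[symmetric] by (rule genideal_mpoly_minimal[OF X])
  have R2: "q \<in> mp.span T" if "q \<in> carrier (poly_ring d)" "quadric q" for q
  proof -
    have "q \<in> ?M" unfolding max_ideal_prod_eq(2) using that homogeneous_ord_ge by blast
    then have "hpart2 q \<in> mp.span T" using MX by (auto simp: X_def)
    then show ?thesis by (simp add: hpart2_quadric[OF that(2)])
  qed
  have finT: "finite T" and cT: "card T \<le> card S + 1"
    using G(2,3) S(6) card_image_le[OF G(2), of hpart2] by (simp_all add: T_def)
  have ind: "mp.independent (insert v S)" by (rule mp.independent_insertI[OF vS S(5)])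
  have vnS: "v \<notin> S" using vS mp.span_base by blast
  \<comment> \<open>A quadric outside the span of v and S would give card S + 2 independent vectors
    in the span of T, which has at most card S + 1 elements.\<close>
  have span: "q \<in> mp.span (insert v S)" if q: "q \<in> carrier (poly_ring d)" "quadric q" for q
  proof (rule ccontr)
    assume nq: "q \<notin> mp.span (insert v S)"
    then have "mp.independent (insert q (insert v S))" by (rule mp.independent_insertI[OF _ ind])
    moreover have "insert q (insert v S) \<subseteq> mp.span T" using R2 q v S(1,4) by blast
    ultimately have "card (insert q (insert v S)) \<le> card T" using mp.independent_span_bound[OF finT] by blast
    moreover have "q \<notin> insert v S" using nq mp.span_base by blast
    ultimately show False using cT vnS S(3) by simp
  qed
  interpret pair: vector_space_pair "\<lambda>(c::'k) (p::'k mpoly). Const c * p" "(*) :: 'k \<Rightarrow> 'k \<Rightarrow> 'k"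
    by unfold_locales (simp_all add: algebra_simps Const_mult)
  obtain \<phi> where \<phi>: "Vector_Spaces.linear (\<lambda>(c::'k) p. Const c * p) (*) \<phi>"
    "\<And>x. x \<in> insert v S \<Longrightarrow> \<phi> x = (if x = v then 1 else 0)"
    using pair.linear_independent_extend[OF ind, of "\<lambda>x. if x = v then 1 else 0"] by blast
  have add: "\<phi> (p + q) = \<phi> p + \<phi> q" for p q using pair.linear_add[OF \<phi>(1)] .
  have scale: "\<phi> (Const c * p) = c * \<phi> p" for c p using pair.linear_scale[OF \<phi>(1)] .
  have "mp.subspace {p. \<phi> p = 0}"
    by (rule mp.subspaceI) (use scale[of 0 0] in \<open>simp_all add: add scale\<close>)
  moreover have "S \<subseteq> {p. \<phi> p = 0}" using \<phi>(2) vnS by auto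
  ultimately have \<phi>S: "\<phi> p = 0" if "p \<in> mp.span S" for p using mp.span_minimal that by blast
  have \<phi>v: "\<phi> v = 1" using \<phi>(2)[of v] by simp
  have iff: "\<phi> q = 0 \<longleftrightarrow> q \<in> mp.span S" if q: "q \<in> carrier (poly_ring d)" "quadric q" for q
  proof
    assume 0: "\<phi> q = 0"
    obtain k where k: "q - Const k * v \<in> mp.span S"
      using span[OF q] unfolding mp.span_breakdown_eq by blast
    have "\<phi> q = \<phi> (q - Const k * v) + \<phi> (Const k * v)" by (simp flip: add)
    then have "k = 0" using 0 \<phi>S[OF k] by (simp add: scale \<phi>v)
    then show "q \<in> mp.span S" using k by simp
  qed (rule \<phi>S)
  have "\<exists>q\<in>carrier (poly_ring d). quadric q \<and> \<phi> q \<noteq> 0" using v \<phi>v by (intro bexI[of _ v]) auto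
  then show ?thesis using that[of S \<phi>] S(1,2,4) add scale iff by blast
qed

subsection \<open>Diagonalization of symmetric bilinear forms\<close>

text \<open>Induction on the dimension: split off a vector v with \<phi> (v v) nonzero and pass to
  its orthogonal complement W'. If \<phi> vanishes on all products, every basis is
  orthogonal.\<close>

lemma orthogonal_basis:
  fixes \<phi> :: "real mpoly \<Rightarrow> real"
  assumes add: "\<And>p q. \<phi> (p + q) = \<phi> p + \<phi> q" and scale: "\<And>c p. \<phi> (Const c * p) = c * \<phi> p"
    and B: "finite B" "mp.independent B"
  shows "\<exists>C. finite C \<and> mp.independent C \<and> mp.span C = mp.span B \<and>
    (\<forall>u\<in>C. \<forall>v\<in>C. u \<noteq> v \<longrightarrow> \<phi> (u * v) = 0)"
  using B
proof (induction "card B" arbitrary: B rule: less_induct)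
  case less
  let ?W = "mp.span B"
  show ?case
  proof (cases "\<forall>u\<in>?W. \<forall>v\<in>?W. \<phi> (u * v) = 0")
    case True
    then show ?thesis using less.prems mp.span_base by blast
  next
    case False
    then obtain x y where xy: "x \<in> ?W" "y \<in> ?W" "\<phi> (x * y) \<noteq> 0" by blast
    \<comment> \<open>Polarization: if all squares had value 0, then 2 \<phi> (x y) would be
      0.\<close>
    have "\<exists>v\<in>?W. \<phi> (v * v) \<noteq> 0"
    proof (rule ccontr)
      assume "\<not> ?thesis"
      then have z: "\<phi> (w * w) = 0" if "w \<in> ?W" for w using that by blast
      have "\<phi> ((x + y) * (x + y)) = \<phi> (x * x) + 2 * \<phi> (x * y) + \<phi> (y * y)"
      proof -
        have "(x + y) * (x + y) = x * x + (x * y + x * y) + y * y" by (simp add: algebra_simps)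
        then show ?thesis by (simp only: add)
      qed
      then show False using z xy mp.span_add[OF xy(1,2)] by simp
    qed
    then obtain v where v: "v \<in> ?W" "\<phi> (v * v) \<noteq> 0" by blast
    define W' where "W' = {w \<in> ?W. \<phi> (v * w) = 0}"
    have \<phi>0: "\<phi> 0 = 0" using scale[of 0 0] by simp
    have W': "mp.subspace W'"
      unfolding W'_def
      by (rule mp.subspaceI)
        (auto simp: \<phi>0 distrib_left add mult.left_commute[of v] scale intro: mp.span_zero mp.span_add mp.span_scale)
    obtain B' where B': "B' \<subseteq> W'" "mp.independent B'" "W' \<subseteq> mp.span B'"
      using mp.maximal_independent_subset by metis
    have sB': "mp.span B' = W'" using mp.span_subspace[OF B'(1,3) W'] .
    have vW': "v \<notin> W'" using v by (simp add: W'_def)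
    have ind: "mp.independent (insert v B')" using vW' B'(2) sB' by (intro mp.independent_insertI) auto
    have sub: "insert v B' \<subseteq> mp.span B" using v(1) B'(1) by (auto simp: W'_def)
    have bound: "finite (insert v B')" "card (insert v B') \<le> card B"
      using mp.independent_span_bound[OF less.prems(1) ind sub] by (rule conjunct1, rule conjunct2)
    have "v \<notin> B'" using vW' B'(1) by blast
    then have lt: "card B' < card B" "finite B'" using bound by simp_all
    obtain C' where C': "finite C'" "mp.independent C'" "mp.span C' = W'"
      "\<forall>u\<in>C'. \<forall>v\<in>C'. u \<noteq> v \<longrightarrow> \<phi> (u * v) = 0"
      using less.hyps[OF lt B'(2)] unfolding sB' by blast
    have CW: "C' \<subseteq> W'" unfolding C'(3)[symmetric] by (rule mp.span_superset)
    have "mp.independent (insert v C')" using vW' C'(2,3) by (intro mp.independent_insertI) auto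
    moreover have "mp.span (insert v C') = ?W"
    proof (rule mp.span_subspace[OF _ _ mp.subspace_span])
      show "insert v C' \<subseteq> ?W" using v(1) CW by (auto simp: W'_def)
      show "?W \<subseteq> mp.span (insert v C')"
      proof
        fix w assume w: "w \<in> ?W"
        \<comment> \<open>k is the coefficient of the orthogonal projection of w onto v.\<close>
        define k where "k = \<phi> (v * w) / \<phi> (v * v)"
        have "w - Const k * v \<in> W'"
        proof -
          have "\<phi> (v * w) = \<phi> (v * (w - Const k * v)) + \<phi> (Const k * (v * v))"
            by (simp add: algebra_simps flip: add)
          then have "\<phi> (v * (w - Const k * v)) = 0" using v(2) by (simp add: scale k_def)
          moreover have "w - Const k * v \<in> ?W" using w v(1) by (intro mp.span_diff mp.span_scale)
          ultimately show ?thesis by (simp add: W'_def)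
        qed
        then show "w \<in> mp.span (insert v C')" unfolding mp.span_breakdown_eq C'(3) by blast
      qed
    qed
    moreover have "\<phi> (a * b) = 0" if "a \<in> insert v C'" "b \<in> insert v C'" "a \<noteq> b" for a b
    proof -
      have *: "\<phi> (v * w) = 0" "\<phi> (w * v) = 0" if "w \<in> C'" for w
        using CW that by (auto simp: W'_def mult.commute[of w])
      show ?thesis using that * C'(4) by blast
    qed
    ultimately show ?thesis using C'(1) by (intro exI[of _ "insert v C'"]) blast
  qed
qed

lemma span_image_sum:
  assumes "finite A" "x \<in> mp.span (f ` A)"
  obtains c where "x = (\<Sum>a\<in>A. Const (c a) * f a)"
proof -
  let ?X = "{x. \<exists>c. x = (\<Sum>a\<in>A. Const (c a) * f a)}"
  have "mp.span (f ` A) \<subseteq> ?X"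
  proof (rule mp.span_minimal)
    show "mp.subspace ?X"
    proof (rule mp.subspaceI)
      have "0 = (\<Sum>a\<in>A. Const 0 * f a)" by simp
      then show "0 \<in> ?X" by (intro CollectI exI[of _ "\<lambda>_. 0"])
      fix x y assume "x \<in> ?X" "y \<in> ?X"
      then obtain c e where "x = (\<Sum>a\<in>A. Const (c a) * f a)" "y = (\<Sum>a\<in>A. Const (e a) * f a)" by blast
      then have "x + y = (\<Sum>a\<in>A. Const (c a + e a) * f a)" by (simp add: Const_add distrib_right sum.distrib)
      then show "x + y \<in> ?X" by (intro CollectI exI[of _ "\<lambda>a. c a + e a"])
    next
      fix k x assume "x \<in> ?X"
      then obtain c where "x = (\<Sum>a\<in>A. Const (c a) * f a)" by blast
      then have "Const k * x = (\<Sum>a\<in>A. Const (k * c a) * f a)"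
        by (simp add: Const_mult sum_distrib_left mult.assoc)
      then show "Const k * x \<in> ?X" by (intro CollectI exI[of _ "\<lambda>a. k * c a"])
    qed
    show "f ` A \<subseteq> ?X"
    proof safe
      fix b assume b: "b \<in> A"
      have "(\<Sum>a\<in>A. Const (if a = b then 1 else 0) * f a) = (\<Sum>a\<in>A. if a = b then f b else 0)"
        by (intro sum.cong) auto
      then have "f b = (\<Sum>a\<in>A. Const (if a = b then 1 else 0) * f a)" using assms(1) b by simp
      then show "\<exists>c. f b = (\<Sum>a\<in>A. Const (c a) * f a)" by (intro exI[of _ "\<lambda>a. if a = b then 1 else 0"])
    qed
  qed
  then show ?thesis using assms(2) that by blast
qed

lemma independent_image_sum:
  assumes "finite A" "inj_on f A" "mp.independent (f ` A)" "(\<Sum>a\<in>A. Const (c a) * f a) = 0" "a \<in> A"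
  shows "c a = 0"
proof -
  define u where "u y = c (inv_into A f y)" for y
  have u: "u (f a) = c a" if "a \<in> A" for a using assms(2) that by (simp add: u_def)
  have "(\<Sum>y\<in>f ` A. Const (u y) * y) = (\<Sum>a\<in>A. Const (c a) * f a)"
    using assms(2) u by (simp add: sum.reindex)
  then have "u (f a) = 0"
    using mp.independentD[OF assms(3) _ order_refl, of u "f a"] assms(1,4,5) by simp
  then show ?thesis using u[OF assms(5)] by simp
qed

lemma inj_Var: "inj_on (Var :: nat \<Rightarrow> 'k::field mpoly) A"
proof (rule inj_onI)
  fix i j assume "(Var i :: 'k mpoly) = Var j"
  then have "Poly_Mapping.lookup (Var i :: 'k mpoly) (Poly_Mapping.single i 1)
    = Poly_Mapping.lookup (Var j) (Poly_Mapping.single i 1)" by simp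
  then show "i = j" by (simp add: lookup_Var single_inject_1 split: if_splits)
qed

lemma Var_coeff_unique:
  assumes "finite V" "(\<Sum>j\<in>V. Const (a j) * Var j) = (\<Sum>j\<in>V. Const (b j) * Var j)" "i \<in> V"
  shows "a i = b i"
  using arg_cong[OF assms(2), of "\<lambda>p. Poly_Mapping.lookup p (Poly_Mapping.single i 1)"] assms(1,3)
  by (simp add: lookup_linear)

lemma independent_Var:
  assumes "finite V"
  shows "mp.independent (Var ` V :: 'k::field mpoly set)"
  unfolding mp.dependent_def
proof
  assume "\<exists>a\<in>Var ` V. (a :: 'k mpoly) \<in> mp.span (Var ` V - {a})"
  then obtain i where i: "i \<in> V" "(Var i :: 'k mpoly) \<in> mp.span (Var ` V - {Var i})" by blast
  have "mp.span (Var ` V - {Var i :: 'k mpoly}) \<subseteq> {p. Poly_Mapping.lookup p (Poly_Mapping.single i 1) = 0}"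
  proof (rule mp.span_minimal)
    show "mp.subspace {p :: 'k mpoly. Poly_Mapping.lookup p (Poly_Mapping.single i 1) = 0}"
      by (rule mp.subspaceI) (simp_all add: lookup_add)
    show "Var ` V - {Var i} \<subseteq> {p :: 'k mpoly. Poly_Mapping.lookup p (Poly_Mapping.single i 1) = 0}"
      by (auto simp: lookup_Var single_inject_1)
  qed
  then show False using i(2) by (auto simp: lookup_Var)
qed

text \<open>The new coordinates are the members of an orthogonal basis of the space of linear forms,
  scaled and numbered so that the isotropic ones come first.\<close>

lemma diagonalization:
  fixes \<phi> :: "real mpoly \<Rightarrow> real"
  assumes add: "\<And>p q. \<phi> (p + q) = \<phi> p + \<phi> q" and scale: "\<And>c p. \<phi> (Const c * p) = c * \<phi> p"
  obtains A D r where "invertible_matrix d A" "r \<le> d"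
    "\<And>k. k \<in> {1..d} \<Longrightarrow> k \<le> r \<Longrightarrow> D k = 0" "\<And>k. k \<in> {1..d} \<Longrightarrow> r < k \<Longrightarrow> D k \<in> {1, -1 :: real}"
    "\<And>i j. i \<in> {1..d} \<Longrightarrow> j \<in> {1..d} \<Longrightarrow>
      \<phi> (linear_subst d A (Var i * Var j)) = (if i = j then D i else 0)"
proof -
  let ?X = "Var ` {1..d} :: real mpoly set"
  have X: "finite ?X" "mp.independent ?X" "card ?X = d"
    using independent_Var[of "{1..d}"] by (simp_all add: card_image inj_Var)
  obtain C where C: "finite C" "mp.independent C" "mp.span C = mp.span ?X"
    "\<And>u v. u \<in> C \<Longrightarrow> v \<in> C \<Longrightarrow> u \<noteq> v \<Longrightarrow> \<phi> (u * v) = 0"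
    using orthogonal_basis[of \<phi>, OF add scale X(1,2)] by blast
  have "card C \<le> d" "d \<le> card C"
    using mp.independent_span_bound[OF X(1) C(2)] mp.independent_span_bound[OF C(1) X(2)]
      mp.span_superset C(3) X(3) by metis+
  then have cC: "card C = d" by simp
  define Z where "Z = {c \<in> C. \<phi> (c * c) = 0}"
  define r where "r = card Z"
  have Z: "Z \<subseteq> C" "finite Z" using C(1) by (auto simp: Z_def)
  have rd: "r \<le> d" unfolding r_def using card_mono[OF C(1) Z(1)] cC by simp
  have cCZ: "card (C - Z) = d - r" using card_Diff_subset[OF Z(2,1)] cC by (simp add: r_def)
  obtain h1 where h1: "bij_betw h1 {1..r} Z"
    using ex_bij_betw_nat_finite_1[OF Z(2)] unfolding r_def by blast
  obtain h2 where h2: "bij_betw h2 {1..d - r} (C - Z)"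
    using ex_bij_betw_nat_finite_1[of "C - Z"] C(1) cCZ by auto
  define e where "e k = (if k \<le> r then h1 k else h2 (k - r))" for k
  have eZ: "e k \<in> Z" if "k \<in> {1..d}" "k \<le> r" for k
    using that bij_betwE[OF h1] by (simp add: e_def)
  have eC: "e k \<in> C - Z" if "k \<in> {1..d}" "r < k" for k
  proof -
    have "k - r \<in> {1..d - r}" using that by auto
    then show ?thesis using that(2) bij_betwE[OF h2] by (simp add: e_def)
  qed
  have e_img: "e ` {1..d} = C"
  proof (intro equalityI subsetI)
    fix c assume "c \<in> e ` {1..d}"
    then show "c \<in> C" using eZ eC Z(1) by (metis DiffD1 imageE linorder_not_le subsetD)
  next
    fix c assume c: "c \<in> C"
    show "c \<in> e ` {1..d}"
    proof (cases "c \<in> Z")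
      case True
      then obtain k where "k \<in> {1..r}" "c = h1 k" using bij_betw_imp_surj_on[OF h1] by blast
      then show ?thesis using rd by (intro image_eqI[of _ _ k]) (auto simp: e_def)
    next
      case False
      then obtain k where "k \<in> {1..d - r}" "c = h2 k" using bij_betw_imp_surj_on[OF h2] c by blast
      then show ?thesis by (intro image_eqI[of _ _ "k + r"]) (auto simp: e_def)
    qed
  qed
  have e_inj: "inj_on e {1..d}"
    by (rule eq_card_imp_inj_on) (simp_all only: e_img cC finite_atLeastAtMost card_atLeastAtMost diff_Suc_1 Suc_eq_plus1 add_diff_cancel_right')
  \<comment> \<open>Dividing by the square root of the absolute value leaves only the sign of the
    diagonal entry; isotropic vectors stay unscaled.\<close>
  define s where "s k = (if k \<le> r then 1 else 1 / sqrt \<bar>\<phi> (e k * e k)\<bar>)" for k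
  have nz: "\<phi> (e k * e k) \<noteq> 0" if "k \<in> {1..d}" "r < k" for k using eC[OF that] by (auto simp: Z_def)
  have s_nz: "s k \<noteq> 0" if "k \<in> {1..d}" for k using nz[OF that] by (auto simp: s_def)
  define c where "c k = Const (s k) * e k" for k
  define D where "D k = \<phi> (c k * c k)" for k
  have cc: "\<phi> (c i * c j) = s i * s j * \<phi> (e i * e j)" for i j
  proof -
    have "c i * c j = Const (s i * s j) * (e i * e j)" by (simp add: c_def Const_mult mult_ac)
    then show ?thesis by (simp only: scale)
  qed
  have D0: "D k = 0" if "k \<in> {1..d}" "k \<le> r" for k
    using eZ[OF that] by (simp add: D_def cc Z_def)
  have D1: "D k \<in> {1, -1}" if "k \<in> {1..d}" "r < k" for k
  proof -
    have "D k = \<phi> (e k * e k) / \<bar>\<phi> (e k * e k)\<bar>"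
      using that(2) by (simp add: D_def cc s_def flip: real_sqrt_mult)
    then show ?thesis using nz[OF that] by (simp add: abs_if)
  qed
  have orth: "\<phi> (c i * c j) = (if i = j then D i else 0)" if "i \<in> {1..d}" "j \<in> {1..d}" for i j
  proof (cases "i = j")
    case False
    then have "e i \<noteq> e j" using inj_onD[OF e_inj _ that] by blast
    moreover have "e i \<in> C" "e j \<in> C" using e_img that by blast+
    ultimately show ?thesis using C(4) False by (simp add: cc)
  qed (simp add: D_def)
  have "\<forall>k\<in>{1..d}. \<exists>a. c k = (\<Sum>j=1..d. Const (a j) * Var j)"
  proof
    fix k assume k: "k \<in> {1..d}"
    have "e k \<in> C" using e_img k by blast
    then have "e k \<in> mp.span ?X" unfolding C(3)[symmetric] by (rule mp.span_base)
    then have "c k \<in> mp.span ?X" unfolding c_def by (rule mp.span_scale)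
    then obtain a where "c k = (\<Sum>j=1..d. Const (a j) * Var j)"
      by (rule span_image_sum[OF finite_atLeastAtMost])
    then show "\<exists>a. c k = (\<Sum>j=1..d. Const (a j) * Var j)" by (rule exI[of _ a])
  qed
  from bchoice[OF this] obtain A where A: "\<And>k. k \<in> {1..d} \<Longrightarrow> c k = (\<Sum>j=1..d. Const (A k j) * Var j)"
    by blast
  \<comment> \<open>Expanding the variables in the new basis produces the inverse matrix; the two
    products are then checked by comparing coefficients, once in the variables and once in the new
    basis.\<close>
  have "\<forall>i\<in>{1..d}. \<exists>b. (Var i :: real mpoly) = (\<Sum>k=1..d. Const (b k) * c k)"
  proof
    fix i assume i: "i \<in> {1..d}"
    then have "Var i \<in> mp.span (e ` {1..d})"
      unfolding e_img C(3) by (intro mp.span_base imageI)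
    then obtain b where b: "Var i = (\<Sum>k=1..d. Const (b k) * e k)"
      by (rule span_image_sum[OF finite_atLeastAtMost])
    also have "\<dots> = (\<Sum>k=1..d. Const (b k / s k) * c k)"
      by (intro sum.cong refl) (use s_nz in \<open>simp add: c_def flip: mult.assoc Const_mult\<close>)
    finally show "\<exists>b. (Var i :: real mpoly) = (\<Sum>k=1..d. Const (b k) * c k)"
      by (rule exI[of _ "\<lambda>k. b k / s k"])
  qed
  from bchoice[OF this] obtain B
    where B: "\<And>i. i \<in> {1..d} \<Longrightarrow> (Var i :: real mpoly) = (\<Sum>k=1..d. Const (B i k) * c k)"
    by blast
  have expand: "(\<Sum>j=1..d. Const (f j) * (\<Sum>k=1..d. Const (g j k) * h k)) = (\<Sum>k=1..d. Const (\<Sum>j=1..d. f j * g j k) * h k)"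
    for f g and h :: "nat \<Rightarrow> real mpoly"
  proof -
    have "(\<Sum>j=1..d. Const (f j) * (\<Sum>k=1..d. Const (g j k) * h k)) = (\<Sum>j=1..d. \<Sum>k=1..d. Const (f j * g j k) * h k)"
      by (simp add: sum_distrib_left Const_mult mult.assoc)
    also have "\<dots> = (\<Sum>k=1..d. \<Sum>j=1..d. Const (f j * g j k) * h k)" by (rule sum.swap)
    finally show ?thesis by (simp add: Const_sum sum_distrib_right)
  qed
  have delta: "(\<Sum>k=1..d. Const (if i = k then 1 else 0) * h k) = h i" if "i \<in> {1..d}" for i and h :: "nat \<Rightarrow> real mpoly"
  proof -
    have "(\<Sum>k=1..d. Const (if i = k then 1 else 0) * h k) = (\<Sum>k=1..d. if k = i then h i else 0)"
      by (intro sum.cong) auto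
    then show ?thesis using that by simp
  qed
  have BA: "(\<Sum>j=1..d. B i j * A j k) = (if i = k then 1 else 0)" if i: "i \<in> {1..d}" and k: "k \<in> {1..d}" for i k
  proof (rule Var_coeff_unique[OF finite_atLeastAtMost _ k])
    have "(\<Sum>k=1..d. Const (\<Sum>j=1..d. B i j * A j k) * Var k) = (\<Sum>j=1..d. Const (B i j) * c j)"
      unfolding expand[symmetric] by (intro sum.cong refl) (simp add: A)
    also have "\<dots> = Var i" using B[OF i] by simp
    finally show "(\<Sum>k=1..d. Const (\<Sum>j=1..d. B i j * A j k) * Var k)
      = (\<Sum>k=1..d. Const (if i = k then 1 else 0) * Var k)" using delta[OF i, of Var] by simp
  qed
  have AB: "(\<Sum>j=1..d. A i j * B j k) = (if i = k then 1 else 0)" if i: "i \<in> {1..d}" and k: "k \<in> {1..d}" for i k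
  proof -
    let ?m = "\<lambda>k. (\<Sum>j=1..d. A i j * B j k) - (if i = k then 1 else 0)"
    have "(\<Sum>k=1..d. Const (\<Sum>j=1..d. A i j * B j k) * c k) = (\<Sum>j=1..d. Const (A i j) * Var j)"
      unfolding expand[symmetric] by (intro sum.cong refl) (simp add: B[symmetric])
    also have "\<dots> = c i" using A[OF i] by simp
    finally have "(\<Sum>k=1..d. Const (?m k) * c k) = 0"
      using delta[OF i, of c] by (simp only: Const_diff left_diff_distrib sum_subtractf diff_self)
    \<comment> \<open>Independence is available for the unscaled vectors \<open>e k\<close>, so the
      nonzero factor \<open>s k\<close> is absorbed into the coefficient.\<close>
    then have "(\<Sum>k=1..d. Const (?m k * s k) * e k) = 0" by (simp only: c_def Const_mult mult.assoc)
    from independent_image_sum[OF finite_atLeastAtMost e_inj _ this k] C(2) e_img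
    have "?m k * s k = 0" by simp
    then show ?thesis using s_nz[OF k] by simp
  qed
  have "invertible_matrix d A" unfolding invertible_matrix_def using AB BA by blast
  moreover have "\<phi> (linear_subst d A (Var i * Var j)) = (if i = j then D i else 0)"
    if "i \<in> {1..d}" "j \<in> {1..d}" for i j
    using orth[OF that] unfolding A[OF that(1)] A[OF that(2)]
    by (simp only: linear_subst_eq subst_poly_mult subst_poly_Var)
  ultimately show ?thesis using that[of A r D] rd D0 D1 by blast
qed

subsection \<open>The classification\<close>

text \<open>Restriction to the last coordinate axis: every variable except x_d is set to 0.\<close>

definition last_var :: "nat \<Rightarrow> nat \<Rightarrow> 'k::field mpoly" where
  "last_var d j = (if j = d then Var d else 0)"

text \<open>Composed with \<sigma>, restriction to the axis is again a substitution without constant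
  terms, so its kernel is a prime inside the ideal of the origin; the preimage of x_d under \<sigma>
  shows that it is properly smaller.\<close>

lemma codim_last_var_less:
  fixes I :: "'k::field mpoly set"
  assumes \<sigma>: "change_of_variables d \<sigma>" and d: "1 \<le> d"
    and I: "\<And>p. p \<in> I \<Longrightarrow> p \<in> carrier (poly_ring d) \<and> subst_poly (last_var d) (\<sigma> p) = 0"
  shows "codim (poly_ring d) I < enat d"
proof -
  obtain A B where A: "\<sigma> = linear_subst d A"
    and inv: "\<And>p. p \<in> carrier (poly_ring d) \<Longrightarrow> \<sigma> (linear_subst d B p) = p"
    using change_of_variables_inverse[OF \<sigma>] by metis
  define f where "f i = subst_poly (last_var d) (\<sigma> (Var i))" for i
  have comp: "subst_poly (last_var d) (\<sigma> p) = subst_poly f p" if "p \<in> carrier (poly_ring d)" for p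
    unfolding A linear_subst_eq by (rule subst_poly_comp_eq[OF that]) (simp add: f_def A linear_subst_eq)
  have const: "Poly_Mapping.lookup (subst_poly g p) 0 = Poly_Mapping.lookup p 0"
    if "p \<in> carrier (poly_ring d)" "\<And>i. Poly_Mapping.lookup (g i) 0 = 0" for g p
    using that(1) by (induction rule: mpoly_induct)
      (auto simp: subst_poly_add subst_poly_mult lookup_add that(2) lookup_Const lookup_ord_ge[OF ord_ge_Var(1)])
  have lv: "Poly_Mapping.lookup (last_var d i :: 'k mpoly) 0 = 0" for i
    by (simp add: last_var_def lookup_ord_ge[OF ord_ge_Var(1)])
  have lin: "Poly_Mapping.lookup (linear_subst d C p) 0 = Poly_Mapping.lookup p 0"
    if "p \<in> carrier (poly_ring d)" for C p
    unfolding linear_subst_eq by (rule const[OF that lookup_ord_ge[OF ord_ge_linear]]) simp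
  show ?thesis
  proof (rule codim_subst_kernel_less)
    show "p \<in> carrier (poly_ring d) \<and> subst_poly f p = 0" if "p \<in> I" for p
      using I[OF that] comp by metis
    show "Poly_Mapping.lookup (f i) 0 = 0" if "i \<in> {1..d}" for i
    proof -
      have i: "Var i \<in> carrier (poly_ring d)" using that by simp
      have "Poly_Mapping.lookup (f i) 0 = Poly_Mapping.lookup (Var i :: 'k mpoly) 0"
        unfolding f_def A using const[OF linear_subst_in_mpoly[OF i] lv] lin[OF i] by simp
      then show ?thesis by (simp add: lookup_ord_ge[OF ord_ge_Var(1)])
    qed
    have vd: "(Var d :: 'k mpoly) \<in> carrier (poly_ring d)" using d by simp
    have "subst_poly f (linear_subst d B (Var d)) = Var d"
      using comp[OF linear_subst_in_mpoly[OF vd, of B]] inv[OF vd] by (simp add: last_var_def)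
    moreover have "(Var d :: 'k mpoly) \<noteq> 0" by (simp add: Var_def)
    ultimately show "\<exists>p\<in>carrier (poly_ring d). Poly_Mapping.lookup p 0 = 0 \<and> subst_poly f p \<noteq> 0"
      using lin[OF vd, of B] lookup_ord_ge[OF ord_ge_Var(1), of 0 d]
      by (intro bexI[OF _ linear_subst_in_mpoly[OF vd, of B]]) simp
  qed
qed

text \<open>Preimages of ideals under linear substitutions are ideals, so both inclusions may be
  tested on generators.\<close>

lemma ideal_image_change_of_variables:
  assumes \<sigma>: "\<sigma> = linear_subst d A"
    and inv: "\<And>p. p \<in> carrier (poly_ring d) \<Longrightarrow> \<tau> (\<sigma> p) = p" "\<And>p. p \<in> carrier (poly_ring d) \<Longrightarrow> \<sigma> (\<tau> p) = p"
    and \<tau>: "\<tau> = linear_subst d B"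
    and S: "S \<subseteq> carrier (poly_ring d)" and T: "T \<subseteq> carrier (poly_ring d)"
    and ST: "\<And>p. p \<in> S \<Longrightarrow> \<sigma> p \<in> genideal (poly_ring d) T"
    and TS: "\<And>p. p \<in> T \<Longrightarrow> \<tau> p \<in> genideal (poly_ring d) S"
  shows "\<sigma> ` genideal (poly_ring d) S = genideal (poly_ring d) T"
proof -
  have pull: "ideal {p \<in> carrier (poly_ring d). linear_subst d C p \<in> K} (poly_ring d)"
    if K: "ideal K (poly_ring d)" for C K
    by (rule ideal_mpolyI)
      (auto simp: linear_subst_add linear_subst_mult intro: ideal_mpoly_zero[OF K] ideal_mpoly_add[OF K]
        ideal_mpoly_mult[OF K linear_subst_in_mpoly])
  have IS: "ideal (genideal (poly_ring d) S) (poly_ring d)" and IT: "ideal (genideal (poly_ring d) T) (poly_ring d)"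
    using S T by (auto intro: genideal_mpoly_ideal)
  have 1: "genideal (poly_ring d) S \<subseteq> {p \<in> carrier (poly_ring d). \<sigma> p \<in> genideal (poly_ring d) T}"
    by (rule genideal_mpoly_minimal[OF pull[OF IT, of A, folded \<sigma>]]) (use S ST in blast)
  have 2: "genideal (poly_ring d) T \<subseteq> {p \<in> carrier (poly_ring d). \<tau> p \<in> genideal (poly_ring d) S}"
    by (rule genideal_mpoly_minimal[OF pull[OF IS, of B, folded \<tau>]]) (use T TS in blast)
  show ?thesis
  proof (intro equalityI subsetI)
    fix w assume "w \<in> genideal (poly_ring d) T"
    then have "\<tau> w \<in> genideal (poly_ring d) S" "w = \<sigma> (\<tau> w)" using 2 inv(2) by auto
    then show "w \<in> \<sigma> ` genideal (poly_ring d) S" by blast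
  qed (use 1 in blast)
qed

text \<open>On the axis a quadric retains only its x_d^2 term, exactly the coefficient tested by a
  functional whose single nonzero diagonal entry is the last.\<close>

lemma quadric_last_var_zero:
  assumes w: "quadric w" "w \<in> carrier (poly_ring d)"
  shows "subst_poly (last_var d) w = Const (Poly_Mapping.lookup w (Poly_Mapping.single d 2)) * (Var d * Var d)"
  using w
proof (induction rule: quadric_induct)
  case (Var_mult i j)
  then show ?case by (auto simp: subst_poly_mult lookup_Var_mult last_var_def)
qed (auto simp: subst_poly_add subst_poly_mult lookup_add Const_add Const_mult distrib_right mult.assoc)

lemma quadric_nf_generators: "p \<in> nf_monomials r d \<union> nf_binomials r d \<epsilon> \<Longrightarrow> quadric p"
  unfolding nf_monomials_def nf_binomials_def power2_eq_square
  by (auto intro!: quadric_Var_mult homogeneous_add homogeneous_Const_mult)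

text \<open>Over the reals the functional vanishing on the quadrics of the ideal becomes diagonal with
  entries \<open>0, 1, -1\<close>; a single nonzero entry would contradict the codimension.\<close>

lemma real_normal_form:
  fixes I :: "real mpoly set"
  assumes asq: "almost_square_quadric_ideal d I"
  obtains \<sigma> r \<epsilon> where "change_of_variables d \<sigma>" "r + 2 \<le> d" "\<And>k. \<epsilon> k \<in> {1, -1}"
    "\<sigma> ` I = normal_form r d \<epsilon>" "ideal I (poly_ring d)"
proof -
  obtain S \<phi> where S: "S \<subseteq> carrier (poly_ring d)" "I = genideal (poly_ring d) S" "\<And>q. q \<in> S \<Longrightarrow> quadric q"
    and add: "\<And>p q. \<phi> (p + q) = \<phi> p + (\<phi> q :: real)" and scale: "\<And>c p. \<phi> (Const c * p) = c * \<phi> p"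
    and ker: "\<And>q. q \<in> carrier (poly_ring d) \<Longrightarrow> quadric q \<Longrightarrow> \<phi> q = 0 \<longleftrightarrow> q \<in> mp.span S"
    and nz: "\<exists>q\<in>carrier (poly_ring d). quadric q \<and> \<phi> q \<noteq> 0"
  proof (rule quadric_functional[OF asq], goal_cases)
    case (1 S \<phi>)
    show ?case using 1(2-) by (rule 1(1))
  qed
  have I: "ideal I (poly_ring d)" unfolding S(2) by (rule genideal_mpoly_ideal[OF S(1)])
  obtain B D r where B: "invertible_matrix d B" and "r \<le> d"
    and D0: "\<And>k. k \<in> {1..d} \<Longrightarrow> k \<le> r \<Longrightarrow> D k = 0"
    and D1: "\<And>k. k \<in> {1..d} \<Longrightarrow> r < k \<Longrightarrow> D k \<in> {1, -1 :: real}"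
    and diag: "\<And>i j. i \<in> {1..d} \<Longrightarrow> j \<in> {1..d} \<Longrightarrow>
      \<phi> (linear_subst d B (Var i * Var j)) = (if i = j then D i else 0)"
  proof (rule diagonalization[of \<phi> d, OF add scale], goal_cases)
    case (1 A D r)
    show ?case using 1(2-) by (rule 1(1))
  qed
  define \<tau> where "\<tau> = linear_subst d B"
  obtain A where A: "invertible_matrix d A"
    and inv: "\<And>p. p \<in> carrier (poly_ring d) \<Longrightarrow> \<tau> (linear_subst d A p) = p"
      "\<And>p. p \<in> carrier (poly_ring d) \<Longrightarrow> linear_subst d A (\<tau> p) = p"
    unfolding \<tau>_def
  proof (rule invertible_matrix_inverse[OF B], goal_cases)
    case (1 A)
    show ?case using 1(2-) by (rule 1(1))
  qed
  define \<sigma> where "\<sigma> = linear_subst d A"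
  note inv = inv[folded \<sigma>_def]
  have \<sigma>: "change_of_variables d \<sigma>" unfolding change_of_variables_def \<sigma>_def using A by blast
  have form: "\<phi> (\<tau> w) = diag_form {1..d} D w" if "quadric w" "w \<in> carrier (poly_ring d)" for w
    using that
  proof (induction rule: quadric_induct)
    case (Var_mult i j)
    then show ?case using diag[of i j] by (simp add: \<tau>_def diag_form_Var_mult)
  next
    show "\<phi> (\<tau> 0) = diag_form {1..d} D 0" using scale[of 0 0] by (simp add: \<tau>_def)
  qed (auto simp: \<tau>_def linear_subst_add linear_subst_mult add scale diag_form_add diag_form_Const_mult)
  have \<sigma>q: "quadric (\<sigma> q)" "\<sigma> q \<in> carrier (poly_ring d)" if "quadric q" "q \<in> carrier (poly_ring d)" for q
    unfolding \<sigma>_def using that homogeneous_linear_subst by auto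
  have \<sigma>S: "quadric (\<sigma> q)" "\<sigma> q \<in> carrier (poly_ring d)" "diag_form {1..d} D (\<sigma> q) = 0" if q: "q \<in> S" for q
  proof -
    have qc: "q \<in> carrier (poly_ring d)" "quadric q" using S(1,3) q by auto
    then show *: "quadric (\<sigma> q)" "\<sigma> q \<in> carrier (poly_ring d)" using \<sigma>q by auto
    have "\<phi> q = 0" using ker[OF qc] mp.span_base[OF q] by simp
    then show "diag_form {1..d} D (\<sigma> q) = 0" using form[OF *] inv(1)[OF qc(1)] by simp
  qed
  \<comment> \<open>A form of rank zero vanishes on all quadrics, against \<open>nz\<close>.\<close>
  have "r \<noteq> d"
  proof
    assume "r = d"
    then have "diag_form {1..d} D w = 0" for w using D0 by (simp add: diag_form_def)
    then have "\<phi> q = 0" if "q \<in> carrier (poly_ring d)" "quadric q" for q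
      using form[OF \<sigma>q[OF that(2,1)]] inv(1)[OF that(1)] by simp
    then show False using nz by blast
  qed
  with \<open>r \<le> d\<close> have rd: "r < d" by simp
  \<comment> \<open>With rank one the transformed generators have no x_d^2 term, so they all vanish
    on the x_d axis.\<close>
  have "r + 1 \<noteq> d"
  proof
    assume rd1: "r + 1 = d"
    have Dd: "D d \<noteq> 0" using D1[of d] rd1 by auto
    have last: "diag_form {1..d} D w = D d * Poly_Mapping.lookup w (Poly_Mapping.single d 2)" for w
    proof -
      have "diag_form {1..d} D w = (\<Sum>k\<in>{1..d}. if k = d then D d * Poly_Mapping.lookup w (Poly_Mapping.single d 2) else 0)"
        unfolding diag_form_def by (intro sum.cong refl) (use D0 rd1 in auto)
      then show ?thesis using rd by simp
    qed
    have K: "ideal {p \<in> carrier (poly_ring d). subst_poly (last_var d) (\<sigma> p) = 0} (poly_ring d)"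
      by (rule ideal_mpolyI) (auto simp: \<sigma>_def linear_subst_add linear_subst_mult subst_poly_add subst_poly_mult)
    have "I \<subseteq> {p \<in> carrier (poly_ring d). subst_poly (last_var d) (\<sigma> p) = 0}"
      unfolding S(2)
    proof (rule genideal_mpoly_minimal[OF K], rule subsetI)
      fix q assume q: "q \<in> S"
      have "Poly_Mapping.lookup (\<sigma> q) (Poly_Mapping.single d 2) = 0"
        using \<sigma>S(3)[OF q] Dd by (simp add: last)
      then show "q \<in> {p \<in> carrier (poly_ring d). subst_poly (last_var d) (\<sigma> p) = 0}"
        using quadric_last_var_zero[OF \<sigma>S(1,2)[OF q]] S(1) q by auto
    qed
    then have "codim (poly_ring d) I < enat d"
      using rd by (intro codim_last_var_less[OF \<sigma>]) auto
    then show False using asq by (simp add: almost_square_quadric_ideal_def)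
  qed
  with rd have rd2: "r + 2 \<le> d" by simp
  \<comment> \<open>Dividing by the first nonzero entry s leaves the kernel of the functional
    unchanged, and the signs \<epsilon> k are taken relative to it. Outside r < k \<le> d the
    default 1 keeps \<epsilon> k a sign.\<close>
  define s where "s = D (r + 1)"
  have s: "s * s = 1" using D1[of "r + 1"] rd by (auto simp: s_def)
  define \<epsilon> where "\<epsilon> k = (if r < k \<and> k \<le> d then - s * D k else 1)" for k
  have \<epsilon>: "\<epsilon> k \<in> {1, -1}" for k
    using D1[of k] D1[of "r + 1"] rd by (auto simp: \<epsilon>_def s_def)
  have \<epsilon>2: "\<epsilon> k * \<epsilon> k = 1" for k using \<epsilon>[of k] by auto
  have Ds: "D k = s * nf_coeff r \<epsilon> k" if k: "k \<in> {1..d}" for k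
  proof -
    consider "k \<le> r" | "k = r + 1" | "r + 1 < k" by linarith
    then show ?thesis
    proof cases
      case 3
      then have "s * nf_coeff r \<epsilon> k = (s * s) * D k" using k by (simp add: nf_coeff_def \<epsilon>_def)
      then show ?thesis using s by simp
    qed (use D0 k in \<open>simp_all add: nf_coeff_def s_def\<close>)
  qed
  have form_s: "diag_form {1..d} D w = s * diag_form {1..d} (nf_coeff r \<epsilon>) w" for w
    unfolding diag_form_def sum_distrib_left by (intro sum.cong refl) (simp add: Ds mult.assoc)
  have s0: "s \<noteq> 0" using s by auto
  have r: "r \<le> d" using rd by simp
  have gens: "nf_monomials r d \<union> nf_binomials r d \<epsilon> \<subseteq> carrier (poly_ring d)"
    using nf_monomials_carrier nf_binomials_carrier by blast
  have "\<sigma> ` genideal (poly_ring d) S = genideal (poly_ring d) (nf_monomials r d \<union> nf_binomials r d \<epsilon>)"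
  proof (rule ideal_image_change_of_variables[OF \<sigma>_def inv \<tau>_def S(1) gens])
    fix q assume q: "q \<in> S"
    have "\<sigma> q \<in> diag_ideal {1..d} (nf_coeff r \<epsilon>)"
      using \<sigma>S[OF q] s0 homogeneous_ord_ge by (auto simp: diag_ideal_def form_s)
    then show "\<sigma> q \<in> genideal (poly_ring d) (nf_monomials r d \<union> nf_binomials r d \<epsilon>)"
      unfolding normal_form_eq[OF r, symmetric] normal_form_diag_ideal[where \<epsilon> = \<epsilon>, OF rd2 \<epsilon>2] .
  next
    fix w assume w: "w \<in> nf_monomials r d \<union> nf_binomials r d \<epsilon>"
    have wq: "quadric w" "w \<in> carrier (poly_ring d)" using quadric_nf_generators[OF w] gens w by auto
    have "w \<in> diag_ideal {1..d} (nf_coeff r \<epsilon>)"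
      using w normal_form_subset_diag_ideal[where \<epsilon> = \<epsilon>, OF r \<epsilon>2] by blast
    then have "\<phi> (\<tau> w) = 0" using form[OF wq] by (simp add: form_s diag_ideal_def)
    then have "\<tau> w \<in> mp.span S"
      using ker[of "\<tau> w"] wq homogeneous_linear_subst[OF wq(1)] by (simp add: \<tau>_def)
    then show "\<tau> w \<in> genideal (poly_ring d) S"
      using span_subset_ideal[OF genideal_mpoly_ideal[OF S(1)], of S] genideal_mpoly_self[OF S(1)] by blast
  qed
  then have "\<sigma> ` I = normal_form r d \<epsilon>" unfolding S(2) normal_form_eq[OF r] .
  from \<sigma> rd2 \<epsilon> this I show ?thesis by (rule that)
qed

text \<open>The equivalence serves both directions of the theorem: it recovers r from the given
  type, and it supplies the type in the converse.\<close>

lemma cm_type_normal_form: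
  assumes \<sigma>: "change_of_variables d \<sigma>" and I: "ideal I (poly_ring d)" and rd: "r + 2 \<le> d"
    and \<epsilon>: "\<And>k. \<epsilon> k \<in> {1, -1 :: 'k::field}" and img: "\<sigma> ` I = normal_form r d \<epsilon>"
  shows "has_cm_type d I n \<longleftrightarrow> n = r + 1"
proof (rule cm_type_diag_ideal[OF _ _ _ _ \<sigma> I])
  have \<epsilon>2: "\<epsilon> k * \<epsilon> k = 1" for k using \<epsilon>[of k] by auto
  show "\<sigma> ` I = diag_ideal {1..d} (nf_coeff r \<epsilon>)"
    unfolding img by (rule normal_form_diag_ideal[where \<epsilon> = \<epsilon>, OF rd \<epsilon>2])
  show "nf_coeff r \<epsilon> k \<noteq> 0" if "r < k" for k
    using nf_coeff_square[where \<epsilon> = \<epsilon>, OF \<epsilon>2 that] by auto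
qed (use rd in \<open>auto simp: nf_coeff_def\<close>)

text \<open>For r = d the ideal would contain every quadric. For r + 1 = d there are no binomials
  and all generators vanish on the x_d axis, contradicting codimension d.\<close>

lemma converse_rank_bound:
  fixes I :: "'k::field mpoly set"
  assumes asq: "almost_square_quadric_ideal d I" and r: "r \<le> d" and \<rho>: "change_of_variables d \<rho>"
    and img: "\<rho> ` I = normal_form r d \<epsilon>"
  shows "r + 2 \<le> d"
proof -
  obtain S where S: "S \<subseteq> carrier (poly_ring d)" "I = genideal (poly_ring d) S"
    using almost_square_quadric_idealE[OF asq] by metis
  have I: "ideal I (poly_ring d)" unfolding S(2) by (rule genideal_mpoly_ideal[OF S(1)])
  obtain A B where A: "\<rho> = linear_subst d A"
    and inv: "\<And>p. p \<in> carrier (poly_ring d) \<Longrightarrow> linear_subst d B (\<rho> p) = p"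
    using change_of_variables_inverse[OF \<rho>] by metis
  have gens: "nf_monomials r d \<union> nf_binomials r d \<epsilon> \<subseteq> carrier (poly_ring d)"
    using nf_monomials_carrier nf_binomials_carrier by blast
  have N: "ideal (normal_form r d \<epsilon>) (poly_ring d)"
    unfolding normal_form_eq[OF r] by (rule genideal_mpoly_ideal[OF gens])
  have nq: "\<exists>q\<in>carrier (poly_ring d). quadric q \<and> q \<notin> I"
    by (rule almost_square_quadric_ideal_missing[OF asq])
  have "r \<noteq> d"
  proof
    assume rd: "r = d"
    have all: "p \<in> normal_form r d \<epsilon>" if "p \<in> carrier (poly_ring d)" "quadric p" for p
      using that(2,1)
    proof (induction rule: quadric_induct)
      case (Var_mult i j)
      then have "Var i * Var j \<in> nf_monomials r d" unfolding nf_monomials_def rd by auto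
      then show ?case unfolding normal_form_eq[OF r] by (intro genideal_mpoly_self[OF gens] UnI1)
    qed (auto intro: ideal_mpoly_add[OF N] ideal_mpoly_mult[OF N] ideal_mpoly_zero[OF N])
    have "q \<in> I" if q: "q \<in> carrier (poly_ring d)" "quadric q" for q
    proof -
      have "\<rho> q \<in> \<rho> ` I"
        unfolding img unfolding A by (intro all linear_subst_in_mpoly homogeneous_linear_subst q)
      then obtain q' where "q' \<in> I" "\<rho> q = \<rho> q'" by blast
      then show ?thesis using inv[OF q(1)] inv[OF ideal_mpoly_subset[OF I]] by metis
    qed
    then show False using nq by blast
  qed
  moreover have "r + 1 \<noteq> d"
  proof
    assume rd: "r + 1 = d"
    have K: "ideal {p \<in> carrier (poly_ring d). subst_poly (last_var d) p = 0} (poly_ring d)"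
      by (rule ideal_mpolyI) (auto simp: subst_poly_add subst_poly_mult)
    have "nf_monomials r d \<union> nf_binomials r d \<epsilon> \<subseteq> {p \<in> carrier (poly_ring d). subst_poly (last_var d) p = 0}"
    proof
      fix p assume p: "p \<in> nf_monomials r d \<union> nf_binomials r d \<epsilon>"
      have "nf_binomials r d \<epsilon> = {}" using rd by (simp add: nf_binomials_def)
      with p obtain i j where ij: "p = Var i * Var j" "i \<noteq> j \<or> i \<le> r"
        unfolding nf_monomials_def by blast
      then have "subst_poly (last_var d) p = 0" using rd by (auto simp: subst_poly_mult last_var_def)
      then show "p \<in> {p \<in> carrier (poly_ring d). subst_poly (last_var d) p = 0}" using p gens by blast
    qed
    then have sub: "normal_form r d \<epsilon> \<subseteq> {p \<in> carrier (poly_ring d). subst_poly (last_var d) p = 0}"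
      unfolding normal_form_eq[OF r] by (rule genideal_mpoly_minimal[OF K])
    have "codim (poly_ring d) I < enat d"
    proof (rule codim_last_var_less[OF \<rho>])
      fix p assume p: "p \<in> I"
      then have "\<rho> p \<in> normal_form r d \<epsilon>" using img by blast
      then show "p \<in> carrier (poly_ring d) \<and> subst_poly (last_var d) (\<rho> p) = 0"
        using sub ideal_mpoly_subset[OF I p] by blast
    qed (use rd in simp)
    then show False using asq by (simp add: almost_square_quadric_ideal_def)
  qed
  ultimately show ?thesis using r by simp
qed

text \<open>Substitution by the identity matrix sends variables outside x_1, ..., x_d to 0, hence
  the restriction to \<open>poly_ring d\<close>.\<close>

lemma change_of_variables_identity:
  obtains \<tau> :: "'k::field mpoly \<Rightarrow> 'k mpoly" where "change_of_variables d \<tau>"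
    "\<And>p. p \<in> carrier (poly_ring d) \<Longrightarrow> \<tau> p = p"
proof -
  define A where "A i j = (if i = j then 1 else 0 :: 'k)" for i j :: nat
  have AA: "(\<Sum>j=1..d. A i j * A j k) = (if i = k then 1 else 0)" if "i \<in> {1..d}" for i k
  proof -
    have "(\<Sum>j=1..d. A i j * A j k) = (\<Sum>j=1..d. if j = i then A i k else 0)"
      by (intro sum.cong) (auto simp: A_def)
    then show ?thesis using that by (simp add: A_def)
  qed
  then have inv: "invertible_matrix d A" unfolding invertible_matrix_def by (intro exI[of _ A]) simp
  have "linear_subst d A p = p" if p: "p \<in> carrier (poly_ring d)" for p
  proof -
    have "(\<Sum>j=1..d. Const (A i j) * Var j) = Var i" if "i \<in> {1..d}" for i
    proof -
      have "(\<Sum>j=1..d. Const (A i j) * Var j) = (\<Sum>j=1..d. if j = i then Var i else 0)"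
        by (intro sum.cong) (auto simp: A_def)
      then show ?thesis using that by simp
    qed
    then have "linear_subst d A (subst_poly Var p) = subst_poly Var p"
      unfolding linear_subst_eq by (intro subst_poly_comp_eq[OF p]) simp
    then show ?thesis by (simp add: subst_poly_Var_id)
  qed
  then show ?thesis using that[of "linear_subst d A"] inv unfolding change_of_variables_def by blast
qed

theorem theorem3p5:
  shows "(\<forall>d r (I :: real mpoly set).
      almost_square_quadric_ideal d I \<and> has_cm_type d I (r + 1) \<longrightarrow>
      r < d \<and>
      (\<exists>\<sigma>. change_of_variables d \<sigma> \<and>
        (\<exists>J. gorenstein_ideal {r+1..d} J \<and>
          \<sigma> ` I = (genideal (poly_ring d) (Var ` {1..r}) \<cdot>\<^bsub>poly_ring d\<^esub> max_ideal d)
            <+>\<^bsub>poly_ring d\<^esub> genideal (poly_ring d) J) \<and>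
        (\<exists>\<tau> \<epsilon>. change_of_variables d \<tau> \<and> (\<forall>k. \<epsilon> k \<in> {1, -1}) \<and>
          \<tau> ` (\<sigma> ` I) = normal_form r d \<epsilon> \<and>
          (\<exists>M B. M \<subseteq> carrier (poly_ring d) \<and> B \<subseteq> carrier (poly_ring d) \<and>
            (\<forall>p\<in>M. monomial p) \<and> (\<forall>p\<in>B. binomial_poly p) \<and>
            finite B \<and> card B = d - r - 1 \<and>
            \<tau> ` (\<sigma> ` I) = genideal (poly_ring d) (M \<union> B)))) \<and>
      K_mixed r d <+>\<^bsub>poly_ring d\<^esub> squares r d =
        genideal (poly_ring d) (Var ` {1..r}) \<cdot>\<^bsub>poly_ring d\<^esub> (max_ideal d :: real mpoly set)) \<and>
    (\<forall>d r (I :: 'k::field mpoly set) \<rho> \<epsilon>.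
      almost_square_quadric_ideal d I \<and> r \<le> d \<and>
      change_of_variables d \<rho> \<and> (\<forall>k. \<epsilon> k \<in> {1, -1}) \<and> \<rho> ` I = normal_form r d \<epsilon> \<longrightarrow>
      has_cm_type d I (r + 1))"
proof (intro conjI[of "\<forall>d r. _ d r"] allI impI; elim conjE)
  fix d r and I :: "real mpoly set"
  assume asq: "almost_square_quadric_ideal d I" and cm: "has_cm_type d I (r + 1)"
  obtain \<sigma> r' \<epsilon> where \<sigma>: "change_of_variables d \<sigma>" and rd': "r' + 2 \<le> d"
    and \<epsilon>: "\<And>k. \<epsilon> k \<in> {1, -1}" and img': "\<sigma> ` I = normal_form r' d \<epsilon>" and I: "ideal I (poly_ring d)"
    using real_normal_form[OF asq] by metis
  \<comment> \<open>The type ties the dimension of the radical found by diagonalization to the given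
    r.\<close>
  have "r' = r" using cm cm_type_normal_form[OF \<sigma> I rd' \<epsilon> img'] by simp
  note rd = rd'[unfolded this] and img = img'[unfolded this]
  have r: "r \<le> d" using rd by simp
  have \<epsilon>2: "\<epsilon> k * \<epsilon> k = 1" for k using \<epsilon>[of k] by auto
  have \<epsilon>0: "\<epsilon> k \<noteq> 0" for k using \<epsilon>2[of k] by auto
  let ?J = "diag_ideal {r + 1..d} (nf_coeff r \<epsilon>)"
  have gor: "gorenstein_ideal {r + 1..d} ?J"
  proof (rule gorenstein_diag_ideal[of _ "r + 1"])
    show "nf_coeff r \<epsilon> k \<noteq> 0" if "k \<in> {r + 1..d}" for k
      using nf_coeff_square[where \<epsilon> = \<epsilon>, OF \<epsilon>2, of r k] that by auto
  qed (use rd in auto)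
  have dec: "\<sigma> ` I = (genideal (poly_ring d) (Var ` {1..r}) \<cdot>\<^bsub>poly_ring d\<^esub> max_ideal d)
    <+>\<^bsub>poly_ring d\<^esub> genideal (poly_ring d) ?J"
    unfolding img by (rule normal_form_decomposition[where \<epsilon> = \<epsilon>, OF rd \<epsilon>2])
  \<comment> \<open>The diagonalization already includes the scaling to signs, so \<sigma> reaches
    the normal form and the identity serves as the additional change of variables.\<close>
  obtain \<tau> :: "real mpoly \<Rightarrow> real mpoly" where \<tau>: "change_of_variables d \<tau>"
    "\<And>p. p \<in> carrier (poly_ring d) \<Longrightarrow> \<tau> p = p"
    using change_of_variables_identity by blast
  have "\<sigma> p \<in> carrier (poly_ring d)" if "p \<in> I" for p
    using \<sigma> ideal_mpoly_subset[OF I that] unfolding change_of_variables_def by auto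
  then have "\<tau> ` (\<sigma> ` I) = \<sigma> ` I" using \<tau>(2) by (force simp: image_image)
  then have \<tau>img: "\<tau> ` (\<sigma> ` I) = normal_form r d \<epsilon>" using img by simp
  have MB: "\<exists>M B. M \<subseteq> carrier (poly_ring d) \<and> B \<subseteq> carrier (poly_ring d) \<and>
      (\<forall>p\<in>M. monomial p) \<and> (\<forall>p\<in>B. binomial_poly p) \<and> finite B \<and> card B = d - r - 1 \<and>
      \<tau> ` (\<sigma> ` I) = genideal (poly_ring d) (M \<union> B)"
    using nf_monomials_carrier nf_binomials_carrier monomial_nf_monomials
      binomial_nf_binomials[where \<epsilon> = \<epsilon>, OF \<epsilon>0] card_nf_binomials[where \<epsilon> = \<epsilon>, OF \<epsilon>0]
    by (intro exI[of _ "nf_monomials r d"] exI[of _ "nf_binomials r d \<epsilon>"] conjI ballI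
        \<tau>img[unfolded normal_form_eq[OF r]])
      (auto simp: nf_binomials_def)
  have rlt: "r < d" using rd by simp
  note K = K_mixed_squares[OF r, where 'k = real]
  show "r < d \<and>
      (\<exists>\<sigma>. change_of_variables d \<sigma> \<and>
        (\<exists>J. gorenstein_ideal {r+1..d} J \<and>
          \<sigma> ` I = (genideal (poly_ring d) (Var ` {1..r}) \<cdot>\<^bsub>poly_ring d\<^esub> max_ideal d)
            <+>\<^bsub>poly_ring d\<^esub> genideal (poly_ring d) J) \<and>
        (\<exists>\<tau> \<epsilon>. change_of_variables d \<tau> \<and> (\<forall>k. \<epsilon> k \<in> {1, -1}) \<and>
          \<tau> ` (\<sigma> ` I) = normal_form r d \<epsilon> \<and>
          (\<exists>M B. M \<subseteq> carrier (poly_ring d) \<and> B \<subseteq> carrier (poly_ring d) \<and>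
            (\<forall>p\<in>M. monomial p) \<and> (\<forall>p\<in>B. binomial_poly p) \<and>
            finite B \<and> card B = d - r - 1 \<and>
            \<tau> ` (\<sigma> ` I) = genideal (poly_ring d) (M \<union> B)))) \<and>
      K_mixed r d <+>\<^bsub>poly_ring d\<^esub> squares r d =
        genideal (poly_ring d) (Var ` {1..r}) \<cdot>\<^bsub>poly_ring d\<^esub> (max_ideal d :: real mpoly set)"
    by (rule conjI, fact rlt, rule conjI, rule exI[of _ \<sigma>], rule conjI, fact \<sigma>, rule conjI,
        rule exI[of _ ?J], rule conjI, fact gor, fact dec, rule exI[of _ \<tau>], rule exI[of _ \<epsilon>],
        rule conjI, fact \<tau>(1), rule conjI, rule allI, fact \<epsilon>, rule conjI, fact \<tau>img, fact MB, fact K)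
next
  fix d r and I :: "'k mpoly set" and \<rho> \<epsilon>
  assume asq: "almost_square_quadric_ideal d I" and r: "r \<le> d" and \<rho>: "change_of_variables d \<rho>"
    and \<epsilon>: "\<forall>k. \<epsilon> k \<in> {1, -1}" and img: "\<rho> ` I = normal_form r d \<epsilon>"
  obtain S where S: "S \<subseteq> carrier (poly_ring d)" "I = genideal (poly_ring d) S"
    using almost_square_quadric_idealE[OF asq] by metis
  have I: "ideal I (poly_ring d)" unfolding S(2) by (rule genideal_mpoly_ideal[OF S(1)])
  have rd: "r + 2 \<le> d" by (rule converse_rank_bound[OF asq r \<rho> img])
  show "has_cm_type d I (r + 1)"
    using cm_type_normal_form[OF \<rho> I rd _ img] \<epsilon> by blast
qed

end
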